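(* Assume $\operatorname{tr} B\ge 0$ and $D_0>D_\infty$, and suppose that for some $\gamma>0$ one has $V(t)\ge\gamma\min\{t^{D_0/2},t^{D_\infty/2}\}$ for every $t>0$. Then for every $0<s<1/2$ there exists a constant $i(s)>0$, depending only on $N,D_0,D_\infty,s,\gamma$, such that for every measurable $E\subset\mathbb{R}^N$ with $|E|<\infty$, $$\mathfrak P^{\mathscr A}_s(E)\ \ge\ i(s)\,\min\Big\{|E|^{\frac{D_0-2s}{D_0}},\,|E|^{\frac{D_\infty-2s}{D_\infty}}\Big\}.$$
   Context: Let $N\ge 2$. Let $Q,B$ be real constant $N\times N$ matrices with $Q=Q^\star\ge 0$, and let $\mathscr A u=\operatorname{tr}(Q\nabla^2u)+\langle BX,\nabla u\rangle$ on $\mathbb{R}^N$. Assume that $K(t)=\frac1t\int_0^t e^{rB}Qe^{rB^\star}\,dr$ is positive definite for every $t>0$. Let $\omega_N$ be the volume of the unit ball of $\mathbb{R}^N$, $V(t)=\omega_N(\det(tK(t)))^{1/2}$, $m_t(X,Y)^2=\langle K(t)^{-1}(Y-e^{tB}X),\,Y-e^{tB}X\rangle$, and $p(X,Y,t)=(4\pi)^{-N/2}(\det(tK(t)))^{-1/2}\exp\!\big(-m_t(X,Y)^2/(4t)\big)$. The semigroup is $P_tf(X)=\int_{\mathbb{R}^N}p(X,Y,t)f(Y)\,dY$, $t>0$. $\mathscr S$ is the Schwartz class on $\mathbb{R}^N$; $L^p=L^p(\mathbb{R}^N)$; $|E|$ is Lebesgue measure and $\mathbf 1_E$ the indicator function.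 Intrinsic dimensions: $D_\infty=\sup\{\alpha>0:\int_1^\infty t^{\alpha/2-1}V(t)^{-1}dt<\infty\}$ (set $D_\infty=0$ if this set is empty); $D_0\ge N$ is the number such that $V(t)$ is comparable to $t^{D_0/2}$ as $t\to0^+$ (i.e. $c\,t^{D_0/2}\le V(t)\le C\,t^{D_0/2}$ for $0<t\le1$, some $c,C>0$). For $0<s<1$ and $f\in\mathscr S$, $(-\mathscr A)^sf(X)=-\frac{s}{\Gamma(1-s)}\int_0^\infty t^{-1-s}\,[P_tf(X)-f(X)]\,dt$. Nonlocal perimeter: for $f\in L^1$ let $\mathscr F(f)$ be the set of sequences $\{f_k\}_{k\in\mathbb N}\subset\mathscr S$ with $f_k\to f$ in $L^1$; for $0<s<1/2$ and measurable $E$ with $|E|<\infty$, $$\mathfrak P^{\mathscr A}_s(E)=\inf_{\{f_k\}\in\mathscr F(\mathbf 1_E)}\ \liminf_{k\to\infty}\|(-\mathscr A)^sf_k\|_{L^1}\in[0,\infty].$$ *)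

theory Defs
  imports "HOL-Analysis.Analysis"
begin

primrec mpow :: "real^'n^'n \<Rightarrow> nat \<Rightarrow> real^'n^'n" where
  "mpow A 0 = mat 1"
| "mpow A (Suc k) = A ** mpow A k"

definition mexp :: "real \<Rightarrow> real^'n^'n \<Rightarrow> real^'n^'n" where
  "mexp t A = (\<Sum>k. (t ^ k / fact k) *\<^sub>R mpow A k)"

definition Kmat :: "real^'n^'n \<Rightarrow> real^'n^'n \<Rightarrow> real \<Rightarrow> real^'n^'n" where
  "Kmat Q B t = (1 / t) *\<^sub>R integral {0..t} (\<lambda>r. mexp r B ** Q ** transpose (mexp r B))"

definition omegaN :: "'n::finite itself \<Rightarrow> real" where
  "omegaN _ = measure lebesgue (ball (0::real^'n) 1)"

definition Vol :: "real^'n^'n \<Rightarrow> real^'n^'n \<Rightarrow> real \<Rightarrow> real" where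
  "Vol Q B t = omegaN TYPE('n) * sqrt (det (t *\<^sub>R Kmat Q B t))"

definition msq :: "real^'n^'n \<Rightarrow> real^'n^'n \<Rightarrow> real \<Rightarrow> real^'n \<Rightarrow> real^'n \<Rightarrow> real" where
  "msq Q B t X Y = (matrix_inv (Kmat Q B t) *v (Y - mexp t B *v X)) \<bullet> (Y - mexp t B *v X)"

definition pker :: "real^'n^'n \<Rightarrow> real^'n^'n \<Rightarrow> real^'n \<Rightarrow> real^'n \<Rightarrow> real \<Rightarrow> real" where
  "pker Q B X Y t = (4 * pi) powr (- real CARD('n) / 2) * (det (t *\<^sub>R Kmat Q B t)) powr (-1/2)
      * exp (- msq Q B t X Y / (4 * t))"

definition Psg :: "real^'n^'n \<Rightarrow> real^'n^'n \<Rightarrow> real \<Rightarrow> (real^'n \<Rightarrow> real) \<Rightarrow> real^'n \<Rightarrow> real" where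
  "Psg Q B t f X = (\<integral>Y. pker Q B X Y t * f Y \<partial>lborel)"

fun dder :: "(real^'n) list \<Rightarrow> (real^'n \<Rightarrow> real) \<Rightarrow> real^'n \<Rightarrow> real" where
  "dder [] f = f"
| "dder (v # vs) f = (\<lambda>x. frechet_derivative (dder vs f) (at x) v)"

definition schwartz :: "(real^'n \<Rightarrow> real) \<Rightarrow> bool" where
  "schwartz f \<longleftrightarrow>
     (\<forall>vs. set vs \<subseteq> cart_basis \<longrightarrow>
        (\<forall>x. dder vs f differentiable at x) \<and>
        (\<forall>m::nat. bounded (range (\<lambda>x. norm x ^ m * dder vs f x))))"

definition fracA :: "real^'n^'n \<Rightarrow> real^'n^'n \<Rightarrow> real \<Rightarrow> (real^'n \<Rightarrow> real) \<Rightarrow> real^'n \<Rightarrow> real" where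
  "fracA Q B s f X = - (s / Gamma (1 - s)) *
      (\<integral>t\<in>{0<..}. t powr (-1 - s) * (Psg Q B t f X - f X) \<partial>lborel)"

definition L1norm :: "(real^'n \<Rightarrow> real) \<Rightarrow> ennreal" where
  "L1norm g = (\<integral>\<^sup>+ x. ennreal \<bar>g x\<bar> \<partial>lborel)"

definition approx_seqs :: "(real^'n \<Rightarrow> real) \<Rightarrow> (nat \<Rightarrow> real^'n \<Rightarrow> real) set" where
  "approx_seqs f = {fs. (\<forall>k. schwartz (fs k)) \<and> (\<lambda>k. L1norm (\<lambda>x. fs k x - f x)) \<longlonglongrightarrow> 0}"

definition perimA :: "real^'n^'n \<Rightarrow> real^'n^'n \<Rightarrow> real \<Rightarrow> (real^'n) set \<Rightarrow> ennreal" where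
  "perimA Q B s E = (INF fs\<in>approx_seqs (indicator E). liminf (\<lambda>k. L1norm (fracA Q B s (fs k))))"

definition Dinfty :: "real^'n^'n \<Rightarrow> real^'n^'n \<Rightarrow> ereal" where
  "Dinfty Q B = (let S = {\<alpha>::real. \<alpha> > 0 \<and>
        (\<integral>\<^sup>+ t. ennreal (indicator {1..} t * t powr (\<alpha>/2 - 1) / Vol Q B t) \<partial>lborel) < \<infinity>}
     in if S = {} then 0 else Sup (ereal ` S))"

definition is_D0 :: "real^'n^'n \<Rightarrow> real^'n^'n \<Rightarrow> real \<Rightarrow> bool" where
  "is_D0 Q B D0 \<longleftrightarrow> (\<exists>c C. c > 0 \<and> C > 0 \<and>
      (\<forall>t. 0 < t \<and> t \<le> 1 \<longrightarrow> c * t powr (D0/2) \<le> Vol Q B t \<and> Vol Q B t \<le> C * t powr (D0/2)))"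

definition admissible :: "real^'n^'n \<Rightarrow> real^'n^'n \<Rightarrow> bool" where
  "admissible Q B \<longleftrightarrow> transpose Q = Q \<and> (\<forall>x. 0 \<le> x \<bullet> (Q *v x)) \<and>
      (\<forall>t>0. \<forall>x. x \<noteq> 0 \<longrightarrow> 0 < x \<bullet> (Kmat Q B t *v x))"

end

theory Submission
  imports Defs "HOL-Probability.Probability"
begin

text \<open>
  Everything reduces to the smoothing estimate
  $\|P_t f - f\|_1 \le C_s t^s \|(-A)^s f\|_1$. Testing it on $f \approx 1_E$ and using
  $\|P_t 1_E\|_\infty \le c |E| / V(t)$ gives $|E| \le 4 C_s t^s \mathfrak P_s(E)$ as soon as
  $V(t) \ge 2c|E|$, and the lower bound on $V$ allows
  $t = \max\{(\mu|E|)^{2/D_0}, (\mu|E|)^{2/D_\infty}\}$.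

  For fixed $X$ put $h(u) = P_u f(X)$. The estimate comes from the scalar identity
  $\int k_t(\tau)\, (D^s h)(\tau)\, d\tau = c_s (h(t) - h(0))$, where
  $k_t(\tau) = (\tau-t)_+^{s-1} - \tau_+^{s-1}$ has $L^1$ norm of order $t^s$ and $D^s h (\tau)$ is
  $P_\tau (-A)^s f (X)$ up to a constant; then one integrates in $X$, $P_\tau$ being an $L^1$ contraction
  because $\operatorname{tr} B \ge 0$. To avoid differentiating the semigroup in time, $h$ is first replaced by
  its averages over $[u, u+\delta]$, whose derivatives are difference quotients, and $\delta \to 0$
  is handled by Fatou's lemma.

  The condition $\operatorname{tr} B \ge 0$ also gives $\det (2tK(2t)) \ge 2^N \det(tK(t))$, so that $V$ grows at least linearly.
  This supplies the decay of $h$ at infinity and shows $D_\infty > 0$.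
\<close>

section \<open>Linear change of variables\<close>

text \<open>The restriction s < 1/2 is what lets the argument run without the generator. A Schwartz
  function is bounded and Lipschitz, and for r \<le> 1 the kernel of P_r moves mass from X by a mean
  distance of at most C (1 + |X|) sqrt r. So P_r f - f is of order sqrt r near r = 0, and its
  product with r^(-1-s) is integrable there. The resulting constants depend on f and X, but they
  only justify exchanges of integrals and limits; none of them reaches the smoothing estimate, which
  contains s, t and the L^1 norm of the fractional power.

  Two facts about powers carry the scalar identity. The tail formula u^(-s) = s * (integral of
  r^(-1-s) over r > u) turns increments of h over a step d into an average of D^s h over an interval
  of length d. The Beta integral of (\<tau> - t)^(s-1) (u - \<tau>)^(-s) over t < \<tau> < u does
  not depend on t and u, so the difference of two such powers in k_t produces the indicator of (0,
  t].\<close>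

lemma nn_integral_lborel_shear:
  fixes f :: "'a::euclidean_space \<Rightarrow> ennreal"
  assumes [measurable]: "f \<in> borel_measurable borel"
    and m: "m \<in> Basis" and n: "n \<in> Basis" and mn: "m \<noteq> n"
  shows "(\<integral>\<^sup>+x. f (x + (c * (x \<bullet> n)) *\<^sub>R m) \<partial>lborel) = integral\<^sup>N lborel f"
proof -
  interpret product_sigma_finite "\<lambda>_::'a. lborel :: real measure" ..
  define I where "I = Basis - {m}"
  have I: "finite I" "m \<notin> I" "insert m I = Basis" "n \<in> I"
    using m n mn by (auto simp: I_def)
  define S where "S = (\<lambda>g::'a \<Rightarrow> real. \<Sum>b\<in>Basis. g b *\<^sub>R b)"
  have Sm[measurable]: "S \<in> measurable (Pi\<^sub>M (insert m I) (\<lambda>_. lborel)) borel"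
    unfolding S_def I(3) by measurable
  have lb: "(\<integral>\<^sup>+x. g x \<partial>lborel) = (\<integral>\<^sup>+x. \<integral>\<^sup>+y. g (S (x(m := y))) \<partial>lborel \<partial>Pi\<^sub>M I (\<lambda>_. lborel))"
    if [measurable]: "g \<in> borel_measurable borel" for g :: "'a \<Rightarrow> ennreal"
  proof -
    have "(\<integral>\<^sup>+x. g x \<partial>lborel) = (\<integral>\<^sup>+x. g (S x) \<partial>Pi\<^sub>M (insert m I) (\<lambda>_. lborel))"
      unfolding I(3) S_def by (subst lborel_eq) (simp add: nn_integral_distr)
    also have "\<dots> = (\<integral>\<^sup>+x. \<integral>\<^sup>+y. g (S (x(m := y))) \<partial>lborel \<partial>Pi\<^sub>M I (\<lambda>_. lborel))"
      by (subst product_nn_integral_insert[OF I(1,2)]) auto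
    finally show ?thesis .
  qed
  have Sn: "S h \<bullet> n = h n" for h
    using n unfolding S_def by simp
  have S_upd: "S (h(m := z)) = z *\<^sub>R m + (\<Sum>b\<in>I. h b *\<^sub>R b)" for h z
    using I(1,2) unfolding S_def I(3)[symmetric] by (simp add: sum.insert) (rule sum.cong, auto)
  \<comment> \<open>Since m and n are different, coordinate n is fixed while coordinate m is
    integrated, so on each line the shear is a translation.\<close>
  have upd: "S (h(m := y)) + (c * (S (h(m := y)) \<bullet> n)) *\<^sub>R m = S (h(m := c * h n + 1 * y))" for h y
    using mn unfolding Sn by (simp add: S_upd algebra_simps)
  have meas: "(\<lambda>y. f (S (h(m := y)))) \<in> borel_measurable borel" for h
    unfolding S_upd by simp
  have "(\<integral>\<^sup>+x. f (x + (c * (x \<bullet> n)) *\<^sub>R m) \<partial>lborel) =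
      (\<integral>\<^sup>+h. \<integral>\<^sup>+y. f (S (h(m := y)) + (c * (S (h(m := y)) \<bullet> n)) *\<^sub>R m) \<partial>lborel \<partial>Pi\<^sub>M I (\<lambda>_. lborel))"
    by (rule lb) simp
  also have "\<dots> = (\<integral>\<^sup>+h. \<integral>\<^sup>+y. f (S (h(m := c * h n + 1 * y))) \<partial>lborel \<partial>Pi\<^sub>M I (\<lambda>_. lborel))"
    unfolding upd ..
  also have "\<dots> = (\<integral>\<^sup>+h. \<integral>\<^sup>+y. f (S (h(m := y))) \<partial>lborel \<partial>Pi\<^sub>M I (\<lambda>_. lborel))"
  proof (rule nn_integral_cong)
    fix h
    show "(\<integral>\<^sup>+y. f (S (h(m := c * h n + 1 * y))) \<partial>lborel) = (\<integral>\<^sup>+y. f (S (h(m := y))) \<partial>lborel)"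
      using nn_integral_real_affine[OF meas, of 1 h "c * h n"] by simp
  qed
  also have "\<dots> = integral\<^sup>N lborel f" by (rule lb[symmetric]) simp
  finally show ?thesis .
qed

lemma nn_integral_lborel_swap:
  fixes f :: "real^'n \<Rightarrow> ennreal"
  assumes [measurable]: "f \<in> borel_measurable borel"
  shows "(\<integral>\<^sup>+x. f (\<chi> i. x $ Transposition.transpose m n i) \<partial>lborel) = integral\<^sup>N lborel f"
proof -
  define T where "T = (\<lambda>x::real^'n. \<chi> i. x $ Transposition.transpose m n i)"
  have "linear T" unfolding T_def by (rule linearI) (auto simp: vec_eq_iff)
  then have [measurable]: "T \<in> borel_measurable borel"
    by (intro borel_measurable_continuous_onI linear_continuous_on linear_conv_bounded_linear[THEN iffD1])
  have prodB: "(\<Prod>b\<in>Basis. z \<bullet> b) = (\<Prod>i\<in>UNIV. z $ i)" for z :: "real^'n"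
  proof -
    have "(\<Prod>b\<in>Basis. z \<bullet> b) = (\<Prod>b\<in>(\<lambda>i. axis i 1) ` UNIV. z \<bullet> b)"
      by (rule prod.cong) (auto simp: Basis_vec_def)
    also have "\<dots> = (\<Prod>i\<in>UNIV. z $ i)"
      by (subst prod.reindex) (auto simp: inj_on_def axis_eq_axis inner_axis)
    finally show ?thesis .
  qed
  \<comment> \<open>\<open>lborel\<close> is determined by its values on boxes. A transposition is
    an involution, so the preimage of a box is the box with permuted corners, and the product of the
    side lengths is only reordered.\<close>
  have "lborel = distr lborel borel T"
  proof (rule lborel_eqI)
    fix l u :: "real^'n" assume le: "\<And>b. b \<in> Basis \<Longrightarrow> l \<bullet> b \<le> u \<bullet> b"
    have le': "l $ i \<le> u $ i" for i using le[of "axis i 1"] by (simp add: inner_axis axis_in_Basis_iff)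
    have bij: "bij (Transposition.transpose m n)" by simp
    have eq: "T -` box l u = box (T l) (T u)"
    proof (intro set_eqI iffI)
      fix x assume "x \<in> T -` box l u"
      then have *: "l $ i < x $ Transposition.transpose m n i \<and> x $ Transposition.transpose m n i < u $ i" for i
        by (auto simp: mem_box_cart T_def)
      show "x \<in> box (T l) (T u)"
        using *[of "Transposition.transpose m n _"] by (auto simp: mem_box_cart T_def)
    next
      fix x assume "x \<in> box (T l) (T u)"
      then have *: "l $ Transposition.transpose m n i < x $ i \<and> x $ i < u $ Transposition.transpose m n i" for i
        by (auto simp: mem_box_cart T_def)
      show "x \<in> T -` box l u"
        using *[of "Transposition.transpose m n _"] by (auto simp: mem_box_cart T_def)
    qed
    have "emeasure (distr lborel borel T) (box l u) = emeasure lborel (box (T l) (T u))"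
      by (simp add: emeasure_distr eq)
    also have "\<dots> = (\<Prod>b\<in>Basis. (T u - T l) \<bullet> b)"
      by (rule emeasure_lborel_box) (use le' in \<open>auto simp: Basis_vec_def T_def inner_axis\<close>)
    also have "(\<Prod>b\<in>Basis. (T u - T l) \<bullet> b) = (\<Prod>i\<in>UNIV. (u - l) $ Transposition.transpose m n i)"
      unfolding prodB by (simp add: T_def)
    also have "\<dots> = (\<Prod>i\<in>UNIV. (u - l) $ i)"
      by (rule prod.reindex_bij_betw[OF bij])
    also have "\<dots> = (\<Prod>b\<in>Basis. (u - l) \<bullet> b)" by (rule prodB[symmetric])
    finally show "emeasure (distr lborel borel T) (box l u) = ennreal (\<Prod>b\<in>Basis. (u - l) \<bullet> b)" .
  qed simp
  then have "integral\<^sup>N lborel f = (\<integral>\<^sup>+x. f x \<partial>distr lborel borel T)" by simp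
  also have "\<dots> = (\<integral>\<^sup>+x. f (T x) \<partial>lborel)" by (rule nn_integral_distr) simp_all
  finally show ?thesis unfolding T_def by (rule sym)
qed

lemma borel_measurable_matrix_vector_mult[measurable]:
  "(\<lambda>x. A *v x :: real^'m) \<in> borel_measurable borel" for A :: "real^'n^'m"
  by (intro borel_measurable_continuous_onI linear_continuous_on matrix_vector_mul_bounded_linear)

text \<open>Both sides are multiplicative in A, so elementary matrices suffice: a zero row
  contradicts det A \<noteq> 0, a diagonal matrix rescales the axes, and transpositions and shears
  preserve Lebesgue measure. The function is quantified inside the induction because the product
  case applies one hypothesis to f composed with a matrix.\<close>

theorem nn_integral_lborel_matrix:
  fixes A :: "real^'n^'n" and f :: "real^'n \<Rightarrow> ennreal"
  assumes "det A \<noteq> 0" "f \<in> borel_measurable borel"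
  shows "ennreal \<bar>det A\<bar> * (\<integral>\<^sup>+x. f (A *v x) \<partial>lborel) = integral\<^sup>N lborel f"
proof -
  have "det A \<noteq> 0 \<longrightarrow> (\<forall>f\<in>borel_measurable borel.
      ennreal \<bar>det A\<bar> * (\<integral>\<^sup>+x. f (A *v x) \<partial>lborel) = integral\<^sup>N lborel f)"
  proof (induction A rule: induct_matrix_elementary)
    case (1 A B)
    show ?case
    proof (intro impI ballI)
      fix f :: "real^'n \<Rightarrow> ennreal"
      assume d: "det (A ** B) \<noteq> 0" and [measurable]: "f \<in> borel_measurable borel"
      have dd: "det A \<noteq> 0" "det B \<noteq> 0" using d by (auto simp: det_mul)
      have "ennreal \<bar>det (A ** B)\<bar> * (\<integral>\<^sup>+x. f ((A ** B) *v x) \<partial>lborel)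
         = ennreal \<bar>det A\<bar> * (ennreal \<bar>det B\<bar> * (\<integral>\<^sup>+x. f (A *v (B *v x)) \<partial>lborel))"
        by (simp add: det_mul abs_mult ennreal_mult mult.assoc matrix_vector_mul_assoc)
      also have "\<dots> = ennreal \<bar>det A\<bar> * (\<integral>\<^sup>+x. f (A *v x) \<partial>lborel)"
        using 1(2) dd by (auto dest!: bspec[where x="\<lambda>x. f (A *v x)"])
      also have "\<dots> = integral\<^sup>N lborel f"
        using 1(1) dd by simp
      finally show "ennreal \<bar>det (A ** B)\<bar> * (\<integral>\<^sup>+x. f ((A ** B) *v x) \<partial>lborel) = integral\<^sup>N lborel f" .
    qed
  next
    case (2 A i)
    then show ?case by (simp add: det_zero_row)
  next
    case (3 A)
    show ?case
    proof (intro impI ballI)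
      fix f :: "real^'n \<Rightarrow> ennreal"
      assume d: "det A \<noteq> 0" and [measurable]: "f \<in> borel_measurable borel"
      define c where "c = (\<lambda>b::real^'n. (A *v b) \<bullet> b)"
      have Aax: "(A *v axis i 1) = A $ i $ i *\<^sub>R axis i 1" for i
        using 3 unfolding matrix_vector_mult_basis by (auto simp: vec_eq_iff column_def axis_def)
      have cax: "c (axis i 1) = A $ i $ i" for i
        unfolding c_def Aax by (simp add: inner_axis_axis)
      have dA: "det A = (\<Prod>i\<in>UNIV. A $ i $ i)" by (rule det_diagonal) (rule 3)
      have nz: "A $ i $ i \<noteq> 0" for i using d dA by auto
      have c0: "c j \<noteq> 0" if "j \<in> Basis" for j
        using that nz by (auto simp: Basis_vec_def cax)
      have "(\<Prod>j\<in>Basis. \<bar>c j\<bar>) = (\<Prod>b\<in>(\<lambda>i. axis i 1) ` UNIV. \<bar>c b\<bar>)"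
        by (rule prod.cong) (auto simp: Basis_vec_def)
      also have "\<dots> = \<bar>det A\<bar>"
        by (subst prod.reindex) (auto simp: inj_on_def axis_eq_axis cax dA abs_prod)
      finally have pc: "(\<Prod>j\<in>Basis. \<bar>c j\<bar>) = \<bar>det A\<bar>" .
      have T: "0 + (\<Sum>j\<in>Basis. (c j * (x \<bullet> j)) *\<^sub>R j) = A *v x" for x
      proof -
        have "A *v x = A *v (\<Sum>j\<in>Basis. (x \<bullet> j) *\<^sub>R j)" by (simp add: euclidean_representation)
        also have "\<dots> = (\<Sum>j\<in>Basis. (x \<bullet> j) *\<^sub>R (A *v j))"
          by (simp add: linear_sum[OF matrix_vector_mul_linear] matrix_vector_mult_scaleR)
        also have "\<dots> = (\<Sum>j\<in>Basis. (c j * (x \<bullet> j)) *\<^sub>R j)"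
          by (rule sum.cong) (auto simp: Basis_vec_def cax Aax)
        finally show ?thesis by simp
      qed
      have "integral\<^sup>N lborel f = (\<integral>\<^sup>+x. f x \<partial>density (distr lborel borel (\<lambda>x. A *v x)) (\<lambda>_. \<bar>det A\<bar>))"
        using lborel_affine_euclidean[of c 0, OF c0] unfolding pc T by simp
      also have "\<dots> = ennreal \<bar>det A\<bar> * (\<integral>\<^sup>+x. f (A *v x) \<partial>lborel)"
        by (simp add: nn_integral_density nn_integral_distr nn_integral_cmult)
      finally show "ennreal \<bar>det A\<bar> * (\<integral>\<^sup>+x. f (A *v x) \<partial>lborel) = integral\<^sup>N lborel f" by simp
    qed
  next
    case (4 m n)
    define A :: "real^'n^'n" where "A = (\<chi> i j. mat 1 $ i $ Transposition.transpose m n j)"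
    have "det A = of_int (sign (Transposition.transpose m n)) * det (mat 1 :: real^'n^'n)"
      unfolding A_def by (rule det_permute_columns) (simp add: permutes_swap_id)
    then have d: "\<bar>det A\<bar> = 1" by (simp add: sign_def)
    have "A *v x = (\<chi> i. x $ Transposition.transpose m n i)" for x
    proof -
      have "(A *v x) $ i = (\<Sum>j\<in>UNIV. if j = Transposition.transpose m n i then x $ j else 0)" for i
        unfolding A_def matrix_vector_mult_def mat_def vec_lambda_beta
        by (rule sum.cong) auto
      then show ?thesis by (simp add: vec_eq_iff)
    qed
    then show ?case using d nn_integral_lborel_swap by (auto simp flip: A_def)
  next
    case (5 m n c)
    define A :: "real^'n^'n" where "A = (\<chi> i j. if i = m \<and> j = n then c else of_bool (i = j))"
    have "A = (\<chi> k. if k = m then row m (mat 1) + c *s row n (mat 1) else row k (mat 1))"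
      using 5 unfolding A_def by (auto simp: vec_eq_iff row_def mat_def)
    then have d: "det A = 1" using det_row_operation[OF 5, of "mat 1" c] by simp
    have "A *v x = x + (c * (x \<bullet> axis n 1)) *\<^sub>R axis m 1" for x
    proof -
      have "(A *v x) $ i = (\<Sum>j\<in>UNIV. (if j = i then x $ j else 0) + (if j = n then (if i = m then c * x $ j else 0) else 0))" for i
        unfolding A_def matrix_vector_mult_def vec_lambda_beta
        using 5 by (intro sum.cong) auto
      then show ?thesis unfolding inner_axis by (auto simp: vec_eq_iff sum.distrib axis_def)
    qed
    moreover have "axis m 1 \<in> (Basis :: (real^'n) set)" "axis n 1 \<in> (Basis :: (real^'n) set)"
      "axis m 1 \<noteq> (axis n 1 :: real^'n)"
      using 5 by (auto simp: axis_eq_axis axis_in_Basis_iff)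
    ultimately show ?case using d by (auto intro!: nn_integral_lborel_shear simp flip: A_def)
  qed
  then show ?thesis using assms by blast
qed

section \<open>Symmetric positive definite matrices and Gaussian integrals\<close>

lemma nn_integral_lborel_translate:
  fixes f :: "'a::euclidean_space \<Rightarrow> ennreal"
  assumes [measurable]: "f \<in> borel_measurable borel"
  shows "(\<integral>\<^sup>+x. f (x + a) \<partial>lborel) = integral\<^sup>N lborel f"
proof -
  have "integral\<^sup>N lborel f = (\<integral>\<^sup>+x. f x \<partial>density (distr lborel borel (\<lambda>x. a + 1 *\<^sub>R x)) (\<lambda>_. ennreal (\<bar>1\<bar>^DIM('a))))"
    using lborel_affine[of 1 a] by simp
  also have "\<dots> = (\<integral>\<^sup>+x. f (x + a) \<partial>lborel)"
    by (simp add: nn_integral_density nn_integral_distr add.commute)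
  finally show ?thesis by simp
qed

lemma nn_integral_lborel_reflect_translate:
  fixes f :: "'a::euclidean_space \<Rightarrow> ennreal"
  assumes [measurable]: "f \<in> borel_measurable borel"
  shows "(\<integral>\<^sup>+x. f (a - x) \<partial>lborel) = integral\<^sup>N lborel f"
proof -
  have "integral\<^sup>N lborel f = (\<integral>\<^sup>+x. f x \<partial>density (distr lborel borel (\<lambda>x. a + (-1) *\<^sub>R x)) (\<lambda>_. ennreal (\<bar>-1\<bar>^DIM('a))))"
    using lborel_affine[of "-1" a] by simp
  also have "\<dots> = (\<integral>\<^sup>+x. f (a - x) \<partial>lborel)"
    by (simp add: nn_integral_density nn_integral_distr)
  finally show ?thesis by simp
qed

section \<open>Positive definite matrices: orthonormal bases, inverses and congruence\<close>

lemma inner_matrix_transpose: "x \<bullet> (A *v y) = (transpose A *v x) \<bullet> y" for A :: "real^'n^'m"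
  by (simp add: dot_lmul_matrix)

definition spd :: "real^'n^'n \<Rightarrow> bool" where
  "spd M \<longleftrightarrow> transpose M = M \<and> (\<forall>x. x \<noteq> 0 \<longrightarrow> 0 < x \<bullet> (M *v x))"

lemma spdD: "spd M \<Longrightarrow> transpose M = M" "spd M \<Longrightarrow> x \<noteq> 0 \<Longrightarrow> 0 < x \<bullet> (M *v x)"
  by (auto simp: spd_def)

lemma spd_nonneg: "spd M \<Longrightarrow> 0 \<le> x \<bullet> (M *v x)"
  by (cases "x = 0") (auto simp: spd_def less_imp_le)

lemma spd_sym: "spd M \<Longrightarrow> x \<bullet> (M *v y) = y \<bullet> (M *v x)"
  using inner_matrix_transpose[of x M y] by (simp add: spdD(1) inner_commute)

text \<open>Gram-Schmidt for the inner product x . M y, one index at a time: fewer than N vectors M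
  b_i leave a nonzero vector orthogonal to all of them, and this vector is normalised. Indexing by
  the column type lets the full family be read as a matrix.\<close>

lemma spd_orthonormal_family:
  assumes M: "spd (M :: real^'n^'n)" and "finite I"
  shows "\<exists>b::'n \<Rightarrow> real^'n. \<forall>i\<in>I. \<forall>j\<in>I. b i \<bullet> (M *v b j) = of_bool (i = j)"
  using assms(2)
proof (induction I)
  case (insert k I)
  then obtain b where b: "\<And>i j. i \<in> I \<Longrightarrow> j \<in> I \<Longrightarrow> b i \<bullet> (M *v b j) = of_bool (i = j)"
    by blast
  let ?S = "(\<lambda>i. M *v b i) ` I"
  have "dim ?S \<le> card ?S" by (rule dim_le_card') (use insert in simp)
  also have "\<dots> \<le> card I" by (rule card_image_le) (use insert in simp)
  also have "\<dots> < card (insert k I)" using insert by simp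
  also have "\<dots> \<le> DIM(real^'n)" using card_mono[of UNIV "insert k I"] by simp
  finally obtain x where x: "x \<noteq> 0" "\<And>y. y \<in> span ?S \<Longrightarrow> orthogonal x y"
    by (rule orthogonal_to_subspace_exists) blast
  have xo: "x \<bullet> (M *v b i) = 0" "b i \<bullet> (M *v x) = 0" if "i \<in> I" for i
    using x(2)[OF span_base, of "M *v b i"] that spd_sym[OF M] by (auto simp: orthogonal_def)
  define r where "r = sqrt (x \<bullet> (M *v x))"
  have r: "r > 0" "x \<bullet> (M *v x) = r * r" using spdD(2)[OF M x(1)] by (auto simp: r_def)
  have "\<forall>i\<in>insert k I. \<forall>j\<in>insert k I.
      (b(k := (1/r) *\<^sub>R x)) i \<bullet> (M *v (b(k := (1/r) *\<^sub>R x)) j) = of_bool (i = j)"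
    using insert.hyps b xo r by (auto simp: matrix_vector_mult_scaleR)
  then show ?case by blast
qed simp

text \<open>The columns of L are an M-orthonormal basis. This congruence to the identity takes the
  place of the spectral theorem: it gives the sign of the determinant and reduces Gaussian integrals
  to the standard one.\<close>

lemma spd_diagonalise:
  assumes M: "spd (M :: real^'n^'n)"
  obtains L :: "real^'n^'n" where "transpose L ** M ** L = mat 1"
proof -
  obtain b :: "'n \<Rightarrow> real^'n" where b: "\<And>i j. b i \<bullet> (M *v b j) = of_bool (i = j)"
    using spd_orthonormal_family[OF M, of UNIV] by auto
  define L :: "real^'n^'n" where "L = (\<chi> i j. b j $ i)"
  have col: "L *v axis j 1 = b j" for j
    by (simp add: matrix_vector_mult_basis column_def L_def vec_eq_iff)
  have comp: "A $ i $ j = axis i 1 \<bullet> (A *v axis j 1)" for A :: "real^'n^'n" and i j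
    by (simp add: matrix_vector_mult_basis column_def inner_axis')
  have "(transpose L ** M ** L) $ i $ j = mat 1 $ i $ j" for i j
  proof -
    have "(transpose L ** M ** L) $ i $ j = axis i 1 \<bullet> (transpose L *v (M *v (L *v axis j 1)))"
      unfolding comp[of "transpose L ** M ** L"] by (simp only: matrix_vector_mul_assoc matrix_mul_assoc)
    also have "\<dots> = (L *v axis i 1) \<bullet> (M *v (L *v axis j 1))"
      by (simp only: inner_matrix_transpose[of _ "transpose L"] transpose_transpose)
    finally show ?thesis unfolding col b by (simp add: mat_def)
  qed
  then show thesis by (intro that[of L]) (simp add: vec_eq_iff)
qed

lemma spd_det_pos:
  assumes "spd (M :: real^'n^'n)" shows "0 < det M"
proof -
  obtain L :: "real^'n^'n" where L: "transpose L ** M ** L = mat 1" using spd_diagonalise[OF assms] .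
  have "det (transpose L ** M ** L) = 1" unfolding L by simp
  then have "(det L)\<^sup>2 * det M = 1" by (simp add: det_mul power2_eq_square mult_ac)
  moreover from this have "0 < (det L)\<^sup>2" by auto
  ultimately show ?thesis using zero_less_mult_pos[of "(det L)\<^sup>2" "det M"] by simp
qed

lemma matrix_inv_cancel:
  fixes M :: "real^'n^'n"
  assumes "det M \<noteq> 0"
  shows "M ** matrix_inv M = mat 1" "matrix_inv M ** M = mat 1"
proof -
  have "\<exists>N. M ** N = mat 1 \<and> N ** M = mat 1"
    using assms invertible_det_nz[of M] by (auto simp: invertible_def)
  then have "M ** matrix_inv M = mat 1 \<and> matrix_inv M ** M = mat 1"
    unfolding matrix_inv_def by (rule someI_ex)
  then show "M ** matrix_inv M = mat 1" "matrix_inv M ** M = mat 1" by auto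
qed

lemma matrix_inv_cancel_vector:
  fixes M :: "real^'n^'n"
  assumes "det M \<noteq> 0"
  shows "M *v (matrix_inv M *v x) = x" "matrix_inv M *v (M *v x) = x"
  using matrix_inv_cancel[OF assms] by (simp_all add: matrix_vector_mul_assoc)

lemma matrix_inv_unique:
  fixes M :: "real^'n^'n"
  assumes "M ** N = mat 1"
  shows "matrix_inv M = N"
proof -
  have "det M * det N = 1" using assms by (metis det_I det_mul)
  then have "det M \<noteq> 0" by auto
  then have "matrix_inv M ** (M ** N) = N"
    by (simp add: matrix_mul_assoc matrix_inv_cancel)
  then show ?thesis using assms by simp
qed

lemma spd_matrix_inv:
  assumes M: "spd M" shows "spd (matrix_inv M)"
proof -
  have d: "det M \<noteq> 0" using spd_det_pos[OF M] by simp
  have "M ** transpose (matrix_inv M) = transpose (matrix_inv M ** M)"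
    using spdD(1)[OF M] by (simp add: matrix_transpose_mul)
  then have "M ** transpose (matrix_inv M) = mat 1"
    by (simp add: matrix_inv_cancel d)
  then have "matrix_inv M = transpose (matrix_inv M)" by (rule matrix_inv_unique)
  moreover have "0 < x \<bullet> (matrix_inv M *v x)" if "x \<noteq> 0" for x
  proof -
    define y where "y = matrix_inv M *v x"
    have x: "x = M *v y" by (simp add: y_def matrix_inv_cancel_vector d)
    then have "y \<noteq> 0" using that by auto
    then have "0 < y \<bullet> (M *v y)" by (rule spdD(2)[OF M])
    moreover have "x \<bullet> (matrix_inv M *v x) = (M *v y) \<bullet> y"
      by (subst x[symmetric]) (simp add: y_def)
    ultimately show ?thesis by (simp add: inner_commute)
  qed
  ultimately show ?thesis by (auto simp: spd_def)
qed

lemma det_matrix_inv: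
  fixes M :: "real^'n^'n"
  assumes "det M \<noteq> 0" shows "det (matrix_inv M) = 1 / det M"
  using matrix_inv_cancel(1)[OF assms] assms
  by (metis det_I det_mul nonzero_eq_divide_eq mult.commute)

lemma spd_add: "spd M \<Longrightarrow> spd N \<Longrightarrow> spd (M + N)"
  by (auto simp: spd_def transpose_def vec_eq_iff matrix_vector_mult_add_rdistrib inner_add_right add_pos_pos)

lemma spd_scaleR: "0 < c \<Longrightarrow> spd M \<Longrightarrow> spd (c *\<^sub>R M)"
  by (auto simp: spd_def transpose_scalar scaleR_matrix_vector_assoc[symmetric])

lemma spd_congruence:
  fixes A M :: "real^'n^'n"
  assumes "det A \<noteq> 0" "spd M" shows "spd (A ** M ** transpose A)"
proof -
  have "0 < x \<bullet> ((A ** M ** transpose A) *v x)" if "x \<noteq> 0" for x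
  proof -
    have "transpose A *v x \<noteq> 0"
    proof
      assume "transpose A *v x = 0"
      then have "matrix_inv (transpose A) *v (transpose A *v x) = 0" by simp
      then show False using assms that by (subst (asm) matrix_inv_cancel_vector) auto
    qed
    then have "0 < (transpose A *v x) \<bullet> (M *v (transpose A *v x))" by (rule spdD(2)[OF assms(2)])
    also have "\<dots> = x \<bullet> (A *v (M *v (transpose A *v x)))" by (rule inner_matrix_transpose[symmetric])
    also have "\<dots> = x \<bullet> ((A ** M ** transpose A) *v x)" by (simp only: matrix_vector_mul_assoc matrix_mul_assoc)
    finally show ?thesis .
  qed
  then show ?thesis
    using spdD(1)[OF assms(2)] by (simp add: spd_def matrix_transpose_mul matrix_mul_assoc)
qed

lemma det_scaleR: "det (c *\<^sub>R A) = c ^ CARD('n) * det A" for A :: "real^'n^'n"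
proof -
  have "det (c *\<^sub>R A) = det (\<chi> i. c *s A $ i)"
    by (rule arg_cong[where f=det]) (simp add: vec_eq_iff)
  also have "\<dots> = c ^ CARD('n) * det A" by (subst det_rows_mul) simp
  finally show ?thesis .
qed

section \<open>Gaussian integrals and the calculus of Gaussian kernels\<close>

lemma nn_integral_gaussian_1d: "(\<integral>\<^sup>+x. ennreal (exp (- x\<^sup>2 / 4)) \<partial>lborel) = ennreal (sqrt (4 * pi))"
proof -
  have "(\<integral>\<^sup>+x. ennreal (normal_density 0 (sqrt 2) x) \<partial>lborel) = 1"
    by (subst nn_integral_eq_integral) auto
  moreover have "ennreal (exp (- x\<^sup>2 / 4)) = ennreal (sqrt (4 * pi)) * ennreal (normal_density 0 (sqrt 2) x)" for x
    by (simp add: normal_density_def ennreal_mult[symmetric] real_sqrt_mult)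
  ultimately show ?thesis by (simp add: nn_integral_cmult)
qed

lemma nn_integral_gaussian_std:
  "(\<integral>\<^sup>+x. ennreal (exp (- (x \<bullet> x) / 4)) \<partial>(lborel :: 'a::euclidean_space measure))
    = ennreal ((4 * pi) powr (real DIM('a) / 2))"
proof -
  have "ennreal (exp (- (x \<bullet> x) / 4)) = (\<Prod>b\<in>Basis. ennreal (exp (- (x \<bullet> b)\<^sup>2 / 4)))" for x :: 'a
    by (simp add: prod_ennreal exp_sum[symmetric] euclidean_inner[of x x] sum_negf sum_divide_distrib power2_eq_square)
  then have "(\<integral>\<^sup>+x. ennreal (exp (- (x \<bullet> x) / 4)) \<partial>(lborel::'a measure))
      = (\<integral>\<^sup>+x. (\<Prod>b\<in>Basis. ennreal (exp (- (x \<bullet> b)\<^sup>2 / 4))) \<partial>(lborel::'a measure))"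
    by (rule nn_integral_cong)
  also have "\<dots> = (\<Prod>b\<in>(Basis::'a set). \<integral>\<^sup>+x. ennreal (exp (- x\<^sup>2 / 4)) \<partial>lborel)"
    by (rule nn_integral_lborel_prod) auto
  also have "\<dots> = (\<Prod>b\<in>(Basis::'a set). ennreal (sqrt (4 * pi)))"
    unfolding nn_integral_gaussian_1d ..
  also have "\<dots> = ennreal (sqrt (4 * pi) ^ DIM('a))" by (simp add: ennreal_power)
  also have "sqrt (4 * pi) ^ DIM('a) = (4 * pi) powr (real DIM('a) / 2)"
    by (simp add: powr_half_sqrt[symmetric] powr_realpow[symmetric] powr_powr)
  finally show ?thesis .
qed

lemma nn_integral_gaussian:
  fixes M :: "real^'n^'n"
  assumes M: "spd M"
  shows "(\<integral>\<^sup>+x. ennreal (exp (- (x \<bullet> (M *v x)) / 4)) \<partial>lborel) =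
    ennreal ((4 * pi) powr (real CARD('n) / 2) * det M powr (-1/2))"
proof -
  obtain L :: "real^'n^'n" where L: "transpose L ** M ** L = mat 1" using spd_diagonalise[OF M] .
  have "det (transpose L ** M ** L) = 1" unfolding L by simp
  then have dL: "(det L)\<^sup>2 * det M = 1" by (simp add: det_mul power2_eq_square mult_ac)
  then have L0: "det L \<noteq> 0" by auto
  have dM: "0 < det M" by (rule spd_det_pos[OF M])
  have "(det L)\<^sup>2 = 1 / det M" using dL dM by (simp add: field_simps)
  then have "\<bar>det L\<bar> = sqrt (1 / det M)" by (metis real_sqrt_abs)
  also have "\<dots> = det M powr (-1/2)"
    using dM powr_half_sqrt[of "det M"] by (simp add: real_sqrt_divide powr_minus_divide)
  finally have aL: "\<bar>det L\<bar> = det M powr (-1/2)" .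
  have q: "(L *v x) \<bullet> (M *v (L *v x)) = x \<bullet> x" for x
  proof -
    have "(L *v x) \<bullet> (M *v (L *v x)) = x \<bullet> (transpose L *v (M *v (L *v x)))"
      by (simp only: inner_matrix_transpose[of _ "transpose L"] transpose_transpose)
    also have "\<dots> = x \<bullet> ((transpose L ** M ** L) *v x)" by (simp only: matrix_vector_mul_assoc matrix_mul_assoc)
    finally show ?thesis unfolding L by simp
  qed
  have "(\<integral>\<^sup>+x. ennreal (exp (- (x \<bullet> (M *v x)) / 4)) \<partial>lborel) =
      ennreal \<bar>det L\<bar> * (\<integral>\<^sup>+x. ennreal (exp (- ((L *v x) \<bullet> (M *v (L *v x))) / 4)) \<partial>lborel)"
    by (rule nn_integral_lborel_matrix[symmetric]) (use L0 in auto)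
  also have "\<dots> = ennreal (det M powr (-1/2)) * ennreal ((4 * pi) powr (real CARD('n) / 2))"
    unfolding q aL nn_integral_gaussian_std by simp
  finally show ?thesis by (simp add: ennreal_mult mult.commute)
qed

text \<open>For positive definite G, the centred Gaussian density with covariance 2G. The kernel of
  P_t is \<open>gk (cov Q B t)\<close> evaluated at Y - e^{tB} X.\<close>

definition gk :: "real^'n^'n \<Rightarrow> real^'n \<Rightarrow> real" where
  "gk G z = (4 * pi) powr (- real CARD('n) / 2) * det G powr (-1/2) * exp (- (z \<bullet> (matrix_inv G *v z)) / 4)"

lemma gk_nonneg: "0 \<le> gk G z" by (simp add: gk_def)

lemma borel_measurable_gk[measurable]: "gk G \<in> borel_measurable borel"
  unfolding gk_def[abs_def] by measurable

lemma gk_le: "spd G \<Longrightarrow> gk G z \<le> (4 * pi) powr (- real CARD('n) / 2) * det G powr (-1/2)"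
  for G :: "real^'n^'n"
  using spd_nonneg[OF spd_matrix_inv, of G z] unfolding gk_def by (intro mult_left_le) auto

lemma nn_integral_gk:
  fixes G :: "real^'n^'n"
  assumes "spd G" shows "(\<integral>\<^sup>+z. ennreal (gk G z) \<partial>lborel) = 1"
proof -
  have d: "0 < det G" by (rule spd_det_pos[OF assms])
  have "(\<integral>\<^sup>+z. ennreal (gk G z) \<partial>lborel) = ennreal ((4 * pi) powr (- real CARD('n) / 2) * det G powr (-1/2))
     * (\<integral>\<^sup>+z. ennreal (exp (- (z \<bullet> (matrix_inv G *v z)) / 4)) \<partial>lborel)"
    unfolding gk_def by (subst nn_integral_cmult[symmetric]) (auto simp: ennreal_mult)
  also have "\<dots> = ennreal (((4 * pi) powr (- real CARD('n) / 2) * det G powr (-1/2)) *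
      ((4 * pi) powr (real CARD('n) / 2) * (1 / det G) powr (-1/2)))"
    using d by (subst nn_integral_gaussian[OF spd_matrix_inv[OF assms]]) (simp add: det_matrix_inv ennreal_mult)
  also have "((4 * pi) powr (- real CARD('n) / 2) * det G powr (-1/2)) *
      ((4 * pi) powr (real CARD('n) / 2) * (1 / det G) powr (-1/2)) = 1"
    using d by (simp add: powr_minus powr_divide field_simps)
  finally show ?thesis by simp
qed

text \<open>Completing the square. The combined exponent, as a quadratic polynomial in x, has its
  critical point at x = G2 q with q the inverse of G1 + G2 applied to y; translating to it leaves a
  Gaussian integral for the sum of the two inverse matrices.\<close>

lemma gk_convolution:
  fixes G1 G2 :: "real^'n^'n"
  assumes G1: "spd G1" and G2: "spd G2"
  shows "(\<integral>\<^sup>+x. ennreal (gk G1 (y - x) * gk G2 x) \<partial>lborel) = ennreal (gk (G1 + G2) y)"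
proof -
  define A where "A = matrix_inv G1"
  define B where "B = matrix_inv G2"
  define S where "S = matrix_inv (G1 + G2)"
  have G: "spd (G1 + G2)" by (rule spd_add[OF G1 G2])
  have AB: "spd A" "spd B" "spd (A + B)"
    unfolding A_def B_def by (intro spd_add spd_matrix_inv G1 G2)+
  have d: "0 < det G1" "0 < det G2" "0 < det (G1 + G2)" "0 < det (A + B)"
    by (intro spd_det_pos G1 G2 G AB)+
  define q where "q = S *v y"
  have y: "G1 *v q + G2 *v q = y"
    using matrix_inv_cancel_vector(1)[of "G1 + G2" y] d
    by (simp add: q_def S_def matrix_vector_mult_add_rdistrib[symmetric])
  have AG: "A *v (G1 *v v) = v" "B *v (G2 *v v) = v" for v
    unfolding A_def B_def using d by (simp_all add: matrix_inv_cancel_vector)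
  \<comment> \<open>The cross terms cancel because A G1 q and B G2 q both equal q, so they
    contribute - 2 q . w and + 2 q . w.\<close>
  have sq: "(y - (w + G2 *v q)) \<bullet> (A *v (y - (w + G2 *v q))) + (w + G2 *v q) \<bullet> (B *v (w + G2 *v q))
      = y \<bullet> (S *v y) + w \<bullet> ((A + B) *v w)" for w
  proof -
    have 1: "y - (w + G2 *v q) = G1 *v q - w" using y by (simp add: algebra_simps)
    have 2: "(G1 *v q) \<bullet> (A *v w) = q \<bullet> w"
      using spd_sym[OF AB(1), of "G1 *v q" w] AG(1)[of q] by (simp add: inner_commute)
    have 3: "(G2 *v q) \<bullet> (B *v w) = q \<bullet> w"
      using spd_sym[OF AB(2), of "G2 *v q" w] AG(2)[of q] by (simp add: inner_commute)
    have 4: "y \<bullet> (S *v y) = (G1 *v q) \<bullet> q + (G2 *v q) \<bullet> q"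
      unfolding q_def[symmetric] by (subst y[symmetric]) (simp add: inner_add_left)
    show ?thesis unfolding 1 4
      by (simp add: matrix_vector_right_distrib matrix_vector_mult_diff_distrib AG inner_diff_left
          inner_diff_right inner_add_left inner_add_right 2 3 matrix_vector_mult_add_rdistrib inner_commute[of w q])
  qed
  define C where "C = (4 * pi) powr (- real CARD('n) / 2) * det G1 powr (-1/2) *
      ((4 * pi) powr (- real CARD('n) / 2) * det G2 powr (-1/2)) * exp (- (y \<bullet> (S *v y)) / 4)"
  have C0: "0 \<le> C" by (simp add: C_def)
  have e: "gk G1 (y - (w + G2 *v q)) * gk G2 (w + G2 *v q) = C * exp (- (w \<bullet> ((A + B) *v w)) / 4)" for w
  proof -
    have "exp (- ((y - (w + G2 *v q)) \<bullet> (A *v (y - (w + G2 *v q)))) / 4) * exp (- ((w + G2 *v q) \<bullet> (B *v (w + G2 *v q))) / 4)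
       = exp (- ((y - (w + G2 *v q)) \<bullet> (A *v (y - (w + G2 *v q))) + (w + G2 *v q) \<bullet> (B *v (w + G2 *v q))) / 4)"
      by (simp add: exp_add[symmetric] field_simps)
    also have "\<dots> = exp (- (y \<bullet> (S *v y)) / 4) * exp (- (w \<bullet> ((A + B) *v w)) / 4)"
      unfolding sq by (simp add: exp_add[symmetric] field_simps)
    finally show ?thesis unfolding gk_def C_def A_def[symmetric] B_def[symmetric]
      by (simp only: mult_ac)
  qed
  \<comment> \<open>The normalisations match by taking determinants in G1 (A + B) G2 = G2 +
    G1.\<close>
  have dd: "det (A + B) * (det G1 * det G2) = det (G1 + G2)"
  proof -
    have "(G1 ** (A + B) ** G2) *v v = (G2 + G1) *v v" for v
      using d by (simp add: A_def B_def matrix_vector_mul_assoc[symmetric] matrix_vector_mult_add_rdistrib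
          matrix_vector_right_distrib matrix_inv_cancel_vector)
    then have "G1 ** (A + B) ** G2 = G2 + G1" by (simp add: matrix_eq)
    then have "det G1 * det (A + B) * det G2 = det (G2 + G1)" by (metis det_mul)
    then show ?thesis by (simp add: mult_ac add.commute)
  qed
  have "(\<integral>\<^sup>+x. ennreal (gk G1 (y - x) * gk G2 x) \<partial>lborel)
      = (\<integral>\<^sup>+w. ennreal (gk G1 (y - (w + G2 *v q)) * gk G2 (w + G2 *v q)) \<partial>lborel)"
    by (rule nn_integral_lborel_translate[symmetric]) measurable
  also have "\<dots> = ennreal C * (\<integral>\<^sup>+w. ennreal (exp (- (w \<bullet> ((A + B) *v w)) / 4)) \<partial>lborel)"
    unfolding e using C0 by (subst nn_integral_cmult[symmetric]) (auto simp: ennreal_mult)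
  also have "\<dots> = ennreal (C * ((4 * pi) powr (real CARD('n) / 2) * det (A + B) powr (-1/2)))"
    using C0 by (subst nn_integral_gaussian[OF AB(3)]) (simp add: ennreal_mult)
  also have "C * ((4 * pi) powr (real CARD('n) / 2) * det (A + B) powr (-1/2)) = gk (G1 + G2) y"
  proof -
    have "det (A + B) powr (-1/2) * (det G1 powr (-1/2) * det G2 powr (-1/2)) = det (G1 + G2) powr (-1/2)"
      using d unfolding dd[symmetric] by (simp add: powr_mult)
    moreover have "(4 * pi) powr (- real CARD('n) / 2) * (4 * pi) powr (real CARD('n) / 2) = 1"
      by (simp add: powr_add[symmetric])
    moreover have "p * d1 * (p * d2) * e * (r * dab) = p * d * e"
      if "dab * (d1 * d2) = d" "p * r = 1" for p d1 d2 e r dab d :: real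
    proof -
      have "p * d1 * (p * d2) * e * (r * dab) = (p * r) * p * (dab * (d1 * d2)) * e"
        by (simp only: mult_ac)
      then show ?thesis unfolding that by simp
    qed
    ultimately show ?thesis unfolding C_def gk_def S_def[symmetric] by blast
  qed
  finally show ?thesis .
qed

text \<open>The density of the image of a Gaussian vector under A, with its Jacobian.
  Chapman-Kolmogorov uses it to carry the Gaussian of the first time step through the drift of the
  second.\<close>

lemma gk_congruence:
  fixes A G :: "real^'n^'n"
  assumes A: "det A \<noteq> 0" and G: "spd G"
  shows "\<bar>det A\<bar> * gk (A ** G ** transpose A) (A *v z) = gk G z"
proof -
  have S: "spd (A ** G ** transpose A)" by (rule spd_congruence[OF A G])
  have dG: "0 < det G" by (rule spd_det_pos[OF G])
  define y where "y = matrix_inv (A ** G ** transpose A) *v (A *v z)"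
  have "(A ** G ** transpose A) *v y = A *v z"
    unfolding y_def using spd_det_pos[OF S] by (simp add: matrix_inv_cancel_vector)
  then have "matrix_inv A *v (A *v (G *v (transpose A *v y))) = matrix_inv A *v (A *v z)"
    by (simp only: matrix_vector_mul_assoc matrix_mul_assoc)
  then have "G *v (transpose A *v y) = z" unfolding matrix_inv_cancel_vector(2)[OF A] .
  then have "matrix_inv G *v (G *v (transpose A *v y)) = matrix_inv G *v z" by simp
  moreover have "matrix_inv G *v (G *v (transpose A *v y)) = transpose A *v y"
    by (rule matrix_inv_cancel_vector(2)) (use dG in simp)
  ultimately have Ay: "transpose A *v y = matrix_inv G *v z" by simp
  have "(A *v z) \<bullet> y = z \<bullet> (transpose A *v y)"
    using inner_matrix_transpose[of y A z] by (simp only: inner_commute)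
  then have q: "(A *v z) \<bullet> (matrix_inv (A ** G ** transpose A) *v (A *v z)) = z \<bullet> (matrix_inv G *v z)"
    unfolding y_def[symmetric] Ay .
  have "det (A ** G ** transpose A) = \<bar>det A\<bar>\<^sup>2 * det G"
    by (simp add: det_mul power2_eq_square mult_ac)
  then have "det (A ** G ** transpose A) powr (-1/2) = (\<bar>det A\<bar>\<^sup>2) powr (-1/2) * det G powr (-1/2)"
    using dG by (simp add: powr_mult)
  also have "(\<bar>det A\<bar>\<^sup>2) powr (-1/2) = 1 / \<bar>det A\<bar>"
    using A powr_half_sqrt[of "(det A)\<^sup>2"] by (simp add: powr_minus_divide)
  finally have "\<bar>det A\<bar> * det (A ** G ** transpose A) powr (-1/2) = det G powr (-1/2)"
    using A by simp
  then show ?thesis unfolding gk_def q by (simp add: mult_ac)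
qed

section \<open>Euclidean norms against the inverse form, and first moments\<close>

lemma spd_cauchy_schwarz:
  assumes "spd G"
  shows "(x \<bullet> (G *v y))\<^sup>2 \<le> (x \<bullet> (G *v x)) * (y \<bullet> (G *v y))"
proof (cases "y = 0")
  case False
  define b where "b = x \<bullet> (G *v y)"
  define c where "c = y \<bullet> (G *v y)"
  have c: "0 < c" unfolding c_def by (rule spdD(2)[OF assms False])
  have "0 \<le> (x - (b/c) *\<^sub>R y) \<bullet> (G *v (x - (b/c) *\<^sub>R y))" by (rule spd_nonneg[OF assms])
  also have "\<dots> = x \<bullet> (G *v x) - (b/c) * b - (b/c) * b + (b/c) * ((b/c) * c)"
    using spd_sym[OF assms, of y x]
    by (simp add: matrix_vector_mult_diff_distrib matrix_vector_mult_scaleR inner_diff_left inner_diff_right b_def c_def algebra_simps)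
  also have "\<dots> = x \<bullet> (G *v x) - b\<^sup>2 / c" using c by (simp add: power2_eq_square)
  finally show ?thesis using c unfolding b_def[symmetric] c_def[symmetric] by (simp add: field_simps)
qed simp

text \<open>With q the inverse of G applied to z, Cauchy-Schwarz for the form G applied to z and q
  gives (z . z)^2 \<le> (z . G z) (z . q). The bound on the first factor then cancels one z .
  z.\<close>

lemma spd_norm_le_inverse_form:
  assumes G: "spd G" and m: "\<And>x. x \<bullet> (G *v x) \<le> m * (x \<bullet> x)"
  shows "z \<bullet> z \<le> m * (z \<bullet> (matrix_inv G *v z))"
proof (cases "z = 0")
  case False
  define q where "q = matrix_inv G *v z"
  have z: "G *v q = z" unfolding q_def using spd_det_pos[OF G] by (simp add: matrix_inv_cancel_vector)
  have "(z \<bullet> z)\<^sup>2 \<le> (z \<bullet> (G *v z)) * (q \<bullet> z)"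
    using spd_cauchy_schwarz[OF G, of z q] unfolding z .
  also have "\<dots> \<le> (m * (z \<bullet> z)) * (q \<bullet> z)"
    using m spd_nonneg[OF G, of q] z by (intro mult_right_mono) auto
  finally have "(z \<bullet> z) * (z \<bullet> z) \<le> (m * (q \<bullet> z)) * (z \<bullet> z)" by (simp add: power2_eq_square mult_ac)
  then have "z \<bullet> z \<le> m * (q \<bullet> z)" using False by (simp add: mult_le_cancel_right)
  then show ?thesis by (simp add: q_def inner_commute)
qed simp

text \<open>Half of the exponent pays for the factor |z|. Writing a for the inverse form at z, one
  has |z| \<le> sqrt (m a) and sqrt a \<le> 2 e^(a/8), and what remains, e^(-a/8), is the
  exponential in the kernel of 2G. The factor 2^(N/2) is the ratio of the two
  normalisations.\<close>

lemma gk_first_moment: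
  fixes G :: "real^'n^'n"
  assumes G: "spd G" and m: "\<And>x. x \<bullet> (G *v x) \<le> m * (x \<bullet> x)" and m0: "0 \<le> m"
  shows "(\<integral>\<^sup>+z. ennreal (gk G z * norm z) \<partial>lborel) \<le> ennreal (2 * 2 powr (real CARD('n) / 2) * sqrt m)"
proof -
  have dG: "0 < det G" by (rule spd_det_pos[OF G])
  have inv2: "matrix_inv (2 *\<^sub>R G) = (1/2) *\<^sub>R matrix_inv G"
    by (rule matrix_inv_unique) (use dG in \<open>simp add: matrix_scalar_ac scalar_matrix_assoc[symmetric] matrix_inv_cancel\<close>)
  have "gk G z * norm z \<le> 2 * 2 powr (real CARD('n) / 2) * sqrt m * gk (2 *\<^sub>R G) z" for z
  proof -
    define a where "a = z \<bullet> (matrix_inv G *v z)"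
    have a: "0 \<le> a" unfolding a_def by (rule spd_nonneg[OF spd_matrix_inv[OF G]])
    have "norm z = sqrt (z \<bullet> z)" by (rule norm_eq_sqrt_inner)
    also have "\<dots> \<le> sqrt (m * a)"
      unfolding a_def by (intro real_sqrt_le_mono spd_norm_le_inverse_form[OF G m])
    finally have nz: "norm z \<le> sqrt m * sqrt a" by (simp add: real_sqrt_mult)
    have "a \<le> 4 * exp (a / 4)" using exp_ge_add_one_self[of "a/4"] by linarith
    also have "\<dots> = (2 * exp (a / 8))\<^sup>2" by (simp add: power_mult_distrib exp_double[symmetric])
    finally have sa: "sqrt a \<le> 2 * exp (a / 8)" by (simp add: real_le_lsqrt a)
    have "exp (- a / 4) * norm z \<le> exp (- a / 4) * (sqrt m * (2 * exp (a / 8)))"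
      using nz sa m0 by (intro mult_left_mono order_trans[OF nz]) auto
    also have "\<dots> = 2 * sqrt m * exp (- a / 8)"
      by (simp add: exp_add[symmetric] mult_exp_exp algebra_simps)
    finally have e: "exp (- a / 4) * norm z \<le> 2 * sqrt m * exp (- a / 8)" .
    have g2: "gk (2 *\<^sub>R G) z = (4 * pi) powr (- real CARD('n) / 2) * ((2 powr (- real CARD('n) / 2)) * det G powr (-1/2)) * exp (- a / 8)"
    proof -
      have "det (2 *\<^sub>R G) powr (-1/2) = (2 powr (- real CARD('n) / 2)) * det G powr (-1/2)"
        using dG by (simp add: det_scaleR powr_mult powr_realpow[symmetric] powr_powr)
      then show ?thesis unfolding gk_def inv2 by (simp add: a_def scaleR_matrix_vector_assoc[symmetric])
    qed
    have "gk G z * norm z = ((4 * pi) powr (- real CARD('n) / 2) * det G powr (-1/2)) * (exp (- a / 4) * norm z)"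
      by (simp add: gk_def a_def)
    also have "\<dots> \<le> ((4 * pi) powr (- real CARD('n) / 2) * det G powr (-1/2)) * (2 * sqrt m * exp (- a / 8))"
      by (rule mult_left_mono[OF e]) simp
    also have "\<dots> = 2 * 2 powr (real CARD('n) / 2) * sqrt m * gk (2 *\<^sub>R G) z"
      unfolding g2 by (simp add: powr_minus field_simps)
    finally show ?thesis .
  qed
  then have "(\<integral>\<^sup>+z. ennreal (gk G z * norm z) \<partial>lborel) \<le>
     (\<integral>\<^sup>+z. ennreal (2 * 2 powr (real CARD('n) / 2) * sqrt m) * ennreal (gk (2 *\<^sub>R G) z) \<partial>lborel)"
    using m0 by (intro nn_integral_mono) (simp add: ennreal_mult[symmetric] gk_nonneg ennreal_leI)
  also have "\<dots> = ennreal (2 * 2 powr (real CARD('n) / 2) * sqrt m)"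
    by (simp add: nn_integral_cmult nn_integral_gk spd_scaleR G)
  finally show ?thesis .
qed

section \<open>Determinants compared through Gaussian integrals\<close>

lemma powr_neg_half_le_imp_ge:
  assumes "0 < a" "0 < (b::real)" "a powr (-1/2) \<le> b powr (-1/2)"
  shows "b \<le> a"
  using powr_less_mono2_neg[of "-1/2" a b] assms by force

text \<open>A larger quadratic form has a smaller Gaussian integral, and that integral is a constant
  times the determinant to the power -1/2.\<close>

lemma spd_det_mono:
  fixes A B :: "real^'n^'n"
  assumes A: "spd A" and B: "spd B" and le: "\<And>x. x \<bullet> (A *v x) \<le> x \<bullet> (B *v x)"
  shows "det A \<le> det B"
proof -
  have "(\<integral>\<^sup>+x. ennreal (exp (- (x \<bullet> (B *v x)) / 4)) \<partial>lborel) \<le> (\<integral>\<^sup>+x. ennreal (exp (- (x \<bullet> (A *v x)) / 4)) \<partial>lborel)"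
    using le by (intro nn_integral_mono ennreal_leI) auto
  then have "(4 * pi) powr (real CARD('n) / 2) * det B powr (-1/2) \<le> (4 * pi) powr (real CARD('n) / 2) * det A powr (-1/2)"
    unfolding nn_integral_gaussian[OF A] nn_integral_gaussian[OF B] by (subst (asm) ennreal_le_iff) auto
  then have "det B powr (-1/2) \<le> det A powr (-1/2)" by (simp add: mult_le_cancel_left)
  then show ?thesis by (rule powr_neg_half_le_imp_ge[OF spd_det_pos[OF B] spd_det_pos[OF A]])
qed

text \<open>A weak form of Minkowski's determinant inequality, obtained by integrating
  $e^{-(a+b)} \le (e^{-2a} + e^{-2b})/2$ for the two quadratic forms.\<close>

lemma spd_det_add_ge:
  fixes A B :: "real^'n^'n"
  assumes A: "spd A" and B: "spd B" and le: "det A \<le> det B"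
  shows "2 ^ CARD('n) * det A \<le> det (A + B)"
proof -
  let ?I = "\<lambda>M::real^'n^'n. \<integral>\<^sup>+x. ennreal (exp (- (x \<bullet> (M *v x)) / 4)) \<partial>lborel"
  define K where "K = (4 * pi) powr (real CARD('n) / 2)"
  have K: "0 < K" by (simp add: K_def)
  have I: "?I M = ennreal (K * det M powr (-1/2))" if "spd M" for M
    unfolding K_def by (rule nn_integral_gaussian[OF that])
  have s: "spd (A + B)" "spd (2 *\<^sub>R A)" "spd (2 *\<^sub>R B)" by (auto intro: spd_add spd_scaleR A B)
  have pw: "exp (- (a + b) / 4) \<le> exp (- (2 * a) / 4) / 2 + exp (- (2 * b) / 4) / 2" for a b :: real
  proof -
    have "exp (- (2 * c) / 4) = (exp (- c / 4))\<^sup>2" for c :: real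
      unfolding exp_double[symmetric] by simp
    moreover have "exp (- (a + b) / 4) = exp (- a / 4) * exp (- b / 4)"
      unfolding exp_add[symmetric] by (simp add: field_simps)
    ultimately show ?thesis
      using sum_squares_bound[of "exp (- a / 4)" "exp (- b / 4)"] by simp
  qed
  have "?I (A + B) \<le> (\<integral>\<^sup>+x. ennreal (1/2) * ennreal (exp (- (x \<bullet> ((2 *\<^sub>R A) *v x)) / 4)) +
      ennreal (1/2) * ennreal (exp (- (x \<bullet> ((2 *\<^sub>R B) *v x)) / 4)) \<partial>lborel)"
  proof (rule nn_integral_mono)
    fix x
    show "ennreal (exp (- (x \<bullet> ((A + B) *v x)) / 4)) \<le> ennreal (1/2) * ennreal (exp (- (x \<bullet> ((2 *\<^sub>R A) *v x)) / 4)) +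
      ennreal (1/2) * ennreal (exp (- (x \<bullet> ((2 *\<^sub>R B) *v x)) / 4))"
    proof -
      have h: "ennreal (1/2) * ennreal (exp c) + ennreal (1/2) * ennreal (exp d) = ennreal (exp c / 2 + exp d / 2)" for c d
        by (subst ennreal_mult[symmetric], simp, simp)+ (simp add: ennreal_plus[symmetric] del: ennreal_plus)
      show ?thesis
        unfolding h using pw[of "x \<bullet> (A *v x)" "x \<bullet> (B *v x)"]
        by (intro ennreal_leI) (simp add: matrix_vector_mult_add_rdistrib inner_add_right scaleR_matrix_vector_assoc[symmetric])
    qed
  qed
  also have "\<dots> = ennreal (1/2) * ?I (2 *\<^sub>R A) + ennreal (1/2) * ?I (2 *\<^sub>R B)"
    by (subst nn_integral_add) (auto simp: nn_integral_cmult)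
  also have "\<dots> = ennreal (K * det (2 *\<^sub>R A) powr (-1/2) / 2 + K * det (2 *\<^sub>R B) powr (-1/2) / 2)"
    unfolding I[OF s(2)] I[OF s(3)] using K
    by (subst ennreal_mult[symmetric], simp, simp)+ (simp add: ennreal_plus[symmetric] del: ennreal_plus)
  finally have "K * det (A + B) powr (-1/2) \<le> K * det (2 *\<^sub>R A) powr (-1/2) / 2 + K * det (2 *\<^sub>R B) powr (-1/2) / 2"
    unfolding I[OF s(1)] using K by (subst (asm) ennreal_le_iff) auto
  also have "det (2 *\<^sub>R B) powr (-1/2) \<le> det (2 *\<^sub>R A) powr (-1/2)"
    using le spd_det_pos[OF s(2)] spd_det_pos[OF s(3)] by (intro powr_mono2') (auto simp: det_scaleR)
  finally have "K * det (A + B) powr (-1/2) \<le> K * det (2 *\<^sub>R A) powr (-1/2)"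
    using K by (simp add: mult_left_mono)
  then have "det (A + B) powr (-1/2) \<le> det (2 *\<^sub>R A) powr (-1/2)" using K by (simp add: mult_le_cancel_left)
  then have "det (2 *\<^sub>R A) \<le> det (A + B)" by (rule powr_neg_half_le_imp_ge[OF spd_det_pos[OF s(1)] spd_det_pos[OF s(2)]])
  then show ?thesis by (simp add: det_scaleR)
qed

section \<open>Measurability of the kernel jointly in the matrix and the point\<close>

lemma borel_measurable_det:
  fixes f :: "'a \<Rightarrow> real^'n^'n"
  assumes [measurable]: "\<And>i j. (\<lambda>x. f x $ i $ j) \<in> borel_measurable M"
  shows "(\<lambda>x. det (f x)) \<in> borel_measurable M"
  unfolding det_def by measurable

lemma borel_measurable_gk2:
  fixes G :: "'a \<Rightarrow> real^'n^'n" and z :: "'a \<Rightarrow> real^'n"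
  assumes G[measurable]: "\<And>i j. (\<lambda>x. G x $ i $ j) \<in> borel_measurable M"
    and z[measurable]: "\<And>i. (\<lambda>x. z x $ i) \<in> borel_measurable M"
    and d: "\<And>x. x \<in> space M \<Longrightarrow> det (G x) \<noteq> 0"
  shows "(\<lambda>x. gk (G x) (z x)) \<in> borel_measurable M"
proof -
  have [measurable]: "(\<lambda>x. det (G x)) \<in> borel_measurable M" by (rule borel_measurable_det) measurable
  have [measurable]: "(\<lambda>x. det (\<chi> i j. if j = k then z x $ i else G x $ i $ j)) \<in> borel_measurable M" for k
    by (rule borel_measurable_det) (simp, measurable)
  \<comment> \<open>Cramer's rule expresses the inverse matrix through determinants, which are
    polynomials in the entries and therefore measurable.\<close>
  have inv: "matrix_inv (G x) *v z x = (\<chi> k. det (\<chi> i j. if j = k then z x $ i else G x $ i $ j) / det (G x))"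
    if "x \<in> space M" for x
    using cramer[OF d[OF that], of "matrix_inv (G x) *v z x" "z x"] matrix_inv_cancel_vector(1)[OF d[OF that]] by simp
  have "(\<lambda>x. gk (G x) (z x)) \<in> borel_measurable M \<longleftrightarrow>
    (\<lambda>x. (4 * pi) powr (- real CARD('n) / 2) * det (G x) powr (-1/2) *
      exp (- (\<Sum>k\<in>UNIV. z x $ k * (det (\<chi> i j. if j = k then z x $ i else G x $ i $ j) / det (G x))) / 4)) \<in> borel_measurable M"
    by (rule measurable_cong) (simp add: gk_def inv inner_vec_def)
  also have "\<dots>" by measurable
  finally show ?thesis .
qed

section \<open>The matrix exponential\<close>

text \<open>The entrywise l^1 norm: it dominates the operator norm and every entry, and it is
  continuous as soon as the entries are.\<close>

definition esum :: "real^'n^'m \<Rightarrow> real" where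
  "esum A = (\<Sum>i\<in>UNIV. \<Sum>j\<in>UNIV. \<bar>A $ i $ j\<bar>)"

lemma esum_nonneg: "0 \<le> esum A"
  by (simp add: esum_def sum_nonneg)

lemma row_sum_le_esum: "(\<Sum>j\<in>UNIV. \<bar>A $ i $ j\<bar>) \<le> esum A"
  unfolding esum_def by (rule member_le_sum) (auto simp: sum_nonneg)

lemma norm_matrix_vector_le_esum: "norm (A *v x) \<le> esum A * norm x" for A :: "real^'n^'m"
proof -
  have "norm (A *v x) \<le> (\<Sum>i\<in>UNIV. \<bar>(A *v x) $ i\<bar>)" by (rule norm_le_l1_cart)
  also have "\<dots> \<le> (\<Sum>i\<in>UNIV. \<Sum>j\<in>UNIV. \<bar>A $ i $ j\<bar> * norm x)"
  proof (rule sum_mono)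
    fix i
    have "\<bar>(A *v x) $ i\<bar> \<le> (\<Sum>j\<in>UNIV. \<bar>A $ i $ j * x $ j\<bar>)"
      unfolding matrix_vector_mult_def by simp
    also have "\<dots> \<le> (\<Sum>j\<in>UNIV. \<bar>A $ i $ j\<bar> * norm x)"
      by (intro sum_mono) (simp add: abs_mult mult_left_mono component_le_norm_cart)
    finally show "\<bar>(A *v x) $ i\<bar> \<le> (\<Sum>j\<in>UNIV. \<bar>A $ i $ j\<bar> * norm x)" .
  qed
  also have "\<dots> = esum A * norm x" by (simp add: esum_def sum_distrib_right)
  finally show ?thesis .
qed

lemma quadratic_form_le_esum: "x \<bullet> (A *v x) \<le> esum A * (x \<bullet> x)" for A :: "real^'n^'n"
proof -
  have "x \<bullet> (A *v x) \<le> norm x * norm (A *v x)" by (rule norm_cauchy_schwarz)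
  also have "\<dots> \<le> norm x * (esum A * norm x)"
    by (intro mult_left_mono norm_matrix_vector_le_esum) auto
  finally show ?thesis by (simp add: dot_square_norm power2_eq_square mult_ac)
qed

lemma mpow_entry_le: "\<bar>mpow A k $ i $ j\<bar> \<le> esum A ^ k"
proof (induction k arbitrary: i j)
  case 0
  show ?case by (simp add: mat_def)
next
  case (Suc k)
  have "\<bar>mpow A (Suc k) $ i $ j\<bar> \<le> (\<Sum>l\<in>UNIV. \<bar>A $ i $ l * mpow A k $ l $ j\<bar>)"
    by (simp add: matrix_matrix_mult_def)
  also have "\<dots> \<le> (\<Sum>l\<in>UNIV. \<bar>A $ i $ l\<bar> * esum A ^ k)"
    by (intro sum_mono) (simp add: abs_mult mult_left_mono Suc)
  also have "\<dots> \<le> esum A * esum A ^ k"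
    unfolding sum_distrib_right[symmetric]
    by (intro mult_right_mono row_sum_le_esum zero_le_power esum_nonneg)
  finally show ?case by simp
qed

section \<open>Convergence, group law and derivative of the exponential series\<close>

lemma summable_mexp_entry: "summable (\<lambda>k. (mpow A k $ i $ j / fact k) * t ^ k)" for t :: real
proof (rule summable_comparison_test)
  show "summable (\<lambda>k. (esum A * \<bar>t\<bar>) ^ k /\<^sub>R fact k)" by (rule summable_exp_generic)
  have "norm ((mpow A k $ i $ j / fact k) * t ^ k) \<le> (esum A * \<bar>t\<bar>) ^ k /\<^sub>R fact k" for k
  proof -
    have "norm ((mpow A k $ i $ j / fact k) * t ^ k) = \<bar>mpow A k $ i $ j\<bar> * \<bar>t\<bar> ^ k / fact k"
      by (simp add: abs_mult power_abs)
    also have "\<dots> \<le> esum A ^ k * \<bar>t\<bar> ^ k / fact k"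
      by (intro divide_right_mono mult_right_mono mpow_entry_le) auto
    finally show ?thesis by (simp add: power_mult_distrib divide_inverse_commute)
  qed
  then show "\<exists>N. \<forall>k\<ge>N. norm ((mpow A k $ i $ j / fact k) * t ^ k) \<le> (esum A * \<bar>t\<bar>) ^ k /\<^sub>R fact k" by blast
qed

text \<open>The defining series has matrix terms; its convergence is obtained entry by entry from
  real power series in t.\<close>

lemma mexp_sums: "(\<lambda>k. (t ^ k / fact k) *\<^sub>R mpow A k) sums (\<chi> i j. \<Sum>k. (mpow A k $ i $ j / fact k) * t ^ k)"
proof -
  have "(\<lambda>n. \<Sum>k<n. (t ^ k / fact k) * mpow A k $ i $ j) \<longlonglongrightarrow> (\<Sum>k. (mpow A k $ i $ j / fact k) * t ^ k)" for i j
    using summable_LIMSEQ[OF summable_mexp_entry[of A i j t]] by (simp add: mult.commute)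
  then show ?thesis
    unfolding sums_def by (intro vec_tendstoI) simp
qed

lemma mexp_entry: "mexp t A $ i $ j = (\<Sum>k. (mpow A k $ i $ j / fact k) * t ^ k)"
  unfolding mexp_def sums_unique[OF mexp_sums, symmetric] by simp

lemma mexp_sums': "(\<lambda>k. (t ^ k / fact k) *\<^sub>R mpow A k) sums mexp t A"
  unfolding mexp_def by (rule summable_sums[OF sums_summable[OF mexp_sums]])

lemma bounded_linear_matrix_mult:
  "bounded_linear (\<lambda>M. A ** M)" "bounded_linear (\<lambda>M. M ** A)" "bounded_linear (\<lambda>M. A ** M ** C)"
  for A C :: "real^'n^'n"
  unfolding linear_conv_bounded_linear[symmetric]
  by (rule linearI; simp add: matrix_matrix_mult_def vec_eq_iff sum.distrib sum_distrib_left sum_distrib_right algebra_simps)+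

lemma mpow_commute: "mpow A k ** A = A ** mpow A k"
  by (induction k) (auto simp: matrix_mul_assoc[symmetric])

lemma mexp_commute: "mexp t A ** A = A ** mexp t A"
proof -
  have "(\<lambda>k. A ** ((t ^ k / fact k) *\<^sub>R mpow A k)) sums (A ** mexp t A)"
    by (rule bounded_linear.sums[OF bounded_linear_matrix_mult(1) mexp_sums'])
  moreover have "(\<lambda>k. ((t ^ k / fact k) *\<^sub>R mpow A k) ** A) sums (mexp t A ** A)"
    by (rule bounded_linear.sums[OF bounded_linear_matrix_mult(2) mexp_sums'])
  moreover have "A ** ((t ^ k / fact k) *\<^sub>R mpow A k) = ((t ^ k / fact k) *\<^sub>R mpow A k) ** A" for k
    by (simp add: matrix_scalar_ac scalar_matrix_assoc[symmetric] mpow_commute)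
  ultimately show ?thesis by (simp add: sums_unique2)
qed

text \<open>Termwise differentiation shifts the k-th coefficient to A^(k+1) / k!, which is the
  series of A e^{tA}.\<close>

lemma DERIV_mexp_entry: "((\<lambda>t. mexp t A $ i $ j) has_real_derivative (A ** mexp t A) $ i $ j) (at t)"
proof -
  let ?c = "\<lambda>k. mpow A k $ i $ j / fact k"
  have "((\<lambda>t. \<Sum>k. ?c k * t ^ k) has_real_derivative (\<Sum>k. diffs ?c k * t ^ k)) (at t)"
    by (rule termdiffs_strong_converges_everywhere) (rule summable_mexp_entry)
  moreover have "(\<Sum>k. diffs ?c k * t ^ k) = (A ** mexp t A) $ i $ j"
  proof -
    have d: "diffs ?c k = (A ** mpow A k) $ i $ j / fact k" for k
      unfolding diffs_def fact_Suc mpow.simps by (simp del: of_nat_Suc)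
    have "(\<lambda>k. A ** ((t ^ k / fact k) *\<^sub>R mpow A k)) sums (A ** mexp t A)"
      by (rule bounded_linear.sums[OF bounded_linear_matrix_mult(1) mexp_sums'])
    then have "(\<lambda>k. (A ** ((t ^ k / fact k) *\<^sub>R mpow A k)) $ i $ j) sums ((A ** mexp t A) $ i $ j)"
      by (rule bounded_linear.sums[OF bounded_linear_compose[OF bounded_linear_vec_nth bounded_linear_vec_nth]])
    then show ?thesis unfolding d by (simp add: matrix_scalar_ac scalar_matrix_assoc[symmetric] mult.commute sums_iff)
  qed
  ultimately show ?thesis by (simp add: mexp_entry)
qed

lemma mexp_0: "mexp 0 A = mat 1"
proof -
  have "mexp 0 A $ i $ j = mat 1 $ i $ j" for i j
    unfolding mexp_entry by (subst powser_zero) simp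
  then show ?thesis by (simp add: vec_eq_iff)
qed

text \<open>The product of e^{(a-u)A} and e^{(b+u)A} has zero derivative in u, because A commutes
  with its exponential. Its values at u = 0 and u = a are the two sides.\<close>

lemma mexp_add: "mexp (a + b) A = mexp a A ** mexp b A"
proof -
  have "(mexp a A ** mexp b A) $ i $ j = mexp (a + b) A $ i $ j" for i j
  proof -
    let ?\<phi> = "\<lambda>u. \<Sum>l\<in>UNIV. mexp (a - u) A $ i $ l * mexp (b + u) A $ l $ j"
    have "(?\<phi> has_real_derivative 0) (at u)" for u
    proof -
      have 1: "((\<lambda>u. mexp (a - u) A $ i $ l) has_real_derivative - (A ** mexp (a - u) A) $ i $ l) (at u)" for l
        using DERIV_chain2[where f="\<lambda>t. mexp t A $ i $ l" and g="\<lambda>u. a - u" and x=u and s=UNIV and Db="-1",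
            OF DERIV_mexp_entry] DERIV_diff[OF DERIV_const[of a] DERIV_ident[of "at u"]]
        by simp
      have 2: "((\<lambda>u. mexp (b + u) A $ l $ j) has_real_derivative (A ** mexp (b + u) A) $ l $ j) (at u)" for l
        using DERIV_chain2[where f="\<lambda>t. mexp t A $ l $ j" and g="\<lambda>u. b + u" and x=u and s=UNIV and Db=1,
            OF DERIV_mexp_entry] DERIV_add[OF DERIV_const[of b] DERIV_ident[of "at u"]]
        by simp
      have "(?\<phi> has_real_derivative (\<Sum>l\<in>UNIV. - (A ** mexp (a - u) A) $ i $ l * mexp (b + u) A $ l $ j
          + (A ** mexp (b + u) A) $ l $ j * mexp (a - u) A $ i $ l)) (at u)"
        by (intro DERIV_sum DERIV_mult 1 2)
      also have "(\<Sum>l\<in>UNIV. - (A ** mexp (a - u) A) $ i $ l * mexp (b + u) A $ l $ j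
          + (A ** mexp (b + u) A) $ l $ j * mexp (a - u) A $ i $ l)
        = (mexp (a - u) A ** (A ** mexp (b + u) A) - (A ** mexp (a - u) A) ** mexp (b + u) A) $ i $ j"
        unfolding matrix_matrix_mult_def[of "mexp (a - u) A"] matrix_matrix_mult_def[of "A ** mexp (a - u) A"]
        by (simp add: sum_subtractf[symmetric] mult.commute)
      also have "\<dots> = 0"
        by (simp add: matrix_mul_assoc mexp_commute)
      finally show ?thesis .
    qed
    then have "?\<phi> 0 = ?\<phi> a" using DERIV_isconst_all[of ?\<phi> 0 a] by blast
    moreover have "?\<phi> 0 = (mexp a A ** mexp b A) $ i $ j" by (simp add: matrix_matrix_mult_def)
    moreover have "?\<phi> a = (mexp 0 A ** mexp (b + a) A) $ i $ j" by (simp add: matrix_matrix_mult_def)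
    ultimately show ?thesis by (simp add: mexp_0 add.commute)
  qed
  then show ?thesis by (simp add: vec_eq_iff)
qed

text \<open>Differentiate the Leibniz formula at the identity matrix. A permutation other than the
  identity moves at least two points, so after one factor is differentiated another off-diagonal
  zero remains; only the identity permutation contributes, and it gives the trace.\<close>

lemma DERIV_det_mexp_0:
  fixes A :: "real^'n^'n"
  shows "((\<lambda>t. det (mexp t A)) has_real_derivative trace A) (at 0)"
proof -
  have 1: "((\<lambda>t. mexp t A $ i $ j) has_real_derivative A $ i $ j) (at 0)" for i j
    using DERIV_mexp_entry[of A i j 0] by (simp add: mexp_0)
  have "((\<lambda>t. det (mexp t A)) has_real_derivative (\<Sum>p | p permutes UNIV. of_int (sign p) *
      (\<Sum>i\<in>UNIV. A $ i $ p i * (\<Prod>k\<in>UNIV - {i}. mexp 0 A $ k $ p k)))) (at 0)"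
    unfolding det_def by (intro DERIV_sum DERIV_cmult has_field_derivative_prod 1)
  also have "(\<Sum>p | p permutes UNIV. of_int (sign p) *
      (\<Sum>i\<in>UNIV. A $ i $ p i * (\<Prod>k\<in>UNIV - {i}. mexp 0 A $ k $ p k))) = (\<Sum>p | p permutes (UNIV :: 'n set). if p = id then trace A else 0)"
  proof (rule sum.cong[OF refl])
    fix p :: "'n \<Rightarrow> 'n" assume "p \<in> {p. p permutes UNIV}"
    then have p: "p permutes UNIV" by simp
    show "of_int (sign p) * (\<Sum>i\<in>UNIV. A $ i $ p i * (\<Prod>k\<in>UNIV - {i}. mexp 0 A $ k $ p k)) = (if p = id then trace A else 0)"
    proof (cases "p = id")
      case True
      then show ?thesis by (simp add: mexp_0 mat_def trace_def sign_id)
    next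
      case False
      have "(\<Prod>k\<in>UNIV - {i}. mexp 0 A $ k $ p k) = 0" for i
      proof -
        obtain k where k: "p k \<noteq> k" using False by (auto simp: fun_eq_iff)
        have "\<exists>k. k \<noteq> i \<and> p k \<noteq> k"
        proof (cases "k = i")
          case True
          have "p (p k) \<noteq> p k" using k permutes_inj[OF p] by (auto dest: injD)
          then show ?thesis using k True by (intro exI[of _ "p k"]) auto
        qed (use k in auto)
        then obtain l where "l \<noteq> i" "p l \<noteq> l" by blast
        then show ?thesis by (intro prod_zero bexI[of _ l]) (auto simp: mexp_0 mat_def)
      qed
      then show ?thesis using False by (simp only: mult_zero_right sum.neutral_const if_False)
    qed
  qed
  also have "\<dots> = trace A" by (simp add: permutes_id)
  finally show ?thesis .
qed

text \<open>By multiplicativity the derivative of det e^{uA} is det e^{uA} times the trace. The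
  determinant is nonnegative, being the square of its value at u/2, so it increases from its value 1
  at time 0.\<close>

lemma det_mexp_ge_1:
  assumes "0 \<le> trace A" "0 \<le> t" shows "1 \<le> det (mexp t A)"
proof -
  let ?d = "\<lambda>t. det (mexp t A)"
  have mult: "?d (a + b) = ?d a * ?d b" for a b by (simp add: mexp_add det_mul)
  have nonneg: "0 \<le> ?d u" for u using mult[of "u/2" "u/2"] by simp
  have "(?d has_real_derivative ?d u * trace A) (at u)" for u
  proof -
    have "((\<lambda>h. ?d u * ?d h) has_real_derivative ?d u * trace A) (at 0)"
      by (rule DERIV_cmult[OF DERIV_det_mexp_0])
    then have "((\<lambda>h. ?d (h + u)) has_real_derivative ?d u * trace A) (at 0)"
      unfolding mult by (simp add: mult.commute)
    then show ?thesis using DERIV_shift[of ?d "?d u * trace A" 0 u] by simp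
  qed
  then have "?d 0 \<le> ?d t"
    by (intro DERIV_nonneg_imp_nondecreasing[OF assms(2)]) (use nonneg assms in \<open>auto intro!: exI mult_nonneg_nonneg\<close>)
  then show ?thesis by (simp add: mexp_0)
qed

lemma continuous_on_matrix_entries:
  assumes "\<And>i j. continuous_on S (\<lambda>x. f x $ i $ j)" shows "continuous_on S (f :: _ \<Rightarrow> real^'n^'m)"
proof -
  have "continuous_on S (\<lambda>x. \<chi> i. \<chi> j. f x $ i $ j)"
    by (intro continuous_on_vec_lambda assms)
  then show ?thesis by simp
qed

lemma continuous_on_mexp: "continuous_on S (\<lambda>t. mexp t A)"
  by (intro continuous_on_matrix_entries continuous_at_imp_continuous_on ballI DERIV_isCont[OF DERIV_mexp_entry])

lemma continuous_on_mexp_entry: "continuous_on S (\<lambda>t. mexp t A $ i $ j)"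
  by (intro continuous_at_imp_continuous_on ballI DERIV_isCont[OF DERIV_mexp_entry])

lemma continuous_on_esum: "continuous_on S f \<Longrightarrow> continuous_on S (\<lambda>x. esum (f x :: real^'n^'m))"
  unfolding esum_def by (intro continuous_intros)

lemma esum_bounded_on_interval:
  fixes f :: "real \<Rightarrow> real^'n^'m"
  assumes "continuous_on {0..R} f"
  obtains C where "0 \<le> C" "\<And>t. 0 \<le> t \<Longrightarrow> t \<le> R \<Longrightarrow> esum (f t) \<le> C"
proof -
  have "bounded ((\<lambda>t. esum (f t)) ` {0..R})"
    by (intro compact_imp_bounded compact_continuous_image continuous_on_esum assms) simp
  then obtain C where "\<forall>t\<in>{0..R}. \<bar>esum (f t)\<bar> \<le> C" by (auto simp: bounded_iff)
  then show thesis by (intro that[of "max C 0"]) (auto simp: le_max_iff_disj abs_le_iff)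
qed

section \<open>The covariance matrix of the semigroup\<close>

definition cov_rate :: "real^'n^'n \<Rightarrow> real^'n^'n \<Rightarrow> real \<Rightarrow> real^'n^'n" where
  "cov_rate Q B r = mexp r B ** Q ** transpose (mexp r B)"

text \<open>The matrix t K(t), half the covariance of the kernel of P_t. Without the factor 1/t it
  obeys the composition rule \<open>cov_add\<close>.\<close>

definition cov :: "real^'n^'n \<Rightarrow> real^'n^'n \<Rightarrow> real \<Rightarrow> real^'n^'n" where
  "cov Q B t = integral {0..t} (cov_rate Q B)"

lemma scaleR_Kmat: "0 < t \<Longrightarrow> t *\<^sub>R Kmat Q B t = cov Q B t"
  by (simp add: Kmat_def cov_def cov_rate_def[abs_def])

lemma continuous_on_cov_rate: "continuous_on S (cov_rate Q B)"
  unfolding cov_rate_def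
  by (intro continuous_on_matrix_entries)
     (auto simp: matrix_matrix_mult_def transpose_def intro!: continuous_intros continuous_on_mexp_entry)

lemma cov_rate_integrable: "cov_rate Q B integrable_on {a..b}"
  by (rule integrable_continuous_interval[OF continuous_on_cov_rate])

lemma cov_rate_add: "cov_rate Q B (r + u) = mexp r B ** cov_rate Q B u ** transpose (mexp r B)"
  by (simp add: cov_rate_def mexp_add matrix_transpose_mul matrix_mul_assoc)

text \<open>Split the integral at r and use e^{(r+u)B} = e^{rB} e^{uB} in the second piece. Both
  Chapman-Kolmogorov and the determinant growth rest on this rule.\<close>

lemma cov_add:
  assumes "0 \<le> r" "0 \<le> u"
  shows "cov Q B (r + u) = cov Q B r + mexp r B ** cov Q B u ** transpose (mexp r B)"
proof -
  have "cov Q B (r + u) = cov Q B r + integral {r..r + u} (cov_rate Q B)"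
    unfolding cov_def by (rule Henstock_Kurzweil_Integration.integral_combine[symmetric]) (use assms cov_rate_integrable in auto)
  also have "integral {r..r + u} (cov_rate Q B) = integral {0..u} (cov_rate Q B \<circ> (+) r)"
    using integral_shift_Icc_real[of 0 u "cov_rate Q B" r] by (simp add: add.commute)
  also have "cov_rate Q B \<circ> (+) r = (\<lambda>M. mexp r B ** M ** transpose (mexp r B)) \<circ> cov_rate Q B"
    by (auto simp: cov_rate_add)
  also have "integral {0..u} \<dots> = mexp r B ** cov Q B u ** transpose (mexp r B)"
    unfolding cov_def by (rule integral_linear[OF cov_rate_integrable bounded_linear_matrix_mult(3)])
  finally show ?thesis .
qed

lemma bounded_linear_quadratic_form: "bounded_linear (\<lambda>A::real^'n^'n. x \<bullet> (A *v x))"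
  unfolding linear_conv_bounded_linear[symmetric]
  by (rule linearI) (simp_all add: matrix_vector_mult_add_rdistrib inner_add_right scaleR_matrix_vector_assoc[symmetric])

lemma cov_form: "x \<bullet> (cov Q B t *v x) = integral {0..t} (\<lambda>r. x \<bullet> (cov_rate Q B r *v x))"
  unfolding cov_def
  by (subst integral_linear[OF cov_rate_integrable bounded_linear_quadratic_form, symmetric]) (simp add: o_def)

lemma cov_entry: "cov Q B t $ i $ j = integral {0..t} (\<lambda>r. cov_rate Q B r $ i $ j)"
  unfolding cov_def
  by (subst integral_linear[OF cov_rate_integrable bounded_linear_compose[OF bounded_linear_vec_nth bounded_linear_vec_nth], symmetric])
     (simp add: o_def)

lemma admissibleD: "admissible Q B \<Longrightarrow> transpose Q = Q"
  by (simp add: admissible_def)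

lemma transpose_cov_rate: "transpose Q = Q \<Longrightarrow> transpose (cov_rate Q B r) = cov_rate Q B r"
  by (simp add: cov_rate_def matrix_transpose_mul matrix_mul_assoc)

lemma transpose_cov: assumes "transpose Q = Q" shows "transpose (cov Q B t) = cov Q B t"
proof -
  have "cov_rate Q B r $ j $ i = cov_rate Q B r $ i $ j" for r i j
    using arg_cong[OF transpose_cov_rate[OF assms, of B r], of "\<lambda>M. M $ i $ j"] by (simp add: transpose_def)
  then show ?thesis by (simp add: transpose_def vec_eq_iff cov_entry)
qed

lemma spd_cov:
  assumes adm: "admissible Q B" and t: "0 < t"
  shows "spd (cov Q B t)"
proof -
  have "0 < x \<bullet> (cov Q B t *v x)" if "x \<noteq> 0" for x
  proof -
    have "0 < x \<bullet> (Kmat Q B t *v x)" using adm t that by (auto simp: admissible_def)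
    then show ?thesis using t
      unfolding scaleR_Kmat[OF t, symmetric] by (simp add: scaleR_matrix_vector_assoc[symmetric])
  qed
  then show ?thesis using transpose_cov[OF admissibleD[OF adm]] by (simp add: spd_def)
qed

text \<open>The factor t, from integrating a bounded rate, is what becomes sqrt u in the mean
  displacement of the kernel.\<close>

lemma cov_form_le:
  obtains C where "0 \<le> C" "\<And>t x. 0 \<le> t \<Longrightarrow> t \<le> R \<Longrightarrow> x \<bullet> (cov Q B t *v x) \<le> C * t * (x \<bullet> x)"
proof -
  obtain C where C: "0 \<le> C" "\<And>t. 0 \<le> t \<Longrightarrow> t \<le> R \<Longrightarrow> esum (cov_rate Q B t) \<le> C"
    using esum_bounded_on_interval[OF continuous_on_cov_rate] by blast
  have "x \<bullet> (cov Q B t *v x) \<le> C * t * (x \<bullet> x)" if t: "0 \<le> t" "t \<le> R" for t x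
  proof -
    have "x \<bullet> (cov Q B t *v x) \<le> integral {0..t} (\<lambda>r. C * (x \<bullet> x))"
      unfolding cov_form
    proof (rule integral_le)
      show "(\<lambda>r. x \<bullet> (cov_rate Q B r *v x)) integrable_on {0..t}"
        using integrable_linear[OF cov_rate_integrable bounded_linear_quadratic_form] by (simp add: o_def)
      fix r assume "r \<in> {0..t}"
      then have "esum (cov_rate Q B r) * (x \<bullet> x) \<le> C * (x \<bullet> x)"
        using t by (intro mult_right_mono C) auto
      then show "x \<bullet> (cov_rate Q B r *v x) \<le> C * (x \<bullet> x)"
        using quadratic_form_le_esum order_trans by blast
    qed auto
    then show ?thesis using t by (simp add: mult_ac)
  qed
  then show thesis using C(1) that by blast
qed

section \<open>Continuity in time and growth of the determinant\<close>

lemma continuous_on_cov_entry: "continuous_on {0..} (\<lambda>t. cov Q B t $ i $ j)"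
  unfolding continuous_on_eq_continuous_within
proof
  fix t :: real assume "t \<in> {0..}"
  then have t: "0 \<le> t" by simp
  have "continuous_on {0..t + 1} (\<lambda>t. cov Q B t $ i $ j)"
    unfolding cov_entry
    by (rule indefinite_integral_continuous_1)
       (rule integrable_linear[OF cov_rate_integrable bounded_linear_compose[OF bounded_linear_vec_nth bounded_linear_vec_nth], unfolded o_def])
  then have "continuous (at t within {0..t + 1}) (\<lambda>t. cov Q B t $ i $ j)"
    using t by (simp add: continuous_on_eq_continuous_within)
  moreover have "at t within {0..t + 1} = at t within {0..}"
    by (rule at_within_nhd[of _ "{..<t + 1}"]) auto
  ultimately show "continuous (at t within {0..}) (\<lambda>t. cov Q B t $ i $ j)" by (simp add: continuous_within)
qed

text \<open>The matrix at time 2t is the one at time t plus its congruence by e^{tB}, whose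
  determinant is at least as large because det e^{tB} \<ge> 1.\<close>

lemma det_cov_double:
  fixes Q B :: "real^'n^'n"
  assumes adm: "admissible Q B" and tr: "0 \<le> trace B" and t: "0 < t"
  shows "2 ^ CARD('n) * det (cov Q B t) \<le> det (cov Q B (2 * t))"
proof -
  have s: "spd (cov Q B t)" by (rule spd_cov[OF adm t])
  have d: "1 \<le> det (mexp t B)" using det_mexp_ge_1[OF tr] t by simp
  have "1 * det (cov Q B t) \<le> (det (mexp t B))\<^sup>2 * det (cov Q B t)"
    by (rule mult_right_mono) (use d spd_det_pos[OF s] in auto)
  also have "\<dots> = det (mexp t B ** cov Q B t ** transpose (mexp t B))"
    by (simp add: det_mul power2_eq_square mult_ac)
  finally have le: "det (cov Q B t) \<le> det (mexp t B ** cov Q B t ** transpose (mexp t B))" by simp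
  have "2 ^ CARD('n) * det (cov Q B t) \<le> det (cov Q B t + mexp t B ** cov Q B t ** transpose (mexp t B))"
    by (rule spd_det_add_ge[OF s spd_congruence[OF _ s] le]) (use d in auto)
  moreover have "cov Q B (2 * t) = cov Q B t + mexp t B ** cov Q B t ** transpose (mexp t B)"
    unfolding mult_2 by (rule cov_add) (use t in auto)
  ultimately show ?thesis by (simp only:)
qed

lemma det_cov_mono:
  assumes adm: "admissible Q B" and t: "0 < u" "u \<le> t"
  shows "det (cov Q B u) \<le> det (cov Q B t)"
proof (rule spd_det_mono[OF spd_cov[OF adm] spd_cov[OF adm]])
  fix x
  have nn: "0 \<le> x \<bullet> (cov_rate Q B r *v x)" for r
  proof -
    have "x \<bullet> (cov_rate Q B r *v x) = x \<bullet> (mexp r B *v (Q *v (transpose (mexp r B) *v x)))"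
      unfolding cov_rate_def by (simp only: matrix_vector_mul_assoc matrix_mul_assoc)
    also have "\<dots> = (transpose (mexp r B) *v x) \<bullet> (Q *v (transpose (mexp r B) *v x))"
      by (rule inner_matrix_transpose)
    also have "\<dots> \<ge> 0" using adm by (auto simp: admissible_def simp del: transpose_matrix_vector)
    finally show ?thesis .
  qed
  have int: "(\<lambda>r. x \<bullet> (cov_rate Q B r *v x)) integrable_on {0..c}" for c
    using integrable_linear[OF cov_rate_integrable bounded_linear_quadratic_form] by (simp add: o_def)
  show "x \<bullet> (cov Q B u *v x) \<le> x \<bullet> (cov Q B t *v x)"
    unfolding cov_form by (rule integral_subset_le) (use t nn int in auto)
qed (use t in auto)

text \<open>Iterated doubling: each step gains at least 2^N \<ge> 4, which is quadratic growth along
  powers of two. The argument t / 2 pays for rounding t down to such a power. On taking square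
  roots, V grows at least linearly.\<close>

lemma det_cov_ge:
  fixes Q B :: "real^'n^'n"
  assumes adm: "admissible Q B" and tr: "0 \<le> trace B" and N: "2 \<le> CARD('n)" and t: "1 \<le> t"
  shows "det (cov Q B 1) * (t / 2)\<^sup>2 \<le> det (cov Q B t)"
proof -
  have pow: "det (cov Q B 1) * (2 ^ n)\<^sup>2 \<le> det (cov Q B (2 ^ n))" for n
  proof (induction n)
    case (Suc n)
    have pos: "0 < det (cov Q B (2 ^ n))" by (intro spd_det_pos spd_cov adm) simp
    have "det (cov Q B 1) * (2 ^ Suc n)\<^sup>2 = 2 ^ 2 * (det (cov Q B 1) * (2 ^ n)\<^sup>2)"
      by (simp add: power2_eq_square)
    also have "\<dots> \<le> 2 ^ 2 * det (cov Q B (2 ^ n))" using Suc by simp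
    also have "\<dots> \<le> 2 ^ CARD('n) * det (cov Q B (2 ^ n))"
      using pos N by (intro mult_right_mono power_increasing) auto
    also have "\<dots> \<le> det (cov Q B (2 * 2 ^ n))" by (rule det_cov_double[OF adm tr]) simp
    finally show ?case by simp
  qed simp
  obtain n where n: "2 ^ n \<le> t" "t < 2 ^ Suc n"
  proof -
    define m where "m = (LEAST m. t < 2 ^ m)"
    obtain k where "t < 2 ^ k" using real_arch_pow[of 2 t] by auto
    then have m: "t < 2 ^ m" unfolding m_def by (rule LeastI)
    with t obtain n where mn: "m = Suc n" by (cases m) auto
    then have "\<not> t < 2 ^ n" using not_less_Least[of n "\<lambda>m. t < 2 ^ m"] m_def by simp
    then show thesis by (intro that[of n]) (use m mn in auto)
  qed
  have "det (cov Q B 1) * (t / 2)\<^sup>2 \<le> det (cov Q B 1) * (2 ^ n)\<^sup>2"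
    using n t spd_det_pos[OF spd_cov[OF adm], of 1] by (intro mult_left_mono power_mono) auto
  also have "\<dots> \<le> det (cov Q B (2 ^ n))" by (rule pow)
  also have "\<dots> \<le> det (cov Q B t)" by (rule det_cov_mono[OF adm]) (use n in auto)
  finally show ?thesis .
qed

text \<open>The inverse of K(t) is t times the inverse of \<open>cov Q B t\<close>, which cancels
  the 1/t in the exponent.\<close>

lemma pker_eq_gk:
  assumes adm: "admissible Q B" and t: "0 < t"
  shows "pker Q B X Y t = gk (cov Q B t) (Y - mexp t B *v X)"
proof -
  define w where "w = Y - mexp t B *v X"
  have d: "0 < det (cov Q B t)" by (rule spd_det_pos[OF spd_cov[OF adm t]])
  have K: "Kmat Q B t = (1/t) *\<^sub>R cov Q B t"
    using t unfolding scaleR_Kmat[OF t, symmetric] by simp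
  have "matrix_inv (Kmat Q B t) = t *\<^sub>R matrix_inv (cov Q B t)"
    unfolding K by (rule matrix_inv_unique) (use d t in \<open>simp add: matrix_scalar_ac scalar_matrix_assoc[symmetric] matrix_inv_cancel\<close>)
  then have "msq Q B t X Y = t * (w \<bullet> (matrix_inv (cov Q B t) *v w))"
    unfolding msq_def w_def[symmetric] by (simp add: scaleR_matrix_vector_assoc[symmetric] inner_commute)
  then show ?thesis unfolding pker_def gk_def scaleR_Kmat[OF t] w_def[symmetric] using t by simp
qed

section \<open>Transition kernels\<close>

text \<open>What the fractional power argument uses of the heat kernel. Mass one makes P_t a
  contraction of bounded functions, and co-mass at most one makes it an L^1 contraction. The
  displacement bound controls small times; since its constant grows like 1 + |x|,
  \<open>p_moment\<close> is there to integrate it against another kernel. \<open>p_decay\<close>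
  controls large times.\<close>

locale transition_kernel =
  fixes p :: "real \<Rightarrow> 'a::euclidean_space \<Rightarrow> 'a \<Rightarrow> real"
  assumes p_nonneg: "0 \<le> p t x y"
    and p_measurable: "(\<lambda>(t, x, y). p t x y) \<in> borel_measurable (borel \<Otimes>\<^sub>M borel \<Otimes>\<^sub>M borel)"
    and p_mass: "0 < t \<Longrightarrow> (\<integral>\<^sup>+y. ennreal (p t x y) \<partial>lborel) = 1"
    and p_comass: "0 < t \<Longrightarrow> (\<integral>\<^sup>+x. ennreal (p t x y) \<partial>lborel) \<le> 1"
    and chapman_kolmogorov: "0 < u \<Longrightarrow> 0 < r \<Longrightarrow>
      (\<integral>\<^sup>+z. ennreal (p u x z * p r z y) \<partial>lborel) = ennreal (p (u + r) x y)"
    and p_displacement: "\<exists>C\<ge>0. \<forall>u x. 0 < u \<longrightarrow> u \<le> 1 \<longrightarrow>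
      (\<integral>\<^sup>+y. ennreal (p u x y * norm (y - x)) \<partial>lborel) \<le> ennreal (C * (1 + norm x) * sqrt u)"
    and p_moment: "\<exists>C\<ge>0. \<forall>u x. 0 < u \<longrightarrow> u \<le> R \<longrightarrow>
      (\<integral>\<^sup>+y. ennreal (p u x y * norm y) \<partial>lborel) \<le> ennreal (C * (1 + norm x))"
    and p_decay: "\<exists>C\<ge>0. \<forall>u\<ge>1. \<forall>x y. p u x y \<le> C / u"

text \<open>The kernel of $P_t$, cut off at $t \le 0$ to make it jointly measurable on the whole line.\<close>

definition pk :: "real^'n^'n \<Rightarrow> real^'n^'n \<Rightarrow> real \<Rightarrow> real^'n \<Rightarrow> real^'n \<Rightarrow> real" where
  "pk Q B t x y = (if 0 < t then pker Q B x y t else 0)"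

lemma pk_eq_gk: "admissible Q B \<Longrightarrow> 0 < t \<Longrightarrow> pk Q B t x y = gk (cov Q B t) (y - mexp t B *v x)"
  by (simp add: pk_def pker_eq_gk)

lemma borel_measurable_vec_component[measurable]: "(\<lambda>x::real^'n. x $ i) \<in> borel_measurable borel"
  by (intro borel_measurable_continuous_onI continuous_intros)

lemma pk_measurable:
  fixes Q B :: "real^'n^'n"
  assumes adm: "admissible Q B"
  shows "(\<lambda>(t, x, y). pk Q B t x y) \<in> borel_measurable (borel \<Otimes>\<^sub>M borel \<Otimes>\<^sub>M borel)"
proof -
  \<comment> \<open>Filling in the identity matrix for t \<le> 0 keeps the determinant nonzero on
    the whole line, as \<open>borel_measurable_gk2\<close> requires.\<close>
  define G where "G = (\<lambda>t. if t \<in> {0<..} then cov Q B t else mat 1)"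
  have [measurable]: "(\<lambda>t. G t $ i $ j) \<in> borel_measurable borel" for i j
  proof -
    have "(\<lambda>t. if t \<in> {0<..} then cov Q B t $ i $ j else mat 1 $ i $ j) \<in> borel_measurable borel"
      by (intro borel_measurable_continuous_on_if continuous_on_subset[OF continuous_on_cov_entry] continuous_on_const) auto
    also have "(\<lambda>t. if t \<in> {0<..} then cov Q B t $ i $ j else mat 1 $ i $ j) = (\<lambda>t. G t $ i $ j)"
      by (auto simp: G_def)
    finally show ?thesis .
  qed
  have [measurable]: "(\<lambda>t. mexp t B $ i $ j) \<in> borel_measurable borel" for i j
    by (intro borel_measurable_continuous_onI continuous_on_mexp_entry)
  have dG: "det (G t) \<noteq> 0" for t
    using spd_det_pos[OF spd_cov[OF adm]] by (auto simp: G_def less_imp_neq[symmetric])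
  have [measurable]: "(\<lambda>q. gk (G (fst q)) (snd (snd q) - mexp (fst q) B *v fst (snd q)))
      \<in> borel_measurable (borel \<Otimes>\<^sub>M borel \<Otimes>\<^sub>M borel)"
    by (rule borel_measurable_gk2) (simp_all add: dG matrix_vector_mult_def)
  have "(\<lambda>(t, x, y). pk Q B t x y) =
      (\<lambda>q. if 0 < fst q then gk (G (fst q)) (snd (snd q) - mexp (fst q) B *v fst (snd q)) else 0)"
    by (auto simp: fun_eq_iff G_def pk_eq_gk[OF adm]) (simp add: pk_def)
  moreover have "\<dots> \<in> borel_measurable (borel \<Otimes>\<^sub>M borel \<Otimes>\<^sub>M borel)" by measurable
  ultimately show ?thesis by (simp only:)
qed

lemma pk_mass:
  assumes adm: "admissible Q B" and t: "0 < t"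
  shows "(\<integral>\<^sup>+y. ennreal (pk Q B t x y) \<partial>lborel) = 1"
  unfolding pk_eq_gk[OF adm t]
  using nn_integral_lborel_translate[of "\<lambda>y. ennreal (gk (cov Q B t) y)" "- (mexp t B *v x)"]
  by (simp add: nn_integral_gk[OF spd_cov[OF adm t]])

text \<open>In the starting point x the kernel is a Gaussian composed with e^{tB}; the substitution
  produces the Jacobian 1 / det e^{tB} \<le> 1.\<close>

lemma pk_comass:
  assumes adm: "admissible Q B" and tr: "0 \<le> trace B" and t: "0 < t"
  shows "(\<integral>\<^sup>+x. ennreal (pk Q B t x y) \<partial>lborel) \<le> 1"
proof -
  have d: "1 \<le> det (mexp t B)" using det_mexp_ge_1[OF tr] t by simp
  let ?I = "\<integral>\<^sup>+x. ennreal (gk (cov Q B t) (y - mexp t B *v x)) \<partial>lborel"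
  have "?I \<le> ennreal \<bar>det (mexp t B)\<bar> * ?I"
    using mult_right_mono[of 1 "ennreal \<bar>det (mexp t B)\<bar>" ?I] d by simp
  also have "\<dots> = (\<integral>\<^sup>+x. ennreal (gk (cov Q B t) (y - x)) \<partial>lborel)"
    by (rule nn_integral_lborel_matrix) (use d in auto)
  also have "\<dots> = 1"
    by (subst nn_integral_lborel_reflect_translate[of "\<lambda>y. ennreal (gk (cov Q B t) y)"])
       (simp_all add: nn_integral_gk[OF spd_cov[OF adm t]])
  finally show ?thesis unfolding pk_eq_gk[OF adm t] .
qed

text \<open>Centre z at e^{uB} x and push the first Gaussian through e^{rB}. The integral becomes a
  convolution of two Gaussians whose matrices add up to \<open>cov Q B (u + r)\<close> by
  \<open>cov_add\<close>.\<close>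

lemma pk_chapman_kolmogorov:
  assumes adm: "admissible Q B" and tr: "0 \<le> trace B" and u: "0 < u" and r: "0 < r"
  shows "(\<integral>\<^sup>+z. ennreal (pk Q B u x z * pk Q B r z y) \<partial>lborel) = ennreal (pk Q B (u + r) x y)"
proof -
  define M where "M = mexp r B"
  define S where "S = M ** cov Q B u ** transpose M"
  define y' where "y' = y - mexp (u + r) B *v x"
  have d: "1 \<le> det M" unfolding M_def using det_mexp_ge_1[OF tr] r by simp
  have Gu: "spd (cov Q B u)" and Gr: "spd (cov Q B r)" using spd_cov[OF adm] u r by auto
  have S: "spd S" unfolding S_def by (rule spd_congruence[OF _ Gu]) (use d in auto)
  have e: "y - M *v (z + mexp u B *v x) = y' - M *v z" for z
    by (simp add: y'_def M_def matrix_vector_right_distrib matrix_vector_mul_assoc mexp_add[symmetric] add.commute)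
  have "(\<integral>\<^sup>+z. ennreal (pk Q B u x z * pk Q B r z y) \<partial>lborel)
      = (\<integral>\<^sup>+z. ennreal (gk (cov Q B u) (z - mexp u B *v x) * gk (cov Q B r) (y - M *v z)) \<partial>lborel)"
    unfolding pk_eq_gk[OF adm u] pk_eq_gk[OF adm r] M_def ..
  also have "\<dots> = (\<integral>\<^sup>+z. ennreal (gk (cov Q B u) z * gk (cov Q B r) (y' - M *v z)) \<partial>lborel)"
    using nn_integral_lborel_translate[of "\<lambda>z. ennreal (gk (cov Q B u) (z - mexp u B *v x) * gk (cov Q B r) (y - M *v z))" "mexp u B *v x", symmetric]
    unfolding e by simp
  also have "\<dots> = (\<integral>\<^sup>+z. ennreal \<bar>det M\<bar> * ennreal (gk (cov Q B r) (y' - M *v z) * gk S (M *v z)) \<partial>lborel)"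
  proof (rule nn_integral_cong)
    fix z
    have "gk (cov Q B u) z = \<bar>det M\<bar> * gk S (M *v z)"
      unfolding S_def by (rule gk_congruence[symmetric, OF _ Gu]) (use d in auto)
    then show "ennreal (gk (cov Q B u) z * gk (cov Q B r) (y' - M *v z)) =
        ennreal \<bar>det M\<bar> * ennreal (gk (cov Q B r) (y' - M *v z) * gk S (M *v z))"
      by (simp add: ennreal_mult[symmetric] gk_nonneg mult_ac)
  qed
  also have "\<dots> = ennreal \<bar>det M\<bar> * (\<integral>\<^sup>+z. ennreal (gk (cov Q B r) (y' - M *v z) * gk S (M *v z)) \<partial>lborel)"
    by (rule nn_integral_cmult) measurable
  also have "\<dots> = (\<integral>\<^sup>+z. ennreal (gk (cov Q B r) (y' - z) * gk S z) \<partial>lborel)"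
    by (rule nn_integral_lborel_matrix) (use d in auto)
  also have "\<dots> = ennreal (gk (cov Q B r + S) y')" by (rule gk_convolution[OF Gr S])
  also have "cov Q B r + S = cov Q B (u + r)"
    using cov_add[of r u Q B] u r by (simp add: S_def M_def add.commute)
  finally show ?thesis using pk_eq_gk[OF adm, of "u + r" x y] u r by (simp add: y'_def)
qed

text \<open>Spread of the Gaussian plus distance from its centre to a. The choice a = x gives the
  displacement bound of the locale, and a = 0 its first moment.\<close>

lemma pk_distance_moment:
  fixes Q B :: "real^'n^'n"
  assumes adm: "admissible Q B" and t: "0 < t"
    and m: "\<And>x. x \<bullet> (cov Q B t *v x) \<le> m * (x \<bullet> x)" and m0: "0 \<le> m"
  shows "(\<integral>\<^sup>+y. ennreal (pk Q B t x y * norm (y - a)) \<partial>lborel)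
    \<le> ennreal (2 * 2 powr (real CARD('n) / 2) * sqrt m + norm (mexp t B *v x - a))"
proof -
  define G where "G = cov Q B t"
  define b where "b = mexp t B *v x"
  have G: "spd G" unfolding G_def by (rule spd_cov[OF adm t])
  have "(\<integral>\<^sup>+y. ennreal (pk Q B t x y * norm (y - a)) \<partial>lborel) \<le>
      (\<integral>\<^sup>+y. ennreal (gk G (y - b) * norm (y - b)) + ennreal (norm (b - a)) * ennreal (gk G (y - b)) \<partial>lborel)"
  proof (rule nn_integral_mono)
    fix y
    have "norm (y - a) \<le> norm (y - b) + norm (b - a)" using norm_triangle_ineq[of "y - b" "b - a"] by simp
    then have "gk G (y - b) * norm (y - a) \<le> gk G (y - b) * (norm (y - b) + norm (b - a))"
      by (rule mult_left_mono) (rule gk_nonneg)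
    then show "ennreal (pk Q B t x y * norm (y - a)) \<le> ennreal (gk G (y - b) * norm (y - b)) + ennreal (norm (b - a)) * ennreal (gk G (y - b))"
      unfolding pk_eq_gk[OF adm t] G_def[symmetric] b_def[symmetric]
      by (simp add: ennreal_mult[symmetric] ennreal_plus[symmetric] gk_nonneg algebra_simps del: ennreal_plus)
  qed
  also have "\<dots> = (\<integral>\<^sup>+y. ennreal (gk G (y - b) * norm (y - b)) \<partial>lborel) + ennreal (norm (b - a)) * (\<integral>\<^sup>+y. ennreal (gk G (y - b)) \<partial>lborel)"
    by (subst nn_integral_add) (auto simp: nn_integral_cmult)
  also have "(\<integral>\<^sup>+y. ennreal (gk G (y - b) * norm (y - b)) \<partial>lborel) = (\<integral>\<^sup>+y. ennreal (gk G y * norm y) \<partial>lborel)"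
    using nn_integral_lborel_translate[of "\<lambda>y. ennreal (gk G y * norm y)" "- b"] by simp
  also have "(\<integral>\<^sup>+y. ennreal (gk G (y - b)) \<partial>lborel) = 1"
    using nn_integral_lborel_translate[of "\<lambda>y. ennreal (gk G y)" "- b"] nn_integral_gk[OF G] by simp
  also have "(\<integral>\<^sup>+y. ennreal (gk G y * norm y) \<partial>lborel) + ennreal (norm (b - a)) * 1
      \<le> ennreal (2 * 2 powr (real CARD('n) / 2) * sqrt m) + ennreal (norm (b - a))"
    using gk_first_moment[OF G m[folded G_def] m0] by (simp add: add_right_mono)
  also have "\<dots> = ennreal (2 * 2 powr (real CARD('n) / 2) * sqrt m + norm (b - a))"
    using m0 by simp
  finally show ?thesis unfolding b_def .
qed

lemma pk_le:
  fixes Q B :: "real^'n^'n"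
  assumes adm: "admissible Q B" and t: "0 < t"
  shows "pk Q B t x y \<le> (4 * pi) powr (- real CARD('n) / 2) * det (cov Q B t) powr (-1/2)"
  unfolding pk_eq_gk[OF assms] by (rule gk_le[OF spd_cov[OF assms]])

text \<open>The mean value theorem bounds each entry of e^{uB} - 1 by C u; summing over all N^2
  entries gives the constant C'.\<close>

lemma norm_mexp_displacement:
  obtains C where "0 \<le> C" "\<And>u x. 0 \<le> u \<Longrightarrow> u \<le> 1 \<Longrightarrow> norm (mexp u B *v x - x) \<le> C * u * norm x"
proof -
  have "continuous_on {0..1} (\<lambda>u. B ** mexp u B)"
    by (rule linear_continuous_on_compose[OF continuous_on_mexp])
       (rule bounded_linear.linear[OF bounded_linear_matrix_mult(1)])
  then obtain C where C: "0 \<le> C" "\<And>u. 0 \<le> u \<Longrightarrow> u \<le> 1 \<Longrightarrow> esum (B ** mexp u B) \<le> C"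
    by (rule esum_bounded_on_interval) blast
  define C' where "C' = real (CARD('a) * CARD('a)) * C"
  have "norm (mexp u B *v x - x) \<le> C' * u * norm x" if u: "0 \<le> u" "u \<le> 1" for u x
  proof -
    have "\<bar>(mexp u B - mat 1) $ i $ j\<bar> \<le> C * u" for i j
    proof (cases "u = 0")
      case False
      with u have u0: "0 < u" by simp
      obtain z where z: "0 < z" "z < u" "mexp u B $ i $ j - mexp 0 B $ i $ j = (u - 0) * (B ** mexp z B) $ i $ j"
        using MVT2[OF u0 DERIV_mexp_entry] by blast
      have "\<bar>(B ** mexp z B) $ i $ j\<bar> \<le> (\<Sum>j\<in>UNIV. \<bar>(B ** mexp z B) $ i $ j\<bar>)"
        by (rule member_le_sum) auto
      also have "\<dots> \<le> esum (B ** mexp z B)" by (rule row_sum_le_esum)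
      also have "\<dots> \<le> C" using z u by (intro C) auto
      finally show ?thesis using z(3) u0 by (simp add: mexp_0 abs_mult)
    qed (simp add: mexp_0)
    then have "esum (mexp u B - mat 1) \<le> (\<Sum>i\<in>(UNIV::'a set). \<Sum>j\<in>(UNIV::'a set). C * u)"
      unfolding esum_def by (intro sum_mono)
    then have "esum (mexp u B - mat 1) \<le> C' * u" by (simp add: C'_def mult_ac)
    moreover have "norm ((mexp u B - mat 1) *v x) \<le> esum (mexp u B - mat 1) * norm x"
      by (rule norm_matrix_vector_le_esum)
    ultimately have "norm ((mexp u B - mat 1) *v x) \<le> C' * u * norm x"
      by (meson mult_right_mono norm_ge_zero order_trans)
    then show ?thesis by (simp add: matrix_vector_mult_diff_rdistrib)
  qed
  then show thesis using C(1) by (intro that[of C']) (auto simp: C'_def)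
qed

theorem transition_kernel_pk:
  fixes Q B :: "real^'n^'n"
  assumes adm: "admissible Q B" and tr: "0 \<le> trace B" and N: "2 \<le> CARD('n)"
  shows "transition_kernel (pk Q B)"
proof
  define D where "D = 2 * 2 powr (real CARD('n) / 2)"
  have D: "0 \<le> D" by (simp add: D_def)
  show "0 \<le> pk Q B t x y" for t x y by (simp add: pk_def pker_def)
  show "(\<lambda>(t, x, y). pk Q B t x y) \<in> borel_measurable (borel \<Otimes>\<^sub>M borel \<Otimes>\<^sub>M borel)"
    by (rule pk_measurable[OF adm])
  show "0 < t \<Longrightarrow> (\<integral>\<^sup>+y. ennreal (pk Q B t x y) \<partial>lborel) = 1" for t x by (rule pk_mass[OF adm])
  show "0 < t \<Longrightarrow> (\<integral>\<^sup>+x. ennreal (pk Q B t x y) \<partial>lborel) \<le> 1" for t y by (rule pk_comass[OF adm tr])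
  show "0 < u \<Longrightarrow> 0 < r \<Longrightarrow>
      (\<integral>\<^sup>+z. ennreal (pk Q B u x z * pk Q B r z y) \<partial>lborel) = ennreal (pk Q B (u + r) x y)" for u r x y
    by (rule pk_chapman_kolmogorov[OF adm tr])
  show "\<exists>C\<ge>0. \<forall>u x. 0 < u \<longrightarrow> u \<le> 1 \<longrightarrow>
      (\<integral>\<^sup>+y. ennreal (pk Q B u x y * norm (y - x)) \<partial>lborel) \<le> ennreal (C * (1 + norm x) * sqrt u)"
  proof -
    obtain C1 where C1: "0 \<le> C1" "\<And>t x. 0 \<le> t \<Longrightarrow> t \<le> 1 \<Longrightarrow> x \<bullet> (cov Q B t *v x) \<le> C1 * t * (x \<bullet> x)"
      by (rule cov_form_le) blast
    obtain C2 where C2: "0 \<le> C2" "\<And>u x. 0 \<le> u \<Longrightarrow> u \<le> 1 \<Longrightarrow> norm (mexp u B *v x - x) \<le> C2 * u * norm x"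
      by (rule norm_mexp_displacement) blast
    show ?thesis
    proof (intro exI[of _ "D * sqrt C1 + C2"] conjI allI impI)
      show "0 \<le> D * sqrt C1 + C2" using D C1 C2 by simp
      fix u :: real and x :: "real^'n" assume u: "0 < u" "u \<le> 1"
      have "(\<integral>\<^sup>+y. ennreal (pk Q B u x y * norm (y - x)) \<partial>lborel) \<le> ennreal (D * sqrt (C1 * u) + norm (mexp u B *v x - x))"
        unfolding D_def by (rule pk_distance_moment[OF adm]) (use u C1 in auto)
      also have "\<dots> \<le> ennreal ((D * sqrt C1 + C2) * (1 + norm x) * sqrt u)"
      proof (rule ennreal_leI)
        \<comment> \<open>The drift contributes order u and the diffusion order sqrt u; for u \<le>
          1 both are covered by sqrt u.\<close>
        have "u \<le> sqrt u" using u by (simp add: real_le_rsqrt power2_eq_square mult_left_le)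
        have "norm (mexp u B *v x - x) \<le> C2 * u * norm x" using u by (intro C2) auto
        also have "\<dots> \<le> C2 * sqrt u * (1 + norm x)"
          using \<open>u \<le> sqrt u\<close> C2 u by (intro mult_mono) auto
        finally have 1: "norm (mexp u B *v x - x) \<le> C2 * sqrt u * (1 + norm x)" .
        have 2: "D * sqrt (C1 * u) \<le> D * sqrt C1 * sqrt u * (1 + norm x)"
          using D C1 u by (simp add: real_sqrt_mult mult_le_cancel_left1 algebra_simps)
        show "D * sqrt (C1 * u) + norm (mexp u B *v x - x) \<le> (D * sqrt C1 + C2) * (1 + norm x) * sqrt u"
          using 1 2 by (simp add: algebra_simps)
      qed
      finally show "(\<integral>\<^sup>+y. ennreal (pk Q B u x y * norm (y - x)) \<partial>lborel) \<le> ennreal ((D * sqrt C1 + C2) * (1 + norm x) * sqrt u)" .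
    qed
  qed
  show "\<exists>C\<ge>0. \<forall>u x. 0 < u \<longrightarrow> u \<le> R \<longrightarrow>
      (\<integral>\<^sup>+y. ennreal (pk Q B u x y * norm y) \<partial>lborel) \<le> ennreal (C * (1 + norm x))" for R
  proof -
    obtain C1 where C1: "0 \<le> C1" "\<And>t x. 0 \<le> t \<Longrightarrow> t \<le> R \<Longrightarrow> x \<bullet> (cov Q B t *v x) \<le> C1 * t * (x \<bullet> x)"
      by (rule cov_form_le) blast
    obtain C2 where C2: "0 \<le> C2" "\<And>t. 0 \<le> t \<Longrightarrow> t \<le> R \<Longrightarrow> esum (mexp t B) \<le> C2"
      using esum_bounded_on_interval[OF continuous_on_mexp] by blast
    define C where "C = D * sqrt (C1 * \<bar>R\<bar>) + C2"
    have C0: "0 \<le> C" using D C1 C2 by (simp add: C_def)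
    show ?thesis
    proof (intro exI[of _ C] conjI allI impI C0)
      fix u :: real and x :: "real^'n" assume u: "0 < u" "u \<le> R"
      have "(\<integral>\<^sup>+y. ennreal (pk Q B u x y * norm (y - 0)) \<partial>lborel) \<le> ennreal (D * sqrt (C1 * u) + norm (mexp u B *v x - 0))"
        unfolding D_def by (rule pk_distance_moment[OF adm]) (use u C1 in auto)
      also have "\<dots> \<le> ennreal (C * (1 + norm x))"
      proof (rule ennreal_leI)
        have "norm (mexp u B *v x) \<le> esum (mexp u B) * norm x" by (rule norm_matrix_vector_le_esum)
        also have "\<dots> \<le> C2 * norm x" using u by (intro mult_right_mono C2) auto
        finally have 1: "norm (mexp u B *v x) \<le> C2 * norm x" .
        have "sqrt (C1 * u) \<le> sqrt (C1 * \<bar>R\<bar>)" using u C1 by (intro real_sqrt_le_mono mult_left_mono) auto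
        then have 2: "D * sqrt (C1 * u) \<le> D * sqrt (C1 * \<bar>R\<bar>)" using D by (rule mult_left_mono)
        have "D * sqrt (C1 * \<bar>R\<bar>) + C2 * norm x \<le> C * (1 + norm x)"
          using D C1 C2 by (simp add: C_def algebra_simps)
        then show "D * sqrt (C1 * u) + norm (mexp u B *v x - 0) \<le> C * (1 + norm x)"
          using 1 2 by simp
      qed
      finally show "(\<integral>\<^sup>+y. ennreal (pk Q B u x y * norm y) \<partial>lborel) \<le> ennreal (C * (1 + norm x))" by simp
    qed
  qed
  show "\<exists>C\<ge>0. \<forall>u\<ge>1. \<forall>x y. pk Q B u x y \<le> C / u"
  proof -
    define d where "d = det (cov Q B 1)"
    have d: "0 < d" unfolding d_def by (intro spd_det_pos spd_cov adm) simp
    define c where "c = (4 * pi) powr (- real CARD('n) / 2)"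
    have c: "0 \<le> c" by (simp add: c_def)
    show ?thesis
    \<comment> \<open>By \<open>det_cov_ge\<close> the determinant is at least d (u/2)^2, whose
      power -1/2 is d^(-1/2) * 2 / u.\<close>
    proof (intro exI[of _ "c * d powr (-1/2) * 2"] conjI allI impI)
      show "0 \<le> c * d powr (-1/2) * 2" using c by simp
      fix u :: real and x y :: "real^'n" assume u: "1 \<le> u"
      have "pk Q B u x y \<le> c * det (cov Q B u) powr (-1/2)"
        unfolding c_def by (rule pk_le[OF adm]) (use u in simp)
      also have "det (cov Q B u) powr (-1/2) \<le> (d * (u / 2)\<^sup>2) powr (-1/2)"
        using det_cov_ge[OF adm tr N u] d u unfolding d_def[symmetric]
        by (intro powr_mono2') auto
      also have "(d * (u / 2)\<^sup>2) powr (-1/2) = d powr (-1/2) * 2 / u"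
      proof -
        have "((u / 2)\<^sup>2) powr (-1/2) = 2 / u"
          using u powr_half_sqrt[of "(u / 2)\<^sup>2"] by (simp add: powr_minus_divide)
        then show ?thesis using d u by (simp add: powr_mult)
      qed
      finally show "pk Q B u x y \<le> c * d powr (-1/2) * 2 / u" using c by (simp add: mult_left_mono mult.assoc)
    qed
  qed
qed

section \<open>The scalar identity inverting a Marchaud derivative\<close>

text \<open>The truncated power x_+^a. Vanishing for x \<le> 0, it lets every integral run over the
  whole line, where translations and exchanges are simplest.\<close>

definition ppow :: "real \<Rightarrow> real \<Rightarrow> real" where
  "ppow a x = (if 0 < x then x powr a else 0)"

lemma ppow_nonneg[simp]: "0 \<le> ppow a x" by (simp add: ppow_def)

lemma borel_measurable_ppow[measurable]: "ppow a \<in> borel_measurable borel"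
  unfolding ppow_def[abs_def] by measurable

lemma nn_integral_ppow_from_0:
  assumes "-1 < a" "0 \<le> c"
  shows "(\<integral>\<^sup>+x. ennreal (ppow a x) * indicator {..c} x \<partial>lborel) = ennreal (c powr (a + 1) / (a + 1))"
proof -
  have "(\<integral>\<^sup>+x. ennreal (ppow a x) * indicator {..c} x \<partial>lborel) = (\<integral>\<^sup>+x. ennreal (x powr a) * indicator {0..c} x \<partial>lborel)"
    by (rule nn_integral_cong_AE) (rule AE_mp[OF AE_lborel_singleton[of 0]], auto simp: ppow_def split: split_indicator)
  also have "\<dots> = ennreal (c powr (a + 1) / (a + 1))"
    by (rule nn_integral_has_integral_lebesgue'[OF _ has_integral_powr_from_0]) (use assms in auto)
  finally show ?thesis .
qed

lemma nn_integral_ppow_to_inf: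
  assumes "a < -1" "0 < c"
  shows "(\<integral>\<^sup>+x. ennreal (ppow a x) * indicator {c..} x \<partial>lborel) = ennreal (- (c powr (a + 1)) / (a + 1))"
proof -
  have "(\<integral>\<^sup>+x. ennreal (ppow a x) * indicator {c..} x \<partial>lborel) = (\<integral>\<^sup>+x. ennreal (x powr a) * indicator {c..} x \<partial>lborel)"
    by (rule nn_integral_cong) (use assms in \<open>auto simp: ppow_def split: split_indicator\<close>)
  also have "\<dots> = ennreal (- (c powr (a + 1)) / (a + 1))"
    by (rule nn_integral_has_integral_lebesgue'[OF _ has_integral_powr_to_inf]) (use assms in auto)
  finally show ?thesis .
qed

lemma nn_integral_shift:
  fixes f :: "real \<Rightarrow> ennreal"
  assumes "f \<in> borel_measurable borel"
  shows "(\<integral>\<^sup>+x. f (x - a) \<partial>lborel) = integral\<^sup>N lborel f"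
  using nn_integral_lborel_translate[OF assms, of "- a"] by simp

text \<open>\<open>kap s t\<close> is the kernel with which $P_t f - f$ is recovered from $(-A)^s f$: its
  Laplace transform is $\Gamma(s)\lambda^{-s}(e^{-t\lambda}-1)$.\<close>

definition kap :: "real \<Rightarrow> real \<Rightarrow> real \<Rightarrow> real" where
  "kap s t \<tau> = ppow (s - 1) (\<tau> - t) - ppow (s - 1) \<tau>"

lemma borel_measurable_kap[measurable]: "kap s t \<in> borel_measurable borel"
  unfolding kap_def[abs_def] by measurable

text \<open>Three regimes. Up to t only the second power is present. Between t and 2t the difference
  is at most its larger term. Beyond 2t the mean value theorem trades a factor t for one more power
  of decay, which makes the tail integrable because s < 1.\<close>

lemma abs_kap_le:
  assumes s: "0 < s" "s < 1" and t: "0 < t"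
  shows "\<bar>kap s t \<tau>\<bar> \<le> ppow (s - 1) \<tau> * indicator {..t} \<tau> + ppow (s - 1) (\<tau> - t) * indicator {..t} (\<tau> - t)
     + (1 - s) * t * (ppow (s - 2) (\<tau> - t) * indicator {t..} (\<tau> - t))"
proof -
  consider "\<tau> \<le> t" | "t < \<tau>" "\<tau> \<le> 2 * t" | "2 * t < \<tau>" by linarith
  then show ?thesis
  proof cases
    case 1
    then show ?thesis using t by (auto simp: kap_def ppow_def indicator_def)
  next
    case 2
    have "\<tau> powr (s - 1) \<le> (\<tau> - t) powr (s - 1)" using 2 s t by (intro powr_mono2') auto
    then have "\<bar>kap s t \<tau>\<bar> \<le> ppow (s - 1) (\<tau> - t) * indicator {..t} (\<tau> - t)"
      using 2 t by (simp add: kap_def ppow_def)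
    moreover have "0 \<le> (1 - s) * t * (ppow (s - 2) (\<tau> - t) * indicator {t..} (\<tau> - t))" using s t by simp
    moreover have "0 \<le> ppow (s - 1) \<tau> * indicator {..t} \<tau>" by simp
    ultimately show ?thesis by linarith
  next
    case 3
    have mono: "\<tau> powr (s - 1) \<le> (\<tau> - t) powr (s - 1)" using 3 s t by (intro powr_mono2') auto
    have "\<exists>z. \<tau> - t < z \<and> z < \<tau> \<and> \<tau> powr (s - 1) - (\<tau> - t) powr (s - 1) = (\<tau> - (\<tau> - t)) * ((s - 1) * z powr (s - 1 - 1))"
      by (rule MVT2) (use 3 t in \<open>auto intro!: derivative_eq_intros\<close>)
    then obtain z where z: "\<tau> - t < z" "z < \<tau>" "\<tau> powr (s - 1) - (\<tau> - t) powr (s - 1) = t * ((s - 1) * z powr (s - 2))"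
      by auto
    have "z powr (s - 2) \<le> (\<tau> - t) powr (s - 2)" using z 3 s t by (intro powr_mono2') auto
    then have "(1 - s) * t * z powr (s - 2) \<le> (1 - s) * t * (\<tau> - t) powr (s - 2)"
      using s t by (intro mult_left_mono) auto
    then have "(\<tau> - t) powr (s - 1) - \<tau> powr (s - 1) \<le> (1 - s) * t * (\<tau> - t) powr (s - 2)"
      using z(3) by (simp add: algebra_simps)
    then show ?thesis using 3 t mono by (auto simp: kap_def ppow_def indicator_def)
  qed
qed

text \<open>Each of the two singular pieces contributes t^s / s, and the tail contributes
  t^s.\<close>

lemma nn_integral_kap_le:
  assumes s: "0 < s" "s < 1" and t: "0 < t"
  shows "(\<integral>\<^sup>+\<tau>. ennreal \<bar>kap s t \<tau>\<bar> \<partial>lborel) \<le> ennreal ((2 / s + 1) * t powr s)"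
proof -
  let ?f = "\<lambda>x. ennreal (ppow (s - 1) x) * indicator {..t} x"
  let ?g = "\<lambda>x. ennreal (ppow (s - 2) x) * indicator {t..} x"
  have "(\<integral>\<^sup>+\<tau>. ennreal \<bar>kap s t \<tau>\<bar> \<partial>lborel) \<le>
      (\<integral>\<^sup>+\<tau>. ?f \<tau> + ?f (\<tau> - t) + ennreal ((1 - s) * t) * ?g (\<tau> - t) \<partial>lborel)"
  proof (rule nn_integral_mono)
    fix \<tau>
    have "ennreal \<bar>kap s t \<tau>\<bar> \<le> ennreal (ppow (s - 1) \<tau> * indicator {..t} \<tau> + ppow (s - 1) (\<tau> - t) * indicator {..t} (\<tau> - t)
     + (1 - s) * t * (ppow (s - 2) (\<tau> - t) * indicator {t..} (\<tau> - t)))"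
      by (rule ennreal_leI[OF abs_kap_le[OF assms]])
    also have "\<dots> = ?f \<tau> + ?f (\<tau> - t) + ennreal ((1 - s) * t) * ?g (\<tau> - t)"
      using s t by (simp add: ennreal_mult ennreal_indicator)
    finally show "ennreal \<bar>kap s t \<tau>\<bar> \<le> ?f \<tau> + ?f (\<tau> - t) + ennreal ((1 - s) * t) * ?g (\<tau> - t)" .
  qed
  also have "\<dots> = (\<integral>\<^sup>+\<tau>. ?f \<tau> \<partial>lborel) + (\<integral>\<^sup>+\<tau>. ?f (\<tau> - t) \<partial>lborel) + ennreal ((1 - s) * t) * (\<integral>\<^sup>+\<tau>. ?g (\<tau> - t) \<partial>lborel)"
    by (simp add: nn_integral_add nn_integral_cmult)
  also have "\<dots> = (\<integral>\<^sup>+\<tau>. ?f \<tau> \<partial>lborel) + (\<integral>\<^sup>+\<tau>. ?f \<tau> \<partial>lborel) + ennreal ((1 - s) * t) * (\<integral>\<^sup>+\<tau>. ?g \<tau> \<partial>lborel)"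
    using nn_integral_shift[of ?f t] nn_integral_shift[of ?g t] by simp
  also have "\<dots> = ennreal (t powr s / s) + ennreal (t powr s / s) + ennreal ((1 - s) * t) * ennreal (t powr (s - 1) / (1 - s))"
    using s t nn_integral_ppow_from_0[of "s - 1" t] nn_integral_ppow_to_inf[of "s - 2" t]
    by (simp add: minus_divide_right)
  also have "\<dots> = ennreal (t powr s / s + t powr s / s + ((1 - s) * t) * (t powr (s - 1) / (1 - s)))"
  proof -
    have "0 \<le> t powr s / s" "0 \<le> (1 - s) * t" "0 \<le> t powr (s - 1) / (1 - s)" using s t by auto
    then show ?thesis by (simp only: ennreal_mult ennreal_plus add_nonneg_nonneg mult_nonneg_nonneg)
  qed
  also have "t powr s / s + t powr s / s + ((1 - s) * t) * (t powr (s - 1) / (1 - s)) = (2 / s + 1) * t powr s"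
    using s t by (simp add: powr_diff field_simps)
  finally show ?thesis .
qed

text \<open>The substitution \<tau> = t + (u - t) x gives Euler's Beta integral. The exponents s - 1
  and - s add up to -1, so the length u - t drops out and only the condition t < u survives.\<close>

lemma nn_integral_beta:
  assumes s: "0 < s" "s < 1"
  shows "(\<integral>\<^sup>+\<tau>. ennreal (ppow (s - 1) (\<tau> - t) * ppow (- s) (u - \<tau>)) \<partial>lborel)
    = (if t < u then ennreal (Beta s (1 - s)) else 0)"
proof (cases "t < u")
  case True
  define c where "c = u - t"
  have c: "0 < c" using True by (simp add: c_def)
  have "(\<integral>\<^sup>+\<tau>. ennreal (ppow (s - 1) (\<tau> - t) * ppow (- s) (u - \<tau>)) \<partial>lborel)
      = ennreal c * (\<integral>\<^sup>+x. ennreal (ppow (s - 1) (t + c * x - t) * ppow (- s) (u - (t + c * x))) \<partial>lborel)"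
    using c by (subst nn_integral_real_affine[where c=c and t=t]) auto
  also have "\<dots> = (\<integral>\<^sup>+x. ennreal c * ennreal (ppow (s - 1) (t + c * x - t) * ppow (- s) (u - (t + c * x))) \<partial>lborel)"
    by (rule nn_integral_cmult[symmetric]) measurable
  also have "\<dots> = (\<integral>\<^sup>+x. ennreal (x powr (s - 1) * (1 - x) powr (1 - s - 1)) * indicator {0..1} x \<partial>lborel)"
  proof (rule nn_integral_cong_AE, rule AE_mp[OF AE_lborel_singleton[of 0]], rule AE_mp[OF AE_lborel_singleton[of 1]], intro AE_I2 impI)
    fix x :: real assume x: "x \<noteq> 0" "x \<noteq> 1"
    have e: "u - (t + c * x) = c * (1 - x)" by (simp add: c_def algebra_simps)
    show "ennreal c * ennreal (ppow (s - 1) (t + c * x - t) * ppow (- s) (u - (t + c * x)))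
        = ennreal (x powr (s - 1) * (1 - x) powr (1 - s - 1)) * indicator {0..1} x"
    proof (cases "0 < x \<and> x < 1")
      case True
      have "c * (c powr (s - 1) * c powr (- s)) = 1"
        using c by (simp add: powr_add[symmetric] powr_neg_one del: powr_minus)
      then have "c * ((c * x) powr (s - 1) * (c * (1 - x)) powr (- s)) = x powr (s - 1) * (1 - x) powr (1 - s - 1)"
        using c True by (simp add: powr_mult mult_ac)
      then show ?thesis using True c unfolding e by (simp add: ppow_def ennreal_mult[symmetric])
    next
      case False
      then show ?thesis using x c unfolding e by (auto simp: ppow_def zero_less_mult_iff split: split_indicator)
    qed
  qed
  also have "\<dots> = ennreal (Beta s (1 - s))"
    by (rule nn_integral_has_integral_lebesgue'[OF _ has_integral_Beta_real]) (use s in auto)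
  finally show ?thesis using True by simp
next
  case False
  then have "ppow (s - 1) (\<tau> - t) * ppow (- s) (u - \<tau>) = 0" for \<tau> by (auto simp: ppow_def)
  then show ?thesis using False by (simp only: ennreal_0 nn_integral_const) simp
qed

text \<open>Unconditional, because the Bochner integral of a non-integrable function is 0 by
  convention. Estimates can thus be written before finiteness is known.\<close>

lemma ennreal_norm_integral_le:
  fixes f :: "'a \<Rightarrow> real"
  shows "ennreal \<bar>\<integral>x. f x \<partial>M\<bar> \<le> (\<integral>\<^sup>+x. ennreal \<bar>f x\<bar> \<partial>M)"
proof (cases "integrable M f")
  case True
  then show ?thesis using integral_norm_bound_ennreal[OF True] by simp
next
  case False
  then show ?thesis by (simp add: not_integrable_integral_eq)
qed

lemma integral_lborel_swap:
  fixes F :: "'a::euclidean_space \<Rightarrow> 'b::euclidean_space \<Rightarrow> real"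
  assumes [measurable]: "(\<lambda>(x, y). F x y) \<in> borel_measurable (lborel \<Otimes>\<^sub>M lborel)"
    and "(\<integral>\<^sup>+x. \<integral>\<^sup>+y. ennreal \<bar>F x y\<bar> \<partial>lborel \<partial>lborel) < \<infinity>"
  shows "(LBINT x. LBINT y. F x y) = (LBINT y. LBINT x. F x y)"
proof -
  have "(\<integral>\<^sup>+z. ennreal (norm (case z of (x, y) \<Rightarrow> F x y)) \<partial>(lborel \<Otimes>\<^sub>M lborel)) < \<infinity>"
    using assms(2) by (subst lborel.nn_integral_fst[symmetric]) auto
  then have "integrable (lborel \<Otimes>\<^sub>M lborel) (\<lambda>(x, y). F x y)"
    by (intro integrableI_bounded) auto
  then show ?thesis by (rule lborel_pair.Fubini_integral[symmetric])
qed

lemma integrable_beta: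
  assumes s: "0 < s" "s < 1"
  shows "integrable lborel (\<lambda>\<tau>. ppow (s - 1) (\<tau> - t) * ppow (- s) (u - \<tau>))"
    and "(LBINT \<tau>. ppow (s - 1) (\<tau> - t) * ppow (- s) (u - \<tau>)) = (if t < u then Beta s (1 - s) else 0)"
proof -
  have B: "0 \<le> Beta s (1 - s)" using s by (simp add: Beta_def)
  have "has_bochner_integral lborel (\<lambda>\<tau>. ppow (s - 1) (\<tau> - t) * ppow (- s) (u - \<tau>)) (if t < u then Beta s (1 - s) else 0)"
    by (rule has_bochner_integral_nn_integral) (use B nn_integral_beta[OF s, of t u] in auto)
  then show "integrable lborel (\<lambda>\<tau>. ppow (s - 1) (\<tau> - t) * ppow (- s) (u - \<tau>))"
    "(LBINT \<tau>. ppow (s - 1) (\<tau> - t) * ppow (- s) (u - \<tau>)) = (if t < u then Beta s (1 - s) else 0)"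
    by (auto simp: has_bochner_integral_iff)
qed

text \<open>Split at u = \<tau> + 1. Nearer, the singularity of order s is integrable and w is
  bounded; farther, \<tau> \<ge> 0 gives |w u| \<le> C / u \<le> C / (u - \<tau>), hence an
  integrand of order - s - 1.\<close>

lemma nn_integral_ppow_decay_finite:
  fixes w :: "real \<Rightarrow> real"
  assumes s: "0 < s" "s < 1" and [measurable]: "w \<in> borel_measurable borel"
    and w1: "\<And>u. \<bar>w u\<bar> \<le> C" and w2: "\<And>u. 1 \<le> u \<Longrightarrow> \<bar>w u\<bar> \<le> C / u" and \<tau>: "0 \<le> \<tau>"
  shows "(\<integral>\<^sup>+u. ennreal \<bar>ppow (- s) (u - \<tau>) * w u\<bar> \<partial>lborel) \<le> ennreal (C * (1 / (1 - s) + 1 / s))"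
proof -
  have C: "0 \<le> C" using w1[of 0] by linarith
  let ?f = "\<lambda>v. ennreal (ppow (- s) v) * indicator {..1} v"
  let ?g = "\<lambda>v. ennreal (ppow (- s - 1) v) * indicator {1..} v"
  have "(\<integral>\<^sup>+u. ennreal \<bar>ppow (- s) (u - \<tau>) * w u\<bar> \<partial>lborel)
      \<le> (\<integral>\<^sup>+u. ennreal C * ?f (u - \<tau>) + ennreal C * ?g (u - \<tau>) \<partial>lborel)"
  proof (rule nn_integral_mono)
    fix u
    have "\<bar>ppow (- s) (u - \<tau>) * w u\<bar> \<le> C * (ppow (- s) (u - \<tau>) * indicator {..1} (u - \<tau>)) + C * (ppow (- s - 1) (u - \<tau>) * indicator {1..} (u - \<tau>))"
    proof (cases "u - \<tau> \<le> 1")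
      case True
      then show ?thesis using mult_left_mono[OF w1[of u], of "ppow (- s) (u - \<tau>)"] C
        by (simp add: abs_mult mult.commute) (simp add: add_increasing2)
    next
      case False
      have "\<bar>w u\<bar> \<le> C / (u - \<tau>)"
      proof -
        have "\<bar>w u\<bar> \<le> C / u" using False \<tau> by (intro w2) auto
        also have "\<dots> \<le> C / (u - \<tau>)" using False \<tau> C by (intro divide_left_mono mult_pos_pos) auto
        finally show ?thesis .
      qed
      then have "ppow (- s) (u - \<tau>) * \<bar>w u\<bar> \<le> ppow (- s) (u - \<tau>) * (C / (u - \<tau>))" by (rule mult_left_mono) simp
      also have "\<dots> = C * ppow (- s - 1) (u - \<tau>)" using False by (simp add: ppow_def powr_diff)
      finally show ?thesis using False by (simp add: abs_mult indicator_def)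
    qed
    then have "ennreal \<bar>ppow (- s) (u - \<tau>) * w u\<bar> \<le> ennreal (C * (ppow (- s) (u - \<tau>) * indicator {..1} (u - \<tau>)) + C * (ppow (- s - 1) (u - \<tau>) * indicator {1..} (u - \<tau>)))"
      by (rule ennreal_leI)
    also have "\<dots> = ennreal C * ?f (u - \<tau>) + ennreal C * ?g (u - \<tau>)"
      using C by (simp add: ennreal_mult ennreal_indicator)
    finally show "ennreal \<bar>ppow (- s) (u - \<tau>) * w u\<bar> \<le> ennreal C * ?f (u - \<tau>) + ennreal C * ?g (u - \<tau>)" .
  qed
  also have "\<dots> = ennreal C * (\<integral>\<^sup>+v. ?f (v - \<tau>) \<partial>lborel) + ennreal C * (\<integral>\<^sup>+v. ?g (v - \<tau>) \<partial>lborel)"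
    by (simp add: nn_integral_add nn_integral_cmult)
  also have "\<dots> = ennreal C * (\<integral>\<^sup>+v. ?f v \<partial>lborel) + ennreal C * (\<integral>\<^sup>+v. ?g v \<partial>lborel)"
    using nn_integral_shift[of ?f \<tau>] nn_integral_shift[of ?g \<tau>] by simp
  also have "\<dots> = ennreal C * ennreal (1 / (1 - s)) + ennreal C * ennreal (1 / s)"
    using s nn_integral_ppow_from_0[of "- s" 1] nn_integral_ppow_to_inf[of "- s - 1" 1] by simp
  also have "\<dots> = ennreal (C * (1 / (1 - s) + 1 / s))"
    using C s by (simp add: ennreal_mult[symmetric] ennreal_plus[symmetric] distrib_left del: ennreal_plus)
  finally show ?thesis .
qed

text \<open>After exchanging the integrals, the integral in \<tau> is a difference of two Beta
  integrals: the Beta constant times the indicator of u > t minus that of u > 0, that is, minus the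
  constant on (0, t]. The decay of w makes the double integral absolutely convergent.\<close>

lemma integral_kap_identity:
  fixes w :: "real \<Rightarrow> real"
  assumes s: "0 < s" "s < 1" and t: "0 < t" and w[measurable]: "w \<in> borel_measurable borel"
    and w1: "\<And>u. \<bar>w u\<bar> \<le> C" and w2: "\<And>u. 1 \<le> u \<Longrightarrow> \<bar>w u\<bar> \<le> C / u"
  shows "(LBINT \<tau>. kap s t \<tau> * (LBINT u. ppow (- s) (u - \<tau>) * w u))
    = - Beta s (1 - s) * (LBINT u. indicator {0<..t} u * w u)"
proof -
  have C: "0 \<le> C" using w1[of 0] by linarith
  define F where "F = (\<lambda>\<tau> u. kap s t \<tau> * (ppow (- s) (u - \<tau>) * w u))"
  have F[measurable]: "(\<lambda>(\<tau>, u). F \<tau> u) \<in> borel_measurable (lborel \<Otimes>\<^sub>M lborel)"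
    unfolding F_def by measurable
  have "(\<integral>\<^sup>+\<tau>. \<integral>\<^sup>+u. ennreal \<bar>F \<tau> u\<bar> \<partial>lborel \<partial>lborel) \<le> (\<integral>\<^sup>+\<tau>. ennreal \<bar>kap s t \<tau>\<bar> * ennreal (C * (1 / (1 - s) + 1 / s)) \<partial>lborel)" (is "?S \<le> _")
  proof (rule nn_integral_mono)
    fix \<tau>
    show "(\<integral>\<^sup>+u. ennreal \<bar>F \<tau> u\<bar> \<partial>lborel) \<le> ennreal \<bar>kap s t \<tau>\<bar> * ennreal (C * (1 / (1 - s) + 1 / s))"
    proof (cases "0 \<le> \<tau>")
      case True
      have "(\<integral>\<^sup>+u. ennreal \<bar>F \<tau> u\<bar> \<partial>lborel) = ennreal \<bar>kap s t \<tau>\<bar> * (\<integral>\<^sup>+u. ennreal \<bar>ppow (- s) (u - \<tau>) * w u\<bar> \<partial>lborel)"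
        unfolding F_def by (subst nn_integral_cmult[symmetric]) (auto simp: abs_mult ennreal_mult)
      then show ?thesis using nn_integral_ppow_decay_finite[OF s w w1 w2 True] by (simp add: mult_left_mono)
    next
      case False
      then have "kap s t \<tau> = 0" using t by (simp add: kap_def ppow_def)
      then show ?thesis by (simp add: F_def)
    qed
  qed
  also have "\<dots> = (\<integral>\<^sup>+\<tau>. ennreal \<bar>kap s t \<tau>\<bar> \<partial>lborel) * ennreal (C * (1 / (1 - s) + 1 / s))"
    by (rule nn_integral_multc) measurable
  also have "\<dots> \<le> ennreal ((2 / s + 1) * t powr s) * ennreal (C * (1 / (1 - s) + 1 / s))"
    by (intro mult_right_mono nn_integral_kap_le s t) simp
  also have "\<dots> < \<infinity>" by (simp add: ennreal_mult_less_top)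
  finally have fin: "?S < \<infinity>" .
  have "(LBINT \<tau>. kap s t \<tau> * (LBINT u. ppow (- s) (u - \<tau>) * w u)) = (LBINT \<tau>. LBINT u. F \<tau> u)"
    unfolding F_def by simp
  also have "\<dots> = (LBINT u. LBINT \<tau>. F \<tau> u)"
    by (rule integral_lborel_swap[OF F fin])
  also have "\<dots> = (LBINT u. - Beta s (1 - s) * (indicator {0<..t} u * w u))"
  proof (rule Bochner_Integration.integral_cong[OF refl])
    fix u :: real
    have "(LBINT \<tau>. F \<tau> u) = (LBINT \<tau>. (ppow (s - 1) (\<tau> - t) * ppow (- s) (u - \<tau>) - ppow (s - 1) (\<tau> - 0) * ppow (- s) (u - \<tau>)) * w u)"
      by (rule Bochner_Integration.integral_cong) (auto simp: F_def kap_def algebra_simps)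
    also have "\<dots> = ((if t < u then Beta s (1 - s) else 0) - (if 0 < u then Beta s (1 - s) else 0)) * w u"
      by (simp only: integral_mult_left_zero Bochner_Integration.integral_diff[OF integrable_beta(1)[OF s] integrable_beta(1)[OF s]] integrable_beta(2)[OF s])
    also have "\<dots> = - Beta s (1 - s) * (indicator {0<..t} u * w u)" using t by (auto simp: indicator_def)
    finally show "(LBINT \<tau>. F \<tau> u) = - Beta s (1 - s) * (indicator {0<..t} u * w u)" .
  qed
  finally show ?thesis by simp
qed

text \<open>The place where s < 1/2 enters: r^(-1-s) sqrt r has exponent - 1/2 - s > -1 and is
  integrable at 0.\<close>

lemma nn_integral_marchaud_le:
  fixes \<phi> :: "real \<Rightarrow> real"
  assumes s: "0 < s" "s < 1/2" and C: "0 \<le> C" and M: "0 \<le> M"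
    and small: "\<And>r. 0 < r \<Longrightarrow> r \<le> 1 \<Longrightarrow> \<bar>\<phi> r\<bar> \<le> C * sqrt r"
    and large: "\<And>r. 1 < r \<Longrightarrow> \<bar>\<phi> r\<bar> \<le> M"
  shows "(\<integral>\<^sup>+r. ennreal \<bar>ppow (-1 - s) r * \<phi> r\<bar> \<partial>lborel) \<le> ennreal (C / (1/2 - s) + M / s)"
proof -
  let ?f = "\<lambda>r. ennreal (ppow (-1/2 - s) r) * indicator {..1} r"
  let ?g = "\<lambda>r. ennreal (ppow (-1 - s) r) * indicator {1..} r"
  have "(\<integral>\<^sup>+r. ennreal \<bar>ppow (-1 - s) r * \<phi> r\<bar> \<partial>lborel) \<le> (\<integral>\<^sup>+r. ennreal C * ?f r + ennreal M * ?g r \<partial>lborel)"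
  proof (rule nn_integral_mono)
    fix r
    have "\<bar>ppow (-1 - s) r * \<phi> r\<bar> \<le> C * (ppow (-1/2 - s) r * indicator {..1} r) + M * (ppow (-1 - s) r * indicator {1..} r)"
    proof -
      consider "r \<le> 0" | "0 < r" "r \<le> 1" | "1 < r" by linarith
      then show ?thesis
      proof cases
        case 1 then show ?thesis by (simp add: ppow_def)
      next
        case 2
        have "r powr (-1 - s) * \<bar>\<phi> r\<bar> \<le> r powr (-1 - s) * (C * sqrt r)"
          using small[OF 2] by (rule mult_left_mono) simp
        also have "\<dots> = C * r powr (-1/2 - s)"
          using 2 by (simp add: powr_half_sqrt[symmetric] powr_add[symmetric])
        also have "\<dots> \<le> C * r powr (-1/2 - s) + M * (ppow (-1 - s) r * indicator {1..} r)" using M by simp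
        finally show ?thesis using 2 by (simp add: ppow_def abs_mult)
      next
        case 3
        have "r powr (-1 - s) * \<bar>\<phi> r\<bar> \<le> r powr (-1 - s) * M"
          using large[OF 3] by (rule mult_left_mono) simp
        then show ?thesis using 3 by (simp add: ppow_def abs_mult mult.commute)
      qed
    qed
    then have "ennreal \<bar>ppow (-1 - s) r * \<phi> r\<bar> \<le> ennreal (C * (ppow (-1/2 - s) r * indicator {..1} r) + M * (ppow (-1 - s) r * indicator {1..} r))"
      by (rule ennreal_leI)
    also have "\<dots> = ennreal C * ?f r + ennreal M * ?g r"
      using C M by (simp add: ennreal_mult ennreal_indicator)
    finally show "ennreal \<bar>ppow (-1 - s) r * \<phi> r\<bar> \<le> ennreal C * ?f r + ennreal M * ?g r" .
  qed
  also have "\<dots> = ennreal C * (\<integral>\<^sup>+r. ?f r \<partial>lborel) + ennreal M * (\<integral>\<^sup>+r. ?g r \<partial>lborel)"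
    by (simp add: nn_integral_add nn_integral_cmult)
  also have "\<dots> = ennreal C * ennreal (1 / (1/2 - s)) + ennreal M * ennreal (1 / s)"
    using s nn_integral_ppow_from_0[of "-1/2 - s" 1] nn_integral_ppow_to_inf[of "-1 - s" 1] by simp
  also have "\<dots> = ennreal (C * (1 / (1/2 - s)) + M * (1 / s))"
  proof -
    have "0 \<le> 1 / (1/2 - s)" "0 \<le> 1 / s" using s by auto
    then show ?thesis using C M by (simp only: ennreal_mult ennreal_plus mult_nonneg_nonneg)
  qed
  finally show ?thesis by simp
qed

text \<open>The forward Marchaud derivative of order s, without its sign and normalising constant s
  / \<Gamma>(1 - s).\<close>

definition marchaud :: "real \<Rightarrow> (real \<Rightarrow> real) \<Rightarrow> real \<Rightarrow> real" where
  "marchaud s h u = (LBINT r. ppow (-1 - s) r * (h (u + r) - h u))"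

lemma integral_indicator_Ioc:
  fixes g :: "real \<Rightarrow> real"
  assumes g: "continuous_on UNIV g"
  shows "(LBINT v. indicator {0<..r} v * g v) = integral {0..r} g"
proof -
  have [measurable]: "g \<in> borel_measurable borel" by (rule borel_measurable_continuous_onI[OF g])
  have "(LBINT v. indicator {0<..r} v * g v) = (LBINT v. indicator {0..r} v * g v)"
    by (rule integral_cong_AE) (measurable, rule AE_mp[OF AE_lborel_singleton[of 0]], auto split: split_indicator)
  also have "\<dots> = integral {0..r} g"
    using set_borel_integral_eq_integral(2)[OF borel_integrable_atLeastAtMost'[OF continuous_on_subset[OF g]], of 0 r]
    by (simp add: set_lebesgue_integral_def)
  finally show ?thesis .
qed

text \<open>For an antiderivative H of h, both sides are the mixed second difference H(\<tau> + d +
  r) - H(\<tau> + d) - H(\<tau> + r) + H(\<tau>), which is symmetric in r and d. This symmetry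
  exchanges the increment length with the averaging length.\<close>

lemma integral_difference_swap:
  fixes h :: "real \<Rightarrow> real"
  assumes h: "continuous_on UNIV h" and "0 \<le> r" "0 \<le> d"
  shows "integral {0..r} (\<lambda>v. h (v + \<tau> + d) - h (v + \<tau>)) = integral {0..d} (\<lambda>e. h (\<tau> + e + r) - h (\<tau> + e))"
proof -
  have hi: "h integrable_on {a..b}" for a b
    by (rule integrable_continuous_interval[OF continuous_on_subset[OF h]]) simp
  have sh: "integral {0..r} (\<lambda>v. h (v + a)) = integral {a..a + r} h" for a r
    using integral_shift_Icc_real[of 0 r h a] by (simp add: o_def add.commute)
  have shi: "(\<lambda>v. h (v + a)) integrable_on {0..r}" for a r
    by (intro integrable_continuous_interval continuous_on_compose2[OF h]) (auto intro!: continuous_intros)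
  have 1: "integral {0..r} (\<lambda>v. h (v + \<tau> + d) - h (v + \<tau>)) = integral {\<tau> + d..\<tau> + d + r} h - integral {\<tau>..\<tau> + r} h"
    using sh[of r "\<tau> + d"] sh[of r \<tau>] shi[of "\<tau> + d" r] shi[of \<tau> r]
    by (simp add: Henstock_Kurzweil_Integration.integral_diff add.assoc)
  have 2: "integral {0..d} (\<lambda>e. h (\<tau> + e + r) - h (\<tau> + e)) = integral {\<tau> + r..\<tau> + r + d} h - integral {\<tau>..\<tau> + d} h"
    using sh[of d "\<tau> + r"] sh[of d \<tau>] shi[of "\<tau> + r" d] shi[of \<tau> d]
    by (simp add: Henstock_Kurzweil_Integration.integral_diff add_ac)
  have "integral {\<tau>..\<tau> + d} h + integral {\<tau> + d..\<tau> + d + r} h = integral {\<tau>..\<tau> + d + r} h"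
    by (rule Henstock_Kurzweil_Integration.integral_combine) (use assms hi in auto)
  moreover have "integral {\<tau>..\<tau> + r} h + integral {\<tau> + r..\<tau> + r + d} h = integral {\<tau>..\<tau> + r + d} h"
    by (rule Henstock_Kurzweil_Integration.integral_combine) (use assms hi in auto)
  ultimately show ?thesis unfolding 1 2 by (simp add: add_ac)
qed

text \<open>What is used of u -> P_u f(X) at a fixed X. The Hoelder exponent 1/2 makes the Marchaud
  integral converge at r = 0, and the decay 1/u makes increments integrable against the power - s at
  infinity. The Hoelder constant may depend on R, since it serves only for finiteness.\<close>

locale decaying_hoelder =
  fixes h :: "real \<Rightarrow> real" and s M :: real
  assumes s: "0 < s" "s < 1/2"
    and h_cont: "continuous_on UNIV h"
    and h_bound: "\<bar>h u\<bar> \<le> M"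
    and h_decay: "1 \<le> u \<Longrightarrow> \<bar>h u\<bar> \<le> M / u"
    and h_hoelder: "\<exists>C\<ge>0. \<forall>u r. 0 \<le> u \<longrightarrow> u \<le> R \<longrightarrow> 0 < r \<longrightarrow> r \<le> 1 \<longrightarrow> \<bar>h (u + r) - h u\<bar> \<le> C * sqrt r"
begin

lemma h_meas[measurable]: "h \<in> borel_measurable borel"
  by (rule borel_measurable_continuous_onI[OF h_cont])

lemma M_nonneg: "0 \<le> M" using h_bound[of 0] by linarith

lemma increment_bound: "\<bar>h (u + d) - h u\<bar> \<le> 2 * M"
  using h_bound[of u] h_bound[of "u + d"] by linarith

lemma increment_decay:
  assumes "1 \<le> u" "0 \<le> d" shows "\<bar>h (u + d) - h u\<bar> \<le> (2 * M) / u"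
proof -
  have "\<bar>h (u + d)\<bar> \<le> M / (u + d)" using assms by (intro h_decay) auto
  also have "\<dots> \<le> M / u" using assms M_nonneg by (intro divide_left_mono mult_pos_pos) auto
  finally have "\<bar>h (u + d) - h u\<bar> \<le> M / u + M / u" using h_decay[OF assms(1)] by linarith
  then show ?thesis by simp
qed

text \<open>Write v^(-s) as s times the integral of r^(-1-s) over r \<ge> v and exchange, using the
  decay. The integral of d-increments over (0, r] equals that of r-increments over (0, d] by
  \<open>integral_difference_swap\<close>. A second exchange, justified by the Hoelder bound, leaves
  Marchaud derivatives averaged over (0, d].\<close>

lemma integral_increment:
  assumes d: "0 < d" and \<tau>: "0 \<le> \<tau>"
  shows "(LBINT u. ppow (- s) (u - \<tau>) * (h (u + d) - h u))
    = s * (LBINT e. indicator {0<..d} e * marchaud s h (\<tau> + e))"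
proof -
  define w where "w = (\<lambda>u. h (u + d) - h u)"
  have [measurable]: "w \<in> borel_measurable borel" unfolding w_def by measurable
  have w_cont: "continuous_on UNIV (\<lambda>v. w (v + \<tau>))"
    unfolding w_def by (intro continuous_intros continuous_on_compose2[OF h_cont]) auto
  have inner_nn: "(\<integral>\<^sup>+r. ennreal (indicator {0<..r} v * ppow (-1 - s) r) \<partial>lborel) = ennreal (ppow (- s) v / s)" for v
  proof (cases "0 < v")
    case True
    have "(\<integral>\<^sup>+r. ennreal (indicator {0<..r} v * ppow (-1 - s) r) \<partial>lborel) = (\<integral>\<^sup>+r. ennreal (ppow (-1 - s) r) * indicator {v..} r \<partial>lborel)"
      by (rule nn_integral_cong) (use True in \<open>auto split: split_indicator\<close>)
    also have "\<dots> = ennreal (ppow (- s) v / s)"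
      using nn_integral_ppow_to_inf[of "-1 - s" v] s True by (simp add: ppow_def)
    finally show ?thesis .
  qed (simp add: ppow_def)
  have inner_meas: "(\<lambda>r. indicator {0<..r} v * ppow (-1 - s) r) \<in> borel_measurable lborel" for v :: real
  proof -
    have "(\<lambda>r. indicator {0<..r} v * ppow (-1 - s) r) = (\<lambda>r. if 0 < v \<and> v \<le> r then ppow (-1 - s) r else 0)"
      by (auto simp: fun_eq_iff indicator_def)
    also have "\<dots> \<in> borel_measurable lborel" by measurable
    finally show ?thesis .
  qed
  have inner: "has_bochner_integral lborel (\<lambda>r. indicator {0<..r} v * ppow (-1 - s) r) (ppow (- s) v / s)" for v
    by (rule has_bochner_integral_nn_integral[OF inner_meas]) (use s inner_nn in auto)
  define F where "F = (\<lambda>v r. (indicator {0<..r} v * ppow (-1 - s) r) * w (v + \<tau>))"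
  have F[measurable]: "(\<lambda>(v, r). F v r) \<in> borel_measurable (lborel \<Otimes>\<^sub>M lborel)"
  proof -
    have "(\<lambda>(v, r). F v r) = (\<lambda>(v, r). (if 0 < v \<and> v \<le> r then ppow (-1 - s) r else 0) * w (v + \<tau>))"
      by (auto simp: F_def fun_eq_iff indicator_def)
    also have "\<dots> \<in> borel_measurable (lborel \<Otimes>\<^sub>M lborel)" by measurable
    finally show ?thesis .
  qed
  have "(\<integral>\<^sup>+v. \<integral>\<^sup>+r. ennreal \<bar>F v r\<bar> \<partial>lborel \<partial>lborel) = (\<integral>\<^sup>+v. ennreal (1 / s) * ennreal \<bar>ppow (- s) (v + \<tau> - \<tau>) * w (v + \<tau>)\<bar> \<partial>lborel)" (is "?S = _")
  proof (rule nn_integral_cong)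
    fix v
    have "(\<integral>\<^sup>+r. ennreal \<bar>F v r\<bar> \<partial>lborel) = (\<integral>\<^sup>+r. ennreal (indicator {0<..r} v * ppow (-1 - s) r) * ennreal \<bar>w (v + \<tau>)\<bar> \<partial>lborel)"
      unfolding F_def by (simp add: abs_mult ennreal_mult)
    also have "\<dots> = ennreal (ppow (- s) v / s) * ennreal \<bar>w (v + \<tau>)\<bar>"
    proof -
      have "(\<lambda>r. ennreal (indicator {0<..r} v * ppow (-1 - s) r)) \<in> borel_measurable lborel"
        using inner_meas by measurable
      then show ?thesis by (subst nn_integral_multc) (simp_all only: inner_nn)
    qed
    also have "\<dots> = ennreal (1 / s) * ennreal \<bar>ppow (- s) (v + \<tau> - \<tau>) * w (v + \<tau>)\<bar>"
      using s by (simp add: abs_mult ennreal_mult[symmetric])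
    finally show "(\<integral>\<^sup>+r. ennreal \<bar>F v r\<bar> \<partial>lborel) = ennreal (1 / s) * ennreal \<bar>ppow (- s) (v + \<tau> - \<tau>) * w (v + \<tau>)\<bar>" .
  qed
  also have "\<dots> = ennreal (1 / s) * (\<integral>\<^sup>+v. ennreal \<bar>ppow (- s) (v - \<tau>) * w v\<bar> \<partial>lborel)"
    using nn_integral_lborel_translate[of "\<lambda>v. ennreal \<bar>ppow (- s) (v - \<tau>) * w v\<bar>" \<tau>]
    by (subst nn_integral_cmult) auto
  also have "\<dots> \<le> ennreal (1 / s) * ennreal ((2 * M) * (1 / (1 - s) + 1 / s))"
    using s \<tau> d increment_bound increment_decay unfolding w_def
    by (intro mult_left_mono nn_integral_ppow_decay_finite) auto
  also have "\<dots> < \<infinity>" by (simp add: ennreal_mult_less_top)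
  finally have fin: "?S < \<infinity>" .
  define H where "H = (\<lambda>r e. ppow (-1 - s) r * (indicator {0<..d} e * (h (\<tau> + e + r) - h (\<tau> + e))))"
  have H: "(\<lambda>(e, r). H r e) \<in> borel_measurable (lborel \<Otimes>\<^sub>M lborel)"
    unfolding H_def by measurable
  have finH: "(\<integral>\<^sup>+e. \<integral>\<^sup>+r. ennreal \<bar>H r e\<bar> \<partial>lborel \<partial>lborel) < \<infinity>" (is "?S < _")
  proof -
    obtain C where C: "0 \<le> C" "\<And>u r. 0 \<le> u \<Longrightarrow> u \<le> \<tau> + d \<Longrightarrow> 0 < r \<Longrightarrow> r \<le> 1 \<Longrightarrow> \<bar>h (u + r) - h u\<bar> \<le> C * sqrt r"
      using h_hoelder[of "\<tau> + d"] by blast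
    define K where "K = C / (1/2 - s) + (2 * M) / s"
    have "?S \<le> (\<integral>\<^sup>+e. ennreal K * indicator {0<..d} e \<partial>lborel)"
    proof (rule nn_integral_mono)
      fix e :: real
      show "(\<integral>\<^sup>+r. ennreal \<bar>H r e\<bar> \<partial>lborel) \<le> ennreal K * indicator {0<..d} e"
      proof (cases "e \<in> {0<..d}")
        case True
        have "(\<integral>\<^sup>+r. ennreal \<bar>ppow (-1 - s) r * (h (\<tau> + e + r) - h (\<tau> + e))\<bar> \<partial>lborel) \<le> ennreal K"
          unfolding K_def
          by (rule nn_integral_marchaud_le) (use s M_nonneg C True \<tau> increment_bound in auto)
        then show ?thesis using True by (simp add: H_def)
      qed (simp add: H_def)
    qed
    also have "\<dots> = ennreal K * ennreal d" using d by (simp add: nn_integral_cmult_indicator)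
    also have "\<dots> < \<infinity>" by (simp add: ennreal_mult_less_top)
    finally show ?thesis .
  qed
  have "(LBINT u. ppow (- s) (u - \<tau>) * w u) = (LBINT v. ppow (- s) v * w (v + \<tau>))"
    by (subst lborel_integral_real_affine[where c=1 and t=\<tau>]) (simp_all add: add.commute)
  also have "\<dots> = (LBINT v. s * (LBINT r. F v r))"
  proof (rule Bochner_Integration.integral_cong[OF refl])
    fix v
    have "(LBINT r. F v r) = ppow (- s) v / s * w (v + \<tau>)"
      unfolding F_def using inner[of v] by (simp add: has_bochner_integral_iff)
    then show "ppow (- s) v * w (v + \<tau>) = s * (LBINT r. F v r)" using s by simp
  qed
  also have "\<dots> = s * (LBINT v. LBINT r. F v r)" by simp
  also have "(LBINT v. LBINT r. F v r) = (LBINT r. LBINT v. F v r)"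
    by (rule integral_lborel_swap[OF F fin])
  also have "\<dots> = (LBINT r. LBINT e. H r e)"
  proof (rule Bochner_Integration.integral_cong[OF refl])
    fix r :: real
    show "(LBINT v. F v r) = (LBINT e. H r e)"
    proof (cases "0 < r")
      case True
      have "(LBINT v. F v r) = ppow (-1 - s) r * (LBINT v. indicator {0<..r} v * w (v + \<tau>))"
        unfolding F_def by (subst integral_mult_right_zero[symmetric]) (simp add: mult_ac)
      also have "(LBINT v. indicator {0<..r} v * w (v + \<tau>)) = integral {0..r} (\<lambda>v. w (v + \<tau>))"
        by (rule integral_indicator_Ioc[OF w_cont])
      also have "\<dots> = integral {0..d} (\<lambda>e. h (\<tau> + e + r) - h (\<tau> + e))"
        unfolding w_def by (rule integral_difference_swap[OF h_cont]) (use True d in auto)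
      also have "\<dots> = (LBINT e. indicator {0<..d} e * (h (\<tau> + e + r) - h (\<tau> + e)))"
        by (rule integral_indicator_Ioc[symmetric]) (intro continuous_intros continuous_on_compose2[OF h_cont]; auto)
      finally show ?thesis unfolding H_def by simp
    qed (simp add: F_def H_def ppow_def)
  qed
  also have "\<dots> = (LBINT e. LBINT r. H r e)"
    by (rule integral_lborel_swap[OF H finH, symmetric])
  also have "\<dots> = (LBINT e. indicator {0<..d} e * marchaud s h (\<tau> + e))"
  proof (rule Bochner_Integration.integral_cong[OF refl])
    fix e :: real
    have "(LBINT r. H r e) = (LBINT r. indicator {0<..d} e * (ppow (-1 - s) r * (h (\<tau> + e + r) - h (\<tau> + e))))"
      unfolding H_def by (simp add: mult_ac)
    then show "(LBINT r. H r e) = indicator {0<..d} e * marchaud s h (\<tau> + e)"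
      unfolding marchaud_def by simp
  qed
  finally show ?thesis unfolding w_def .
qed

text \<open>\<open>integral_kap_identity\<close> for the increment w(u) = h(u + d) - h(u), with its
  inner integral rewritten by \<open>integral_increment\<close>. The latter concerns \<tau> \<ge> 0
  only, and \<open>kap\<close> vanishes for negative \<tau>.\<close>

lemma integral_increment_le:
  assumes d: "0 < d" and t: "0 < t"
  shows "ennreal (Beta s (1 - s) * \<bar>integral {0..t} (\<lambda>u. h (u + d) - h u)\<bar>)
    \<le> (\<integral>\<^sup>+\<tau>. ennreal (s * \<bar>kap s t \<tau>\<bar>) * (\<integral>\<^sup>+e. indicator {0<..d} e * ennreal \<bar>marchaud s h (\<tau> + e)\<bar> \<partial>lborel) \<partial>lborel)"
proof -
  have B: "0 \<le> Beta s (1 - s)" using s by (simp add: Beta_def)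
  have cont: "continuous_on UNIV (\<lambda>u. h (u + d) - h u)"
    by (intro continuous_intros continuous_on_compose2[OF h_cont]) auto
  have "- Beta s (1 - s) * integral {0..t} (\<lambda>u. h (u + d) - h u)
      = (LBINT \<tau>. kap s t \<tau> * (LBINT u. ppow (- s) (u - \<tau>) * (h (u + d) - h u)))"
    unfolding integral_indicator_Ioc[OF cont, symmetric]
    by (rule integral_kap_identity[symmetric, where C="2 * M"]) (use s t d increment_bound increment_decay in auto)
  also have "\<dots> = (LBINT \<tau>. kap s t \<tau> * (s * (LBINT e. indicator {0<..d} e * marchaud s h (\<tau> + e))))"
  proof (rule Bochner_Integration.integral_cong[OF refl])
    fix \<tau> :: real
    show "kap s t \<tau> * (LBINT u. ppow (- s) (u - \<tau>) * (h (u + d) - h u))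
      = kap s t \<tau> * (s * (LBINT e. indicator {0<..d} e * marchaud s h (\<tau> + e)))"
    proof (cases "0 \<le> \<tau>")
      case True
      then show ?thesis by (simp add: integral_increment[OF d])
    next
      case False
      then have "kap s t \<tau> = 0" using t by (simp add: kap_def ppow_def)
      then show ?thesis by simp
    qed
  qed
  finally have eq: "- Beta s (1 - s) * integral {0..t} (\<lambda>u. h (u + d) - h u) = \<dots>" .
  have "ennreal (Beta s (1 - s) * \<bar>integral {0..t} (\<lambda>u. h (u + d) - h u)\<bar>)
      = ennreal \<bar>- Beta s (1 - s) * integral {0..t} (\<lambda>u. h (u + d) - h u)\<bar>"
    using B by (simp add: abs_mult)
  also have "\<dots> \<le> (\<integral>\<^sup>+\<tau>. ennreal \<bar>kap s t \<tau> * (s * (LBINT e. indicator {0<..d} e * marchaud s h (\<tau> + e)))\<bar> \<partial>lborel)"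
    unfolding eq by (rule ennreal_norm_integral_le)
  also have "\<dots> \<le> (\<integral>\<^sup>+\<tau>. ennreal (s * \<bar>kap s t \<tau>\<bar>) * (\<integral>\<^sup>+e. indicator {0<..d} e * ennreal \<bar>marchaud s h (\<tau> + e)\<bar> \<partial>lborel) \<partial>lborel)"
  proof (rule nn_integral_mono)
    fix \<tau> :: real
    let ?I = "LBINT e. indicator {0<..d} e * marchaud s h (\<tau> + e)"
    have "ennreal \<bar>kap s t \<tau> * (s * ?I)\<bar> = ennreal (s * \<bar>kap s t \<tau>\<bar>) * ennreal \<bar>?I\<bar>"
      using s by (simp add: ennreal_mult[symmetric] abs_mult mult_ac)
    also have "\<dots> \<le> ennreal (s * \<bar>kap s t \<tau>\<bar>) * (\<integral>\<^sup>+e. ennreal \<bar>indicator {0<..d} e * marchaud s h (\<tau> + e)\<bar> \<partial>lborel)"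
      by (intro mult_left_mono ennreal_norm_integral_le) simp
    also have "(\<integral>\<^sup>+e. ennreal \<bar>indicator {0<..d} e * marchaud s h (\<tau> + e)\<bar> \<partial>lborel)
        = (\<integral>\<^sup>+e. indicator {0<..d} e * ennreal \<bar>marchaud s h (\<tau> + e)\<bar> \<partial>lborel)"
      by (rule nn_integral_cong) (simp add: abs_mult split: split_indicator)
    finally show "ennreal \<bar>kap s t \<tau> * (s * ?I)\<bar> \<le>
      ennreal (s * \<bar>kap s t \<tau>\<bar>) * (\<integral>\<^sup>+e. indicator {0<..d} e * ennreal \<bar>marchaud s h (\<tau> + e)\<bar> \<partial>lborel)" .
  qed
  finally show ?thesis .
qed

end

section \<open>Fractional powers of the semigroup generator\<close>

text \<open>f plays the role of a Schwartz function. K and L are qualitative; I also enters the sup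
  bound \<open>P_le_sup\<close>, on which the isoperimetric estimate rests.\<close>

locale kernel_datum = transition_kernel p
  for p :: "real \<Rightarrow> 'a::euclidean_space \<Rightarrow> 'a \<Rightarrow> real" +
  fixes f :: "'a \<Rightarrow> real" and K L I s :: real
  assumes s: "0 < s" "s < 1/2"
    and f_meas[measurable]: "f \<in> borel_measurable borel"
    and f_bound: "\<bar>f x\<bar> \<le> K"
    and f_lip: "\<bar>f y - f x\<bar> \<le> L * norm (y - x)" and L0: "0 \<le> L"
    and f_int: "(\<integral>\<^sup>+x. ennreal \<bar>f x\<bar> \<partial>lborel) \<le> ennreal I" and I0: "0 \<le> I"
begin

lemma K0: "0 \<le> K" using f_bound[of 0] by linarith

lemma p_comp[measurable (raw)]:
  assumes [measurable]: "a \<in> borel_measurable N" "b \<in> borel_measurable N" "c \<in> borel_measurable N"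
  shows "(\<lambda>z. p (a z) (b z) (c z)) \<in> borel_measurable N"
proof -
  have "(\<lambda>z. (a z, b z, c z)) \<in> measurable N (borel \<Otimes>\<^sub>M borel \<Otimes>\<^sub>M borel)" by measurable
  from measurable_compose[OF this p_measurable] show ?thesis by simp
qed

section \<open>The semigroup acting on the fixed function f\<close>

definition P :: "real \<Rightarrow> 'a \<Rightarrow> real" where
  "P t x = (LBINT y. p t x y * f y)"

lemma P_meas[measurable (raw)]:
  assumes [measurable]: "a \<in> borel_measurable N" "b \<in> borel_measurable N"
  shows "(\<lambda>z. P (a z) (b z)) \<in> borel_measurable N"
  unfolding P_def by measurable

lemma integrable_p:
  assumes "0 < t"
  shows "integrable lborel (p t x)" "(LBINT y. p t x y) = 1"
proof -
  have "has_bochner_integral lborel (p t x) 1"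
    by (rule has_bochner_integral_nn_integral) (use p_mass[OF assms] p_nonneg in auto)
  then show "integrable lborel (p t x)" "(LBINT y. p t x y) = 1"
    by (auto simp: has_bochner_integral_iff)
qed

lemma integrable_pf:
  assumes t: "0 < t" shows "integrable lborel (\<lambda>y. p t x y * f y)"
proof (rule Bochner_Integration.integrable_bound)
  show "integrable lborel (\<lambda>y. p t x y * K)" using integrable_p(1)[OF t] by simp
  show "AE y in lborel. norm (p t x y * f y) \<le> norm (p t x y * K)"
    using f_bound p_nonneg K0 by (auto simp: abs_mult intro!: mult_left_mono)
qed measurable

lemma P_bound: assumes t: "0 < t" shows "\<bar>P t x\<bar> \<le> K"
proof -
  have "ennreal \<bar>P t x\<bar> \<le> (\<integral>\<^sup>+y. ennreal \<bar>p t x y * f y\<bar> \<partial>lborel)"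
    unfolding P_def by (rule ennreal_norm_integral_le)
  also have "\<dots> \<le> (\<integral>\<^sup>+y. ennreal (p t x y) * ennreal K \<partial>lborel)"
    using f_bound p_nonneg K0
    by (intro nn_integral_mono) (auto simp: abs_mult ennreal_mult[symmetric] intro!: ennreal_leI mult_left_mono)
  also have "\<dots> = ennreal K" by (simp add: nn_integral_multc p_mass[OF t])
  finally show ?thesis using K0 by simp
qed

lemma P_le_sup:
  assumes "\<And>y. p t x y \<le> c" and c: "0 \<le> c" shows "\<bar>P t x\<bar> \<le> c * I"
proof -
  have "ennreal \<bar>P t x\<bar> \<le> (\<integral>\<^sup>+y. ennreal \<bar>p t x y * f y\<bar> \<partial>lborel)"
    unfolding P_def by (rule ennreal_norm_integral_le)
  also have "\<dots> \<le> (\<integral>\<^sup>+y. ennreal c * ennreal \<bar>f y\<bar> \<partial>lborel)"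
    using assms p_nonneg
    by (intro nn_integral_mono) (auto simp: abs_mult ennreal_mult[symmetric] intro!: ennreal_leI mult_right_mono)
  also have "\<dots> = ennreal c * (\<integral>\<^sup>+y. ennreal \<bar>f y\<bar> \<partial>lborel)" by (rule nn_integral_cmult) measurable
  also have "\<dots> \<le> ennreal c * ennreal I" by (intro mult_left_mono f_int) simp
  finally show ?thesis using c I0 by (simp add: ennreal_mult[symmetric])
qed

text \<open>The Lipschitz constant times the mean displacement of the kernel; the growth in x
  reflects the drift e^{rB} x - x.\<close>

lemma P_displacement:
  obtains C where "0 \<le> C" "\<And>r x. 0 < r \<Longrightarrow> r \<le> 1 \<Longrightarrow> \<bar>P r x - f x\<bar> \<le> C * (1 + norm x) * sqrt r"
proof -
  obtain C where C: "0 \<le> C" "\<And>u x. 0 < u \<Longrightarrow> u \<le> 1 \<Longrightarrow>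
      (\<integral>\<^sup>+y. ennreal (p u x y * norm (y - x)) \<partial>lborel) \<le> ennreal (C * (1 + norm x) * sqrt u)"
    using p_displacement by blast
  have "\<bar>P r x - f x\<bar> \<le> L * C * (1 + norm x) * sqrt r" if r: "0 < r" "r \<le> 1" for r x
  proof -
    have "P r x - f x = (LBINT y. p r x y * f y - p r x y * f x)"
      unfolding P_def using integrable_pf[OF r(1)] integrable_p[OF r(1), of x]
      by (subst Bochner_Integration.integral_diff) auto
    then have "ennreal \<bar>P r x - f x\<bar> \<le> (\<integral>\<^sup>+y. ennreal \<bar>p r x y * f y - p r x y * f x\<bar> \<partial>lborel)"
      by (simp only: ennreal_norm_integral_le)
    also have "\<dots> \<le> (\<integral>\<^sup>+y. ennreal L * ennreal (p r x y * norm (y - x)) \<partial>lborel)"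
    proof (rule nn_integral_mono)
      fix y
      have "\<bar>p r x y * f y - p r x y * f x\<bar> = p r x y * \<bar>f y - f x\<bar>"
        using p_nonneg[of r x y] by (simp add: abs_mult right_diff_distrib[symmetric])
      also have "\<dots> \<le> p r x y * (L * norm (y - x))" by (intro mult_left_mono f_lip p_nonneg)
      finally show "ennreal \<bar>p r x y * f y - p r x y * f x\<bar> \<le> ennreal L * ennreal (p r x y * norm (y - x))"
        using L0 p_nonneg by (simp add: ennreal_mult[symmetric] mult_ac ennreal_leI)
    qed
    also have "\<dots> = ennreal L * (\<integral>\<^sup>+y. ennreal (p r x y * norm (y - x)) \<partial>lborel)"
      by (rule nn_integral_cmult) measurable
    also have "\<dots> \<le> ennreal L * ennreal (C * (1 + norm x) * sqrt r)"
      by (intro mult_left_mono C r) simp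
    also have "\<dots> = ennreal (L * C * (1 + norm x) * sqrt r)"
      using L0 C r by (simp add: ennreal_mult[symmetric] mult_ac)
    finally show ?thesis using L0 C r by (subst (asm) ennreal_le_iff) auto
  qed
  then show thesis using C L0 by (intro that[of "L * C"]) auto
qed

lemma P_add:
  assumes u: "0 < u" and r: "0 < r"
  shows "P (u + r) x = (LBINT z. p u x z * P r z)"
proof -
  define F where "F = (\<lambda>z y. p u x z * (p r z y * f y))"
  have F[measurable]: "(\<lambda>(z, y). F z y) \<in> borel_measurable (lborel \<Otimes>\<^sub>M lborel)"
    unfolding F_def by measurable
  have "(\<integral>\<^sup>+z. \<integral>\<^sup>+y. ennreal \<bar>F z y\<bar> \<partial>lborel \<partial>lborel) \<le> (\<integral>\<^sup>+z. ennreal (p u x z) * ennreal K \<partial>lborel)" (is "?S \<le> _")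
  proof (rule nn_integral_mono)
    fix z
    have "(\<integral>\<^sup>+y. ennreal \<bar>F z y\<bar> \<partial>lborel) \<le> (\<integral>\<^sup>+y. ennreal (p u x z) * (ennreal (p r z y) * ennreal K) \<partial>lborel)"
      using f_bound p_nonneg K0 unfolding F_def
      by (intro nn_integral_mono) (auto simp: abs_mult ennreal_mult[symmetric] intro!: ennreal_leI mult_left_mono)
    also have "\<dots> = ennreal (p u x z) * ennreal K"
      by (simp add: nn_integral_cmult nn_integral_multc p_mass[OF r])
    finally show "(\<integral>\<^sup>+y. ennreal \<bar>F z y\<bar> \<partial>lborel) \<le> ennreal (p u x z) * ennreal K" .
  qed
  also have "\<dots> < \<infinity>" by (simp add: nn_integral_multc p_mass[OF u])
  finally have fin: "?S < \<infinity>" .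
  have ck: "(LBINT z. p u x z * p r z y) = p (u + r) x y" for y
    using chapman_kolmogorov[OF u r, of x y] p_nonneg
    by (subst integral_eq_nn_integral) auto
  have "(LBINT z. p u x z * P r z) = (LBINT z. LBINT y. F z y)"
    unfolding F_def P_def by simp
  also have "\<dots> = (LBINT y. LBINT z. F z y)"
    by (rule integral_lborel_swap[OF F fin])
  also have "\<dots> = P (u + r) x"
    unfolding P_def ck[symmetric] F_def by (simp add: mult.assoc[symmetric])
  finally show ?thesis by simp
qed

lemma integrable_p_linear_growth:
  assumes t: "0 < t" and [measurable]: "g \<in> borel_measurable borel" and C: "0 \<le> C" "\<And>y. \<bar>g y\<bar> \<le> C * (1 + norm y)"
  shows "integrable lborel (\<lambda>y. p t x y * g y)"
proof -
  obtain D where D: "0 \<le> D" "\<And>x. (\<integral>\<^sup>+y. ennreal (p t x y * norm y) \<partial>lborel) \<le> ennreal (D * (1 + norm x))"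
    using p_moment[of t] t by blast
  have "(\<integral>\<^sup>+y. ennreal (norm (p t x y * g y)) \<partial>lborel) \<le> (\<integral>\<^sup>+y. ennreal C * (ennreal (p t x y) + ennreal (p t x y * norm y)) \<partial>lborel)"
  proof (rule nn_integral_mono)
    fix y
    have "p t x y * \<bar>g y\<bar> \<le> p t x y * (C * (1 + norm y))" by (intro mult_left_mono C p_nonneg)
    then show "ennreal (norm (p t x y * g y)) \<le> ennreal C * (ennreal (p t x y) + ennreal (p t x y * norm y))"
      using p_nonneg[of t x y] C by (simp add: ennreal_mult[symmetric] ennreal_plus[symmetric] abs_mult algebra_simps ennreal_leI del: ennreal_plus)
  qed
  also have "\<dots> = ennreal C * (1 + (\<integral>\<^sup>+y. ennreal (p t x y * norm y) \<partial>lborel))"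
    by (simp add: nn_integral_cmult nn_integral_add p_mass[OF t])
  also have "\<dots> \<le> ennreal C * (1 + ennreal (D * (1 + norm x)))"
    by (intro mult_left_mono add_left_mono D) simp
  also have "\<dots> < \<infinity>" by (simp add: ennreal_mult_less_top)
  finally show ?thesis by (intro integrableI_bounded) auto
qed

lemma integrable_pP:
  assumes "0 < u" "0 < r" shows "integrable lborel (\<lambda>z. p u x z * P r z)"
  by (rule integrable_p_linear_growth[OF assms(1) _ K0])
     (use K0 in \<open>auto intro!: order_trans[OF P_bound[OF assms(2)]] simp: algebra_simps\<close>)

text \<open>Freezing \<open>h x\<close> for $u \le 0$ makes it continuous on the whole line.\<close>

definition h :: "'a \<Rightarrow> real \<Rightarrow> real" where
  "h x u = (if u \<le> 0 then f x else P u x)"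

lemma h_meas2[measurable (raw)]:
  assumes [measurable]: "a \<in> borel_measurable N" "b \<in> borel_measurable N"
  shows "(\<lambda>z. h (a z) (b z)) \<in> borel_measurable N"
  unfolding h_def by measurable

text \<open>By the semigroup law the increment is P_u applied to P_r f - f. The small-time bound
  grows linearly in the space variable, so integrating it costs a first moment, uniformly bounded
  for u \<le> R.\<close>

lemma h_hoelder:
  obtains C where "0 \<le> C" "\<And>u r. 0 \<le> u \<Longrightarrow> u \<le> R \<Longrightarrow> 0 < r \<Longrightarrow> r \<le> 1 \<Longrightarrow> \<bar>h x (u + r) - h x u\<bar> \<le> C * sqrt r"
proof -
  obtain C where C: "0 \<le> C" "\<And>r x. 0 < r \<Longrightarrow> r \<le> 1 \<Longrightarrow> \<bar>P r x - f x\<bar> \<le> C * (1 + norm x) * sqrt r"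
    by (rule P_displacement) blast
  obtain D where D: "0 \<le> D" "\<And>u x. 0 < u \<Longrightarrow> u \<le> R \<Longrightarrow> (\<integral>\<^sup>+y. ennreal (p u x y * norm y) \<partial>lborel) \<le> ennreal (D * (1 + norm x))"
    using p_moment[of R] by blast
  \<comment> \<open>D + 1 rather than D, so that E also covers u = 0, where the bound contains norm
    x itself.\<close>
  define E where "E = C * (1 + (D + 1) * (1 + norm x))"
  have E0: "0 \<le> E" using C D by (simp add: E_def)
  have "\<bar>h x (u + r) - h x u\<bar> \<le> E * sqrt r" if u: "0 \<le> u" "u \<le> R" and r: "0 < r" "r \<le> 1" for u r
  proof (cases "u = 0")
    case True
    have "\<bar>P r x - f x\<bar> \<le> C * (1 + norm x) * sqrt r" by (rule C(2)[OF r])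
    also have "\<dots> \<le> E * sqrt r"
      unfolding E_def using C D r by (intro mult_right_mono mult_left_mono) (auto simp: algebra_simps)
    finally show ?thesis using True r by (simp add: h_def)
  next
    case False
    with u have u0: "0 < u" by simp
    have "P (u + r) x - P u x = (LBINT z. p u x z * P r z - p u x z * f z)"
      unfolding P_add[OF u0 r(1)] P_def[of u]
      by (rule Bochner_Integration.integral_diff[symmetric, OF integrable_pP[OF u0 r(1)] integrable_pf[OF u0]])
    then have "ennreal \<bar>P (u + r) x - P u x\<bar> \<le> (\<integral>\<^sup>+z. ennreal \<bar>p u x z * P r z - p u x z * f z\<bar> \<partial>lborel)"
      by (simp only: ennreal_norm_integral_le)
    also have "\<dots> \<le> (\<integral>\<^sup>+z. ennreal (C * sqrt r) * (ennreal (p u x z) + ennreal (p u x z * norm z)) \<partial>lborel)"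
    proof (rule nn_integral_mono)
      fix z
      have "\<bar>p u x z * P r z - p u x z * f z\<bar> = p u x z * \<bar>P r z - f z\<bar>"
        using p_nonneg[of u x z] by (simp add: abs_mult right_diff_distrib[symmetric])
      also have "\<dots> \<le> p u x z * (C * (1 + norm z) * sqrt r)" by (intro mult_left_mono C r p_nonneg)
      finally show "ennreal \<bar>p u x z * P r z - p u x z * f z\<bar> \<le> ennreal (C * sqrt r) * (ennreal (p u x z) + ennreal (p u x z * norm z))"
        using C r p_nonneg[of u x z]
        by (simp add: ennreal_mult[symmetric] ennreal_plus[symmetric] algebra_simps ennreal_leI del: ennreal_plus)
    qed
    also have "\<dots> = ennreal (C * sqrt r) * (1 + (\<integral>\<^sup>+y. ennreal (p u x y * norm y) \<partial>lborel))"
      by (simp add: nn_integral_cmult nn_integral_add p_mass[OF u0])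
    also have "\<dots> \<le> ennreal (C * sqrt r) * (1 + ennreal (D * (1 + norm x)))"
      by (intro mult_left_mono add_left_mono D u0 u) simp
    also have "\<dots> = ennreal (C * sqrt r * (1 + D * (1 + norm x)))"
      using C D r by (simp add: ennreal_mult[symmetric] ennreal_plus[symmetric] ennreal_1[symmetric] del: ennreal_plus ennreal_1)
    also have "\<dots> \<le> ennreal (E * sqrt r)"
    proof (rule ennreal_leI)
      have "C * (1 + D * (1 + norm x)) \<le> E"
        unfolding E_def using C D by (intro mult_left_mono) (auto simp: algebra_simps)
      then have "C * (1 + D * (1 + norm x)) * sqrt r \<le> E * sqrt r" using r by (intro mult_right_mono) auto
      then show "C * sqrt r * (1 + D * (1 + norm x)) \<le> E * sqrt r" by (simp add: mult_ac)
    qed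
    finally have "\<bar>P (u + r) x - P u x\<bar> \<le> E * sqrt r" using E0 r by (subst (asm) ennreal_le_iff) auto
    then show ?thesis using u0 r by (simp add: h_def)
  qed
  then show thesis using E0 that by blast
qed

text \<open>Continuity from both sides follows from forward increments by taking the smaller of the
  two times as base point.\<close>

lemma h_cont: "continuous_on UNIV (h x)"
proof (rule continuous_at_imp_continuous_on, rule ballI)
  fix u :: real
  obtain C where C: "0 \<le> C" "\<And>v r. 0 \<le> v \<Longrightarrow> v \<le> \<bar>u\<bar> + 1 \<Longrightarrow> 0 < r \<Longrightarrow> r \<le> 1 \<Longrightarrow> \<bar>h x (v + r) - h x v\<bar> \<le> C * sqrt r"
    by (rule h_hoelder) blast
  have hm: "h x v = h x (max v 0)" for v by (simp add: h_def max_def)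
  have C': "\<bar>h x b - h x a\<bar> \<le> C * sqrt (b - a)" if "0 \<le> a" "a \<le> \<bar>u\<bar> + 1" "a \<le> b" "b - a \<le> 1" for a b
    using C(2)[of a "b - a"] that by (cases "a = b") auto
  have est: "\<bar>h x v - h x u\<bar> \<le> C * sqrt \<bar>v - u\<bar>" if v: "\<bar>v - u\<bar> \<le> 1" for v
  proof (cases "max u 0 \<le> max v 0")
    case True
    have "\<bar>h x v - h x u\<bar> \<le> C * sqrt (max v 0 - max u 0)"
      unfolding hm[of v] hm[of u] by (rule C') (use v True in auto)
    also have "\<dots> \<le> C * sqrt \<bar>v - u\<bar>" using C by (intro mult_left_mono real_sqrt_le_mono) auto
    finally show ?thesis .
  next
    case False
    have "\<bar>h x v - h x u\<bar> = \<bar>h x u - h x v\<bar>" by simp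
    also have "\<dots> \<le> C * sqrt (max u 0 - max v 0)"
      unfolding hm[of v] hm[of u] by (rule C') (use v False in auto)
    also have "\<dots> \<le> C * sqrt \<bar>v - u\<bar>" using C by (intro mult_left_mono real_sqrt_le_mono) auto
    finally show ?thesis .
  qed
  have "((\<lambda>v. C * sqrt \<bar>v - u\<bar>) \<longlongrightarrow> C * sqrt \<bar>u - u\<bar>) (at u)" by (intro tendsto_intros)
  then have lim0: "((\<lambda>v. C * sqrt \<bar>v - u\<bar>) \<longlongrightarrow> 0) (at u)" by simp
  have "((\<lambda>v. h x v - h x u) \<longlongrightarrow> 0) (at u)"
  proof (rule Lim_null_comparison[OF _ lim0])
    show "\<forall>\<^sub>F v in at u. norm (h x v - h x u) \<le> C * sqrt \<bar>v - u\<bar>"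
      unfolding eventually_at by (rule exI[of _ 1]) (auto simp: dist_real_def intro!: est)
  qed
  then show "isCont (h x) u" unfolding isCont_def by (rule LIM_zero_cancel)
qed

lemma decaying_hoelder_h:
  obtains M where "\<And>x. decaying_hoelder (h x) s M"
proof -
  obtain C where C: "0 \<le> C" "\<And>u x y. 1 \<le> u \<Longrightarrow> p u x y \<le> C / u"
    using p_decay by blast
  have "decaying_hoelder (h x) s (max K (C * I))" for x
  proof
    show "0 < s" "s < 1/2" by (fact s)+
    show "continuous_on UNIV (h x)" by (rule h_cont)
    show "\<bar>h x u\<bar> \<le> max K (C * I)" for u
      using f_bound[of x] P_bound[of u x] by (auto simp: h_def le_max_iff_disj)
    show "\<bar>h x u\<bar> \<le> max K (C * I) / u" if u: "1 \<le> u" for u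
    proof -
      have "\<bar>P u x\<bar> \<le> C / u * I" by (rule P_le_sup) (use C u in auto)
      also have "\<dots> \<le> max K (C * I) / u" using u by (simp add: divide_right_mono)
      finally show ?thesis using u by (simp add: h_def)
    qed
    show "\<exists>C\<ge>0. \<forall>u r. 0 \<le> u \<longrightarrow> u \<le> R \<longrightarrow> 0 < r \<longrightarrow> r \<le> 1 \<longrightarrow> \<bar>h x (u + r) - h x u\<bar> \<le> C * sqrt r" for R
      using h_hoelder[of R x] by metis
  qed
  then show thesis by (rule that)
qed

text \<open>The fractional power up to the factor - s / \<Gamma>(1 - s), which
  \<open>L1norm_Psg_diff_le\<close> restores.\<close>

definition fracP :: "'a \<Rightarrow> real" where
  "fracP y = (LBINT r. ppow (-1 - s) r * (P r y - f y))"

lemma fracP_meas[measurable]: "fracP \<in> borel_measurable borel"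
  unfolding fracP_def by measurable

lemma marchaud_meas[measurable (raw)]:
  assumes [measurable]: "a \<in> borel_measurable N" "b \<in> borel_measurable N"
  shows "(\<lambda>z. marchaud s (h (a z)) (b z)) \<in> borel_measurable N"
  unfolding marchaud_def by measurable

text \<open>P_u commutes with the integral in r. The exchange is legitimate because the inner
  absolute integral grows at most linearly in z, and p_u has a first moment.\<close>

lemma marchaud_h:
  assumes u: "0 < u"
  shows "marchaud s (h x) u = (LBINT z. p u x z * fracP z)"
proof -
  obtain C where C: "0 \<le> C" "\<And>r x. 0 < r \<Longrightarrow> r \<le> 1 \<Longrightarrow> \<bar>P r x - f x\<bar> \<le> C * (1 + norm x) * sqrt r"
    by (rule P_displacement) blast
  have big: "\<bar>P r z - f z\<bar> \<le> 2 * K" if "0 < r" for r z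
    using P_bound[OF that, of z] f_bound[of z] by linarith
  define F where "F = (\<lambda>r z. p u x z * (ppow (-1 - s) r * (P r z - f z)))"
  have F: "(\<lambda>(z, r). F r z) \<in> borel_measurable (lborel \<Otimes>\<^sub>M lborel)"
    unfolding F_def by measurable
  define c where "c = C / (1/2 - s) + 2 * K / s"
  have c0: "0 \<le> C / (1/2 - s)" "0 \<le> 2 * K / s" using C K0 s by auto
  have c_nonneg: "0 \<le> c" using c0 by (simp add: c_def)
  have "(\<integral>\<^sup>+z. \<integral>\<^sup>+r. ennreal \<bar>F r z\<bar> \<partial>lborel \<partial>lborel) \<le> (\<integral>\<^sup>+z. ennreal (norm (p u x z * (c * (1 + norm z)))) \<partial>lborel)" (is "?S \<le> _")
  proof (rule nn_integral_mono)
    fix z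
    have "(\<integral>\<^sup>+r. ennreal \<bar>F r z\<bar> \<partial>lborel) = ennreal (p u x z) * (\<integral>\<^sup>+r. ennreal \<bar>ppow (-1 - s) r * (P r z - f z)\<bar> \<partial>lborel)"
      unfolding F_def using p_nonneg by (subst nn_integral_cmult[symmetric]) (auto simp: abs_mult ennreal_mult)
    also have "\<dots> \<le> ennreal (p u x z) * ennreal (C * (1 + norm z) / (1/2 - s) + 2 * K / s)"
      by (intro mult_left_mono nn_integral_marchaud_le) (use s C K0 big in auto)
    also have "\<dots> \<le> ennreal (p u x z) * ennreal (c * (1 + norm z))"
    proof (intro mult_left_mono ennreal_leI)
      have "2 * K / s \<le> 2 * K / s * (1 + norm z)" using mult_left_mono[OF _ c0(2), of 1 "1 + norm z"] by simp
      then show "C * (1 + norm z) / (1/2 - s) + 2 * K / s \<le> c * (1 + norm z)"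
        unfolding c_def by (simp add: distrib_right)
    qed simp
    also have "\<dots> = ennreal (norm (p u x z * (c * (1 + norm z))))"
      using p_nonneg[of u x z] c_nonneg by (simp add: ennreal_mult[symmetric] abs_mult)
    finally show "(\<integral>\<^sup>+r. ennreal \<bar>F r z\<bar> \<partial>lborel) \<le> ennreal (norm (p u x z * (c * (1 + norm z))))" .
  qed
  also have "\<dots> < \<infinity>"
  proof -
    have "integrable lborel (\<lambda>z. p u x z * (c * (1 + norm z)))"
      by (rule integrable_p_linear_growth[OF u _ c_nonneg]) (use c_nonneg in \<open>auto simp: abs_mult\<close>)
    then show ?thesis by (simp add: integrable_iff_bounded)
  qed
  finally have fin: "?S < \<infinity>" .
  have "marchaud s (h x) u = (LBINT r. LBINT z. F r z)"
    unfolding marchaud_def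
  proof (rule Bochner_Integration.integral_cong[OF refl])
    fix r :: real
    show "ppow (-1 - s) r * (h x (u + r) - h x u) = (LBINT z. F r z)"
    proof (cases "0 < r")
      case True
      have "h x (u + r) - h x u = (LBINT z. p u x z * P r z - p u x z * f z)"
        using u True by (simp add: h_def P_add[OF u True] P_def[of u] Bochner_Integration.integral_diff[OF integrable_pP[OF u True] integrable_pf[OF u]])
      then have "ppow (-1 - s) r * (h x (u + r) - h x u) = (LBINT z. ppow (-1 - s) r * (p u x z * P r z - p u x z * f z))"
        by simp
      also have "\<dots> = (LBINT z. F r z)"
        unfolding F_def by (rule Bochner_Integration.integral_cong) (auto simp: algebra_simps)
      finally show ?thesis .
    qed (simp add: F_def ppow_def)
  qed
  also have "\<dots> = (LBINT z. LBINT r. F r z)"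
    by (rule integral_lborel_swap[OF F fin, symmetric])
  also have "\<dots> = (LBINT z. p u x z * fracP z)"
    unfolding F_def fracP_def by simp
  finally show ?thesis .
qed

lemma nn_integral_marchaud_h_le:
  assumes u: "0 < u"
  shows "(\<integral>\<^sup>+x. ennreal \<bar>marchaud s (h x) u\<bar> \<partial>lborel) \<le> (\<integral>\<^sup>+z. ennreal \<bar>fracP z\<bar> \<partial>lborel)"
proof -
  have "(\<integral>\<^sup>+x. ennreal \<bar>marchaud s (h x) u\<bar> \<partial>lborel) \<le> (\<integral>\<^sup>+x. \<integral>\<^sup>+z. ennreal \<bar>p u x z * fracP z\<bar> \<partial>lborel \<partial>lborel)"
    unfolding marchaud_h[OF u] by (intro nn_integral_mono ennreal_norm_integral_le)
  also have "\<dots> = (\<integral>\<^sup>+z. \<integral>\<^sup>+x. ennreal \<bar>p u x z * fracP z\<bar> \<partial>lborel \<partial>lborel)"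
    by (rule lborel_pair.Fubini') measurable
  also have "\<dots> \<le> (\<integral>\<^sup>+z. 1 * ennreal \<bar>fracP z\<bar> \<partial>lborel)"
  proof (rule nn_integral_mono)
    fix z
    have "(\<integral>\<^sup>+x. ennreal \<bar>p u x z * fracP z\<bar> \<partial>lborel) = (\<integral>\<^sup>+x. ennreal (p u x z) \<partial>lborel) * ennreal \<bar>fracP z\<bar>"
      using p_nonneg by (subst nn_integral_multc[symmetric]) (auto simp: abs_mult ennreal_mult)
    also have "\<dots> \<le> 1 * ennreal \<bar>fracP z\<bar>" by (intro mult_right_mono p_comass[OF u]) simp
    finally show "(\<integral>\<^sup>+x. ennreal \<bar>p u x z * fracP z\<bar> \<partial>lborel) \<le> 1 * ennreal \<bar>fracP z\<bar>" .
  qed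
  finally show ?thesis by simp
qed

text \<open>The bound is linear in d, so dividing by d loses nothing in the limit. The factor 2 + s
  is s (2 / s + 1), with 2 / s + 1 from \<open>nn_integral_kap_le\<close>. All integrals are
  nonnegative, so the norm on the right may be infinite.\<close>

lemma nn_integral_increment_le:
  assumes d: "0 < d" and t: "0 < t"
  shows "(\<integral>\<^sup>+x. ennreal (Beta s (1 - s) * \<bar>LBINT u. indicator {0<..t} u * (h x (u + d) - h x u)\<bar>) \<partial>lborel)
    \<le> ennreal ((2 + s) * t powr s * d) * (\<integral>\<^sup>+z. ennreal \<bar>fracP z\<bar> \<partial>lborel)"
proof -
  obtain M where M: "\<And>x. decaying_hoelder (h x) s M" using decaying_hoelder_h by blast
  let ?N = "\<integral>\<^sup>+z. ennreal \<bar>fracP z\<bar> \<partial>lborel"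
  let ?J = "\<lambda>x \<tau> e. indicator {0<..d} e * ennreal \<bar>marchaud s (h x) (\<tau> + e)\<bar>"
  have "(\<integral>\<^sup>+x. ennreal (Beta s (1 - s) * \<bar>LBINT u. indicator {0<..t} u * (h x (u + d) - h x u)\<bar>) \<partial>lborel)
      \<le> (\<integral>\<^sup>+x. \<integral>\<^sup>+\<tau>. ennreal (s * \<bar>kap s t \<tau>\<bar>) * (\<integral>\<^sup>+e. ?J x \<tau> e \<partial>lborel) \<partial>lborel \<partial>lborel)"
  proof (rule nn_integral_mono)
    fix x
    have cont: "continuous_on UNIV (\<lambda>u. h x (u + d) - h x u)"
      by (intro continuous_intros continuous_on_compose2[OF h_cont]) auto
    show "ennreal (Beta s (1 - s) * \<bar>LBINT u. indicator {0<..t} u * (h x (u + d) - h x u)\<bar>)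
      \<le> (\<integral>\<^sup>+\<tau>. ennreal (s * \<bar>kap s t \<tau>\<bar>) * (\<integral>\<^sup>+e. ?J x \<tau> e \<partial>lborel) \<partial>lborel)"
      unfolding integral_indicator_Ioc[OF cont]
      by (rule decaying_hoelder.integral_increment_le[OF M d t])
  qed
  also have "\<dots> = (\<integral>\<^sup>+\<tau>. \<integral>\<^sup>+x. ennreal (s * \<bar>kap s t \<tau>\<bar>) * (\<integral>\<^sup>+e. ?J x \<tau> e \<partial>lborel) \<partial>lborel \<partial>lborel)"
    by (rule lborel_pair.Fubini') measurable
  also have "\<dots> \<le> (\<integral>\<^sup>+\<tau>. ennreal (s * \<bar>kap s t \<tau>\<bar>) * (ennreal d * ?N) \<partial>lborel)"
  proof (rule nn_integral_mono)
    fix \<tau> :: real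
    show "(\<integral>\<^sup>+x. ennreal (s * \<bar>kap s t \<tau>\<bar>) * (\<integral>\<^sup>+e. ?J x \<tau> e \<partial>lborel) \<partial>lborel) \<le> ennreal (s * \<bar>kap s t \<tau>\<bar>) * (ennreal d * ?N)"
    proof (cases "0 \<le> \<tau>")
      case True
      have "(\<integral>\<^sup>+x. \<integral>\<^sup>+e. ?J x \<tau> e \<partial>lborel \<partial>lborel) = (\<integral>\<^sup>+e. \<integral>\<^sup>+x. ?J x \<tau> e \<partial>lborel \<partial>lborel)"
        by (rule lborel_pair.Fubini') measurable
      also have "\<dots> \<le> (\<integral>\<^sup>+e. indicator {0<..d} e * ?N \<partial>lborel)"
      proof (rule nn_integral_mono)
        fix e :: real
        show "(\<integral>\<^sup>+x. ?J x \<tau> e \<partial>lborel) \<le> indicator {0<..d} e * ?N"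
        proof (cases "e \<in> {0<..d}")
          case True
          then show ?thesis using nn_integral_marchaud_h_le[of "\<tau> + e"] \<open>0 \<le> \<tau>\<close> by simp
        qed simp
      qed
      also have "\<dots> = ennreal d * ?N" using d by (subst nn_integral_multc) auto
      finally show ?thesis by (subst nn_integral_cmult) (auto intro!: mult_left_mono)
    next
      case False
      then have "kap s t \<tau> = 0" using t by (simp add: kap_def ppow_def)
      then show ?thesis by simp
    qed
  qed
  also have "\<dots> = ennreal s * (\<integral>\<^sup>+\<tau>. ennreal \<bar>kap s t \<tau>\<bar> \<partial>lborel) * (ennreal d * ?N)"
    using s by (simp add: nn_integral_multc nn_integral_cmult ennreal_mult)
  also have "\<dots> \<le> ennreal s * ennreal ((2 / s + 1) * t powr s) * (ennreal d * ?N)"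
    using s t by (intro mult_right_mono mult_left_mono nn_integral_kap_le) auto
  also have "\<dots> = ennreal (s * ((2 / s + 1) * t powr s) * d) * ?N"
    using s d by (simp add: ennreal_mult mult_ac)
  also have "s * ((2 / s + 1) * t powr s) * d = (2 + s) * t powr s * d"
    using s by (simp add: field_simps)
  finally show ?thesis .
qed

text \<open>By \<open>integral_difference_swap\<close> the quotient is the mean over [0, 1/(n+1)] of
  the continuous function e -> h(e + t) - h(e), and so tends to its value at 0.\<close>

lemma averaged_increment_tendsto:
  assumes t: "0 < t"
  shows "(\<lambda>n. (LBINT u. indicator {0<..t} u * (h x (u + 1 / Suc n) - h x u)) / (1 / Suc n)) \<longlonglongrightarrow> P t x - f x"
proof -
  define g where "g = (\<lambda>e. h x (0 + e + t) - h x (0 + e))"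
  have g: "continuous_on {0..1} g"
    unfolding g_def by (intro continuous_intros continuous_on_compose2[OF h_cont]) auto
  have "((\<lambda>u. integral {0..u} g) has_vector_derivative g 0) (at 0 within {0..1})"
    by (rule integral_has_vector_derivative[OF g]) simp
  then have "((\<lambda>u. integral {0..u} g) has_field_derivative g 0) (at 0 within {0..1})"
    by (simp add: has_real_derivative_iff_has_vector_derivative)
  then have lim: "((\<lambda>y. (integral {0..y} g - integral {0..0} g) / (y - 0)) \<longlongrightarrow> g 0) (at 0 within {0..1})"
    by (simp add: has_field_derivative_iff)
  have "filterlim (\<lambda>n. 1 / real (Suc n)) (at 0 within {0..1}) sequentially"
    unfolding filterlim_at using LIMSEQ_inverse_real_of_nat by (auto simp: inverse_eq_divide)
  from filterlim_compose[OF lim this]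
  have "(\<lambda>n. (integral {0..1 / real (Suc n)} g - integral {0..0} g) / (1 / real (Suc n) - 0)) \<longlonglongrightarrow> g 0" .
  moreover have "(LBINT u. indicator {0<..t} u * (h x (u + 1 / Suc n) - h x u)) = integral {0..1 / real (Suc n)} g" for n
  proof -
    have cont: "continuous_on UNIV (\<lambda>u. h x (u + 1 / Suc n) - h x u)"
      by (intro continuous_intros continuous_on_compose2[OF h_cont]) auto
    show ?thesis
      unfolding integral_indicator_Ioc[OF cont] g_def
      using integral_difference_swap[OF h_cont, of t "1 / Suc n" x 0] t by simp
  qed
  moreover have "g 0 = P t x - f x" using t by (simp add: g_def h_def)
  ultimately show ?thesis by simp
qed

theorem nn_integral_P_diff_le:
  assumes t: "0 < t"
  shows "ennreal (Beta s (1 - s)) * (\<integral>\<^sup>+x. ennreal \<bar>P t x - f x\<bar> \<partial>lborel)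
    \<le> ennreal ((2 + s) * t powr s) * (\<integral>\<^sup>+z. ennreal \<bar>fracP z\<bar> \<partial>lborel)"
proof -
  let ?N = "\<integral>\<^sup>+z. ennreal \<bar>fracP z\<bar> \<partial>lborel"
  have B: "0 \<le> Beta s (1 - s)" using s by (simp add: Beta_def)
  define v where "v = (\<lambda>n x. (LBINT u. indicator {0<..t} u * (h x (u + 1 / Suc n) - h x u)))"
  define a where "a = (\<lambda>n x. ennreal (Beta s (1 - s) * \<bar>v n x / (1 / Suc n)\<bar>))"
  have [measurable]: "v n \<in> borel_measurable borel" for n unfolding v_def by measurable
  have [measurable]: "a n \<in> borel_measurable lborel" for n unfolding a_def by measurable
  have lim: "(\<lambda>n. a n x) \<longlonglongrightarrow> ennreal (Beta s (1 - s) * \<bar>P t x - f x\<bar>)" for x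
    unfolding a_def using averaged_increment_tendsto[OF t, of x]
    by (intro tendsto_ennrealI tendsto_intros) (simp add: v_def)
  have le: "(\<integral>\<^sup>+x. a n x \<partial>lborel) \<le> ennreal ((2 + s) * t powr s) * ?N" for n
  proof -
    have "(\<integral>\<^sup>+x. a n x \<partial>lborel) = (\<integral>\<^sup>+x. ennreal (real (Suc n)) * ennreal (Beta s (1 - s) * \<bar>v n x\<bar>) \<partial>lborel)"
      unfolding a_def using B by (intro nn_integral_cong) (simp add: ennreal_mult[symmetric] abs_mult mult_ac del: of_nat_Suc)
    also have "\<dots> = ennreal (real (Suc n)) * (\<integral>\<^sup>+x. ennreal (Beta s (1 - s) * \<bar>v n x\<bar>) \<partial>lborel)"
      by (rule nn_integral_cmult) measurable
    also have "\<dots> \<le> ennreal (real (Suc n)) * (ennreal ((2 + s) * t powr s * (1 / Suc n)) * ?N)"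
      unfolding v_def using t by (intro mult_left_mono nn_integral_increment_le) auto
    also have "\<dots> = ennreal (real (Suc n) * ((2 + s) * t powr s * (1 / Suc n))) * ?N"
      using s by (subst ennreal_mult) (auto simp: mult.assoc)
    also have "real (Suc n) * ((2 + s) * t powr s * (1 / Suc n)) = (2 + s) * t powr s" by simp
    finally show ?thesis .
  qed
  have "ennreal (Beta s (1 - s)) * (\<integral>\<^sup>+x. ennreal \<bar>P t x - f x\<bar> \<partial>lborel) = (\<integral>\<^sup>+x. ennreal (Beta s (1 - s) * \<bar>P t x - f x\<bar>) \<partial>lborel)"
    using B by (subst nn_integral_cmult[symmetric]) (auto simp: ennreal_mult)
  also have "\<dots> = (\<integral>\<^sup>+x. liminf (\<lambda>n. a n x) \<partial>lborel)"
    by (intro nn_integral_cong lim_imp_Liminf[symmetric] lim) simp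
  also have "\<dots> \<le> liminf (\<lambda>n. \<integral>\<^sup>+x. a n x \<partial>lborel)" by (rule nn_integral_liminf) measurable
  also have "\<dots> \<le> ennreal ((2 + s) * t powr s) * ?N"
  proof -
    have "liminf (\<lambda>n. \<integral>\<^sup>+x. a n x \<partial>lborel) \<le> liminf (\<lambda>n::nat. ennreal ((2 + s) * t powr s) * ?N)"
      by (intro Liminf_mono always_eventually allI le)
    then show ?thesis by (simp add: Liminf_const)
  qed
  finally show ?thesis .
qed

end

section \<open>The isoperimetric inequality\<close>

text \<open>The seminorms with weight exponent 0 and at most one derivative give it: the operator
  norm of the derivative is at most the sum of the bounds of the partial derivatives, and the mean
  value inequality applies.\<close>

lemma schwartz_bounded_lipschitz:
  fixes f :: "real^'n \<Rightarrow> real"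
  assumes f: "schwartz f"
  obtains K L where "f \<in> borel_measurable borel" "\<And>x. \<bar>f x\<bar> \<le> K" "0 \<le> L" "\<And>x y. \<bar>f y - f x\<bar> \<le> L * norm (y - x)"
proof -
  have S: "(\<forall>x. dder vs f differentiable at x) \<and> (\<forall>m::nat. bounded (range (\<lambda>x. norm x ^ m * dder vs f x)))"
    if "set vs \<subseteq> cart_basis" for vs
    using f that unfolding schwartz_def by blast
  have df: "f differentiable at x" for x using S[of "[]"] by simp
  have "bounded (range f)" using conjunct2[OF S[of "[]"], rule_format, of 0] by simp
  then obtain K where K: "\<And>x. \<bar>f x\<bar> \<le> K" by (auto simp: bounded_iff)
  have der: "(f has_derivative frechet_derivative f (at x)) (at x)" for x
    using df frechet_derivative_works by blast
  have "\<exists>l. \<forall>x. \<bar>frechet_derivative f (at x) b\<bar> \<le> l" if b: "b \<in> Basis" for b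
  proof -
    have "b \<in> cart_basis" using b by (auto simp: Basis_vec_def cart_basis_def)
    then have "bounded (range (\<lambda>x. frechet_derivative f (at x) b))"
      using conjunct2[OF S[of "[b]"], rule_format, of 0] by simp
    then show ?thesis by (auto simp: bounded_iff)
  qed
  then obtain l where l: "\<And>b x. b \<in> Basis \<Longrightarrow> \<bar>frechet_derivative f (at x) b\<bar> \<le> l b" by metis
  define L where "L = (\<Sum>b\<in>(Basis::(real^'n) set). l b)"
  have l0: "0 \<le> l b" if "b \<in> Basis" for b using l[OF that, of 0] by linarith
  have L0: "0 \<le> L" unfolding L_def by (rule sum_nonneg) (rule l0)
  have on: "onorm (frechet_derivative f (at x)) \<le> L" for x
  proof (rule onorm_bound[OF L0])
    fix v :: "real^'n"
    let ?D = "frechet_derivative f (at x)"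
    have lin: "linear ?D" using der[of x] has_derivative_linear by blast
    have "?D v = ?D (\<Sum>b\<in>Basis. (v \<bullet> b) *\<^sub>R b)" by (simp add: euclidean_representation)
    also have "\<dots> = (\<Sum>b\<in>Basis. (v \<bullet> b) * ?D b)" by (simp add: linear_sum[OF lin] linear_cmul[OF lin])
    also have "\<bar>\<dots>\<bar> \<le> (\<Sum>b\<in>Basis. \<bar>(v \<bullet> b) * ?D b\<bar>)" by (rule sum_abs)
    also have "\<dots> \<le> (\<Sum>b\<in>Basis. norm v * l b)"
      unfolding abs_mult by (intro sum_mono mult_mono Basis_le_norm l) auto
    finally show "norm (?D v) \<le> L * norm v" by (simp add: L_def sum_distrib_left[symmetric] mult.commute)
  qed
  have "\<bar>f y - f x\<bar> \<le> L * norm (y - x)" for x y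
    using differentiable_bound[of UNIV f "\<lambda>x. frechet_derivative f (at x)" L y x] der on by (simp add: has_derivative_at_withinI)
  moreover have "f \<in> borel_measurable borel"
    using df by (intro borel_measurable_continuous_onI continuous_at_imp_continuous_on ballI differentiable_imp_continuous_within) auto
  ultimately show thesis using that[OF _ K L0] by blast
qed

lemma kernel_datum_schwartz:
  fixes Q B :: "real^'n^'n"
  assumes adm: "admissible Q B" and tr: "0 \<le> trace B" and N: "2 \<le> CARD('n)"
    and f: "schwartz f" and I: "L1norm f \<le> ennreal I" "0 \<le> I" and s: "0 < s" "s < 1/2"
  obtains K L where "kernel_datum (pk Q B) f K L I s"
proof -
  obtain K L where KL: "f \<in> borel_measurable borel" "\<And>x. \<bar>f x\<bar> \<le> K" "0 \<le> L" "\<And>x y. \<bar>f y - f x\<bar> \<le> L * norm (y - x)"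
    by (rule schwartz_bounded_lipschitz[OF f]) blast
  have "kernel_datum (pk Q B) f K L I s"
    by (intro kernel_datum.intro transition_kernel_pk[OF adm tr N] kernel_datum_axioms.intro)
       (use KL I s in \<open>auto simp: L1norm_def\<close>)
  then show thesis by (rule that)
qed

text \<open>The constant (2 + s) / Beta of \<open>nn_integral_P_diff_le\<close>, times \<Gamma>(1 -
  s) / s from the normalisation of the fractional power.\<close>

definition sg_const :: "real \<Rightarrow> real" where
  "sg_const s = (2 + s) * Gamma (1 - s) / (s * Beta s (1 - s))"

lemma sg_const_pos:
  assumes "0 < s" "s < 1/2" shows "0 < sg_const s"
proof -
  have "Gamma s > 0" "Gamma (1 - s) > 0" using assms by (auto intro: Gamma_real_pos)
  moreover from this have "Gamma (1 - s) \<noteq> 0" by linarith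
  ultimately show ?thesis using assms by (simp add: sg_const_def Beta_def)
qed

lemma kernel_datum_P_eq_Psg:
  assumes "kernel_datum (pk Q B) f K L I s" "0 < t"
  shows "kernel_datum.P (pk Q B) f t x = Psg Q B t f x"
  using assms(2) unfolding kernel_datum.P_def[OF assms(1)] Psg_def by (simp add: pk_def)

lemma L1norm_Psg_diff_le:
  fixes Q B :: "real^'n^'n"
  assumes kd: "kernel_datum (pk Q B) f K L I s" and t: "0 < t"
  shows "L1norm (\<lambda>x. Psg Q B t f x - f x) \<le> ennreal (sg_const s * t powr s) * L1norm (fracA Q B s f)"
proof -
  interpret kernel_datum "pk Q B" f K L I s by (rule kd)
  have G: "0 < Gamma (1 - s)" using s by (simp add: Gamma_real_pos)
  then have G0: "Gamma (1 - s) \<noteq> 0" by linarith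
  have B: "0 < Beta s (1 - s)" using s by (simp add: Beta_def Gamma_real_pos)
  have P: "0 < r \<Longrightarrow> P r x = Psg Q B r f x" for r x by (rule kernel_datum_P_eq_Psg[OF kd])
  have fr: "fracA Q B s f x = - (s / Gamma (1 - s)) * fracP x" for x
  proof -
    have "(\<integral>r\<in>{0<..}. r powr (-1 - s) * (Psg Q B r f x - f x) \<partial>lborel) = fracP x"
      unfolding fracP_def set_lebesgue_integral_def
      by (rule Bochner_Integration.integral_cong) (auto simp: ppow_def P indicator_def)
    then show ?thesis by (simp add: fracA_def)
  qed
  have "L1norm (fracA Q B s f) = ennreal (s / Gamma (1 - s)) * (\<integral>\<^sup>+x. ennreal \<bar>fracP x\<bar> \<partial>lborel)"
  proof -
    have "ennreal \<bar>- (s / Gamma (1 - s)) * fracP x\<bar> = ennreal (s / Gamma (1 - s)) * ennreal \<bar>fracP x\<bar>" for x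
      using s G by (subst ennreal_mult[symmetric]) (auto simp: abs_mult)
    then show ?thesis unfolding L1norm_def fr by (simp only:) (rule nn_integral_cmult, measurable)
  qed
  then have "ennreal (Gamma (1 - s) / s) * L1norm (fracA Q B s f)
      = (ennreal (Gamma (1 - s) / s) * ennreal (s / Gamma (1 - s))) * (\<integral>\<^sup>+x. ennreal \<bar>fracP x\<bar> \<partial>lborel)"
    by (simp add: mult.assoc)
  also have "ennreal (Gamma (1 - s) / s) * ennreal (s / Gamma (1 - s)) = 1"
    using s G G0 by (subst ennreal_mult[symmetric]) auto
  finally have N: "(\<integral>\<^sup>+x. ennreal \<bar>fracP x\<bar> \<partial>lborel) = ennreal (Gamma (1 - s) / s) * L1norm (fracA Q B s f)" by simp
  have "L1norm (\<lambda>x. Psg Q B t f x - f x) = (ennreal (1 / Beta s (1 - s)) * ennreal (Beta s (1 - s))) * (\<integral>\<^sup>+x. ennreal \<bar>P t x - f x\<bar> \<partial>lborel)"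
    unfolding L1norm_def P[OF t] using B by (subst ennreal_mult[symmetric]) auto
  also have "\<dots> \<le> ennreal (1 / Beta s (1 - s)) * (ennreal ((2 + s) * t powr s) * (ennreal (Gamma (1 - s) / s) * L1norm (fracA Q B s f)))"
    unfolding mult.assoc N[symmetric] by (intro mult_left_mono nn_integral_P_diff_le t) simp
  also have "\<dots> = ennreal (1 / Beta s (1 - s) * ((2 + s) * t powr s * (Gamma (1 - s) / s))) * L1norm (fracA Q B s f)"
  proof -
    have "ennreal (a * (b * c)) = ennreal a * (ennreal b * ennreal c)" if "0 \<le> a" "0 \<le> b" "0 \<le> c" for a b c
      using that by (simp add: ennreal_mult)
    from this[of "1 / Beta s (1 - s)" "(2 + s) * t powr s" "Gamma (1 - s) / s"]
    show ?thesis using s B G by (simp only: mult.assoc) (simp add: mult.assoc)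
  qed
  also have "1 / Beta s (1 - s) * ((2 + s) * t powr s * (Gamma (1 - s) / s)) = sg_const s * t powr s"
    using s B by (simp add: sg_const_def field_simps)
  finally show ?thesis .
qed

section \<open>Pointwise kernel bounds, volume growth and the test at a fixed time\<close>

lemma omegaN_pos: "0 < omegaN TYPE('n::finite)"
  unfolding omegaN_def using content_ball_pos[of 1 "0::real^'n"] by simp

lemma Vol_eq:
  fixes Q B :: "real^'n^'n"
  assumes "0 < t" shows "Vol Q B t = omegaN TYPE('n) * sqrt (det (cov Q B t))"
  by (simp add: Vol_def scaleR_Kmat[OF assms])

definition heat_const :: "'n::finite itself \<Rightarrow> real" where
  "heat_const N = (4 * pi) powr (- real CARD('n) / 2) * omegaN N"

lemma heat_const_pos: "0 < heat_const TYPE('n::finite)"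
  by (simp add: heat_const_def omegaN_pos)

lemma pk_le_Vol:
  fixes Q B :: "real^'n^'n"
  assumes adm: "admissible Q B" and t: "0 < t"
  shows "pk Q B t x y \<le> heat_const TYPE('n) / Vol Q B t"
proof -
  have d: "0 < det (cov Q B t)" by (rule spd_det_pos[OF spd_cov[OF adm t]])
  have "det (cov Q B t) powr (-1/2) = 1 / sqrt (det (cov Q B t))"
    using d powr_half_sqrt[of "det (cov Q B t)"] by (simp add: powr_minus_divide)
  then show ?thesis
    using pk_le[OF adm t, of x y] omegaN_pos[where 'n='n] by (simp add: Vol_eq[OF t] heat_const_def)
qed

text \<open>Linear growth of V makes the exponent 1 admissible, since t^(-1/2) / t is integrable at
  infinity. The main proof needs it to divide by the dimensions.\<close>

lemma Dinfty_ge_1: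
  fixes Q B :: "real^'n^'n"
  assumes adm: "admissible Q B" and tr: "0 \<le> trace B" and N: "2 \<le> CARD('n)"
  shows "1 \<le> Dinfty Q B"
proof -
  define d where "d = sqrt (det (cov Q B 1))"
  have d: "0 < d" unfolding d_def using spd_det_pos[OF spd_cov[OF adm], of 1] by simp
  let ?w = "omegaN TYPE('n)"
  have w: "0 < ?w" by (rule omegaN_pos)
  have V: "?w * d * (t / 2) \<le> Vol Q B t" if t: "1 \<le> t" for t
  proof -
    have "d * (t / 2) = sqrt (det (cov Q B 1) * (t / 2)\<^sup>2)" using t by (simp add: d_def real_sqrt_mult)
    also have "\<dots> \<le> sqrt (det (cov Q B t))" by (intro real_sqrt_le_mono det_cov_ge adm tr N t)
    finally show ?thesis using w t by (simp add: Vol_eq mult.assoc)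
  qed
  have "(\<integral>\<^sup>+t. ennreal (indicator {1..} t * t powr (1/2 - 1) / Vol Q B t) \<partial>lborel)
      \<le> (\<integral>\<^sup>+t. ennreal (2 / (?w * d)) * (ennreal (ppow (-3/2) t) * indicator {1..} t) \<partial>lborel)"
  proof (rule nn_integral_mono)
    fix t :: real
    show "ennreal (indicator {1..} t * t powr (1/2 - 1) / Vol Q B t) \<le> ennreal (2 / (?w * d)) * (ennreal (ppow (-3/2) t) * indicator {1..} t)"
    proof (cases "1 \<le> t")
      case True
      have "t powr (1/2 - 1) / Vol Q B t \<le> t powr (1/2 - 1) / (?w * d * (t / 2))"
        using V[OF True] w d True by (intro divide_left_mono mult_pos_pos order_less_le_trans[OF _ V[OF True]]) auto
      also have "\<dots> = 2 / (?w * d) * (t powr (1/2 - 1) / t)" by simp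
      also have "t powr (1/2 - 1) / t = ppow (-3/2) t"
        using True powr_diff[of t "1/2 - 1" 1] by (simp add: ppow_def)
      finally show ?thesis using True w d by (simp add: ennreal_mult[symmetric] ennreal_leI)
    qed simp
  qed
  also have "\<dots> = ennreal (2 / (?w * d)) * ennreal (- (1 powr (-3/2 + 1)) / (-3/2 + 1))"
    by (subst nn_integral_cmult) (auto simp: nn_integral_ppow_to_inf)
  also have "\<dots> < \<infinity>" by (simp add: ennreal_mult_less_top)
  finally have "(\<integral>\<^sup>+t. ennreal (indicator {1..} t * t powr (1/2 - 1) / Vol Q B t) \<partial>lborel) < \<infinity>" .
  moreover define A where "A = {\<alpha>::real. \<alpha> > 0 \<and>
    (\<integral>\<^sup>+ t. ennreal (indicator {1..} t * t powr (\<alpha>/2 - 1) / Vol Q B t) \<partial>lborel) < \<infinity>}"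
  ultimately have "1 \<in> A" by simp
  then have "Dinfty Q B = Sup (ereal ` A)" "ereal 1 \<le> Sup (ereal ` A)"
    unfolding Dinfty_def Let_def A_def[symmetric] by (auto intro: Sup_upper)
  then show ?thesis by (simp add: one_ereal_def)
qed

text \<open>Closeness m/6 gives an L^1 norm of f of at most 7m/6, and the volume condition then
  gives |P_t f| \<le> (1 / (2m)) (7m/6) = 7/12. Integrating 1 \<le> |f - 1| + |P_t f - f| + 7/12
  over S leaves 1 - 1/6 - 7/12 = 1/4 of m for the smoothing estimate.\<close>

lemma L1norm_fracA_ge:
  fixes Q B :: "real^'n^'n"
  assumes adm: "admissible Q B" and tr: "0 \<le> trace B" and N: "2 \<le> CARD('n)"
    and s: "0 < s" "s < 1/2" and t: "0 < t" and f: "schwartz f"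
    and S: "S \<in> sets borel" "emeasure lborel S = ennreal m" and m: "0 < m"
    and V: "2 * heat_const TYPE('n) * m \<le> Vol Q B t"
    and \<epsilon>: "L1norm (\<lambda>x. f x - indicator S x) \<le> ennreal (m / 6)"
  shows "ennreal (m / (4 * (sg_const s * t powr s))) \<le> L1norm (fracA Q B s f)"
proof -
  let ?g = "L1norm (fracA Q B s f)"
  let ?c = "heat_const TYPE('n)"
  have c: "0 < ?c" by (rule heat_const_pos)
  have V0: "0 < Vol Q B t" using V c m by (smt (verit) mult_pos_pos)
  have A: "0 < sg_const s * t powr s" using sg_const_pos[OF s] t by simp
  have [measurable]: "S \<in> sets borel" by (rule S)
  obtain K' L' where f_meas: "f \<in> borel_measurable borel"
    using schwartz_bounded_lipschitz[OF f] by blast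
  note [measurable] = f_meas
  define I where "I = m + m / 6"
  have I0: "0 \<le> I" using m by (simp add: I_def)
  have "L1norm f \<le> (\<integral>\<^sup>+x. indicator S x + ennreal \<bar>f x - indicator S x\<bar> \<partial>lborel)"
    unfolding L1norm_def
    by (intro nn_integral_mono) (auto simp: ennreal_plus[symmetric] ennreal_1[symmetric] simp del: ennreal_plus ennreal_1 intro!: ennreal_leI split: split_indicator)
  also have "\<dots> = ennreal m + L1norm (\<lambda>x. f x - indicator S x)"
    unfolding L1norm_def by (subst nn_integral_add) (auto simp: S)
  also have "\<dots> \<le> ennreal m + ennreal (m / 6)" by (intro add_left_mono \<epsilon>)
  also have "\<dots> = ennreal I" using m unfolding I_def by (intro ennreal_plus[symmetric]) auto
  finally have I: "L1norm f \<le> ennreal I" .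
  obtain K L where kd: "kernel_datum (pk Q B) f K L I s"
    by (rule kernel_datum_schwartz[OF adm tr N f I I0 s])
  have Pb: "\<bar>Psg Q B t f x\<bar> \<le> 7 / 12" for x
  proof -
    have "\<bar>Psg Q B t f x\<bar> \<le> ?c / Vol Q B t * I"
      using kernel_datum.P_le_sup[OF kd pk_le_Vol[OF adm t], of x] c V0 kernel_datum_P_eq_Psg[OF kd t, of x] by simp
    also have "\<dots> \<le> 1 / (2 * m) * I"
      using V c m V0 I0 by (intro mult_right_mono) (simp_all add: field_simps)
    also have "\<dots> = 7 / 12" using m by (simp add: I_def field_simps)
    finally show ?thesis .
  qed
  have Pm[measurable]: "(\<lambda>x. Psg Q B t f x) \<in> borel_measurable borel"
  proof -
    interpret kernel_datum "pk Q B" f K L I s by (rule kd)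
    have "(\<lambda>x. P t x) \<in> borel_measurable borel" by measurable
    then show ?thesis by (simp add: kernel_datum_P_eq_Psg[OF kd t])
  qed
  have "ennreal m = (\<integral>\<^sup>+x. indicator S x \<partial>lborel)" by (simp add: S)
  also have "\<dots> \<le> (\<integral>\<^sup>+x. ennreal \<bar>f x - indicator S x\<bar> + ennreal \<bar>Psg Q B t f x - f x\<bar> + ennreal (7/12) * indicator S x \<partial>lborel)"
  proof (rule nn_integral_mono)
    fix x
    show "indicator S x \<le> ennreal \<bar>f x - indicator S x\<bar> + ennreal \<bar>Psg Q B t f x - f x\<bar> + ennreal (7/12) * indicator S x"
    proof (cases "x \<in> S")
      case True
      have "1 \<le> \<bar>f x - 1\<bar> + \<bar>Psg Q B t f x - f x\<bar> + 7/12" using Pb[of x] by linarith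
      then have "ennreal 1 \<le> ennreal (\<bar>f x - 1\<bar> + \<bar>Psg Q B t f x - f x\<bar> + 7/12)" by (rule ennreal_leI)
      then show ?thesis using True by simp
    qed simp
  qed
  also have "\<dots> = L1norm (\<lambda>x. f x - indicator S x) + L1norm (\<lambda>x. Psg Q B t f x - f x) + ennreal (7/12) * ennreal m"
    unfolding L1norm_def by (simp add: nn_integral_add nn_integral_cmult S)
  also have "\<dots> \<le> ennreal (m / 6) + ennreal (sg_const s * t powr s) * ?g + ennreal (7/12 * m)"
    using m by (intro add_mono \<epsilon> L1norm_Psg_diff_le[OF kd t]) (simp add: ennreal_mult[symmetric])
  finally have main: "ennreal m \<le> ennreal (m / 6) + ennreal (sg_const s * t powr s) * ?g + ennreal (7/12 * m)" .
  show ?thesis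
  proof (cases "?g = \<infinity>")
    case False
    then obtain g where g: "?g = ennreal g" "0 \<le> g" by (cases ?g) auto
    have "m \<le> m / 6 + sg_const s * t powr s * g + 7/12 * m"
    proof -
      have "ennreal m \<le> ennreal (m / 6 + sg_const s * t powr s * g + 7/12 * m)"
        using main A m g by (simp add: ennreal_mult[symmetric] ennreal_plus[symmetric] del: ennreal_plus)
      then show ?thesis using A m g by (subst (asm) ennreal_le_iff) auto
    qed
    then have "m / (4 * (sg_const s * t powr s)) \<le> g" using A by (simp add: field_simps)
    then show ?thesis unfolding g by (rule ennreal_leI)
  qed simp
qed

text \<open>E is only Lebesgue measurable, while the norms integrate against \<open>lborel\<close>;
  replacing E by S changes its indicator on a null set only.\<close>

lemma sets_lebesgue_borel_version:
  fixes E :: "'a::euclidean_space set"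
  assumes "E \<in> sets lebesgue"
  obtains S where "S \<in> sets borel" "AE x in lborel. x \<in> E \<longleftrightarrow> x \<in> S" "emeasure lebesgue E = emeasure lborel S"
proof -
  obtain S N N' where E: "E = S \<union> N" "N \<subseteq> N'" "N' \<in> null_sets lborel" "S \<in> sets lborel"
    using sets_completionE[OF assms] by metis
  have "AE x in lborel. x \<notin> N'" by (rule AE_not_in[OF E(3)])
  then have "AE x in lborel. x \<in> E \<longleftrightarrow> x \<in> S" by eventually_elim (use E in auto)
  moreover have "emeasure lebesgue E = emeasure lborel S"
  proof -
    have "N \<in> null_sets lebesgue"
      using E(2,3) by (meson null_sets_completionI null_sets_completion_subset)
    then have "emeasure lebesgue E = emeasure lebesgue S"
      unfolding E(1) using E(4) by (intro emeasure_Un_null_set) auto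
    then show ?thesis using E(4) by simp
  qed
  ultimately show thesis using that[of S] E(4) by simp
qed

text \<open>Every approximating sequence is eventually within m/6 of the indicator, so one bound
  holds along its tail, hence for its lower limit, and hence for the infimum over sequences.\<close>

theorem perimA_ge:
  fixes Q B :: "real^'n^'n"
  assumes adm: "admissible Q B" and tr: "0 \<le> trace B" and N: "2 \<le> CARD('n)"
    and s: "0 < s" "s < 1/2" and t: "0 < t"
    and E: "E \<in> sets lebesgue" "emeasure lebesgue E < \<infinity>" and m: "0 < measure lebesgue E"
    and V: "2 * heat_const TYPE('n) * measure lebesgue E \<le> Vol Q B t"
  shows "ennreal (measure lebesgue E / (4 * (sg_const s * t powr s))) \<le> perimA Q B s E"
  unfolding perimA_def
proof (rule INF_greatest)
  let ?m = "measure lebesgue E"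
  fix fs assume "fs \<in> approx_seqs (indicator E)"
  then have fs: "\<And>k. schwartz (fs k)" "(\<lambda>k. L1norm (\<lambda>x. fs k x - indicator E x)) \<longlonglongrightarrow> 0"
    by (auto simp: approx_seqs_def)
  obtain S where S: "S \<in> sets borel" "AE x in lborel. x \<in> E \<longleftrightarrow> x \<in> S" "emeasure lebesgue E = emeasure lborel S"
    by (rule sets_lebesgue_borel_version[OF E(1)])
  have Sm: "emeasure lborel S = ennreal ?m"
    using E(2) unfolding S(3)[symmetric] by (simp add: emeasure_eq_ennreal_measure)
  have L: "L1norm (\<lambda>x. fs k x - indicator E x) = L1norm (\<lambda>x. fs k x - indicator S x)" for k
    unfolding L1norm_def by (rule nn_integral_cong_AE) (use S(2) in eventually_elim, auto simp: indicator_def)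
  have "eventually (\<lambda>k. L1norm (\<lambda>x. fs k x - indicator S x) < ennreal (?m / 6)) sequentially"
    using order_tendstoD(2)[OF fs(2), of "ennreal (?m / 6)"] m unfolding L by simp
  then have "eventually (\<lambda>k. ennreal (?m / (4 * (sg_const s * t powr s))) \<le> L1norm (fracA Q B s (fs k))) sequentially"
  proof eventually_elim
    case (elim k)
    show ?case
      by (rule L1norm_fracA_ge[OF adm tr N s t fs(1) S(1) Sm m V]) (use elim in simp)
  qed
  then show "ennreal (?m / (4 * (sg_const s * t powr s))) \<le> liminf (\<lambda>k. L1norm (fracA Q B s (fs k)))"
    by (rule Liminf_bounded)
qed

theorem theorem1p2:
  fixes D0 Dinf \<gamma> s :: real
  assumes "CARD('n::finite) \<ge> 2"
    and "\<gamma> > 0" and "D0 > Dinf"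
    and "0 < s" and "s < 1/2"
  shows "\<exists>i>0. \<forall>(Q::real^'n^'n) (B::real^'n^'n).
           admissible Q B \<and> trace B \<ge> 0 \<and> is_D0 Q B D0 \<and> Dinfty Q B = ereal Dinf \<and>
           (\<forall>t>0. Vol Q B t \<ge> \<gamma> * min (t powr (D0/2)) (t powr (Dinf/2))) \<longrightarrow>
           (\<forall>E. E \<in> sets lebesgue \<and> emeasure lebesgue E < \<infinity> \<longrightarrow>
              perimA Q B s E \<ge> ennreal (i * min (measure lebesgue E powr ((D0 - 2 * s)/D0))
                                             (measure lebesgue E powr ((Dinf - 2 * s)/Dinf))))"
proof -
  \<comment> \<open>Chosen so that \<gamma> \<mu> m is the volume 2 c m which
    \<open>perimA_ge\<close> asks for.\<close>
  define \<mu> where "\<mu> = 2 * heat_const TYPE('n) / \<gamma>"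
  have \<mu>: "0 < \<mu>" using heat_const_pos[where 'n='n] assms(2) by (simp add: \<mu>_def)
  \<comment> \<open>The part of t powr s that comes from \<mu>. It is fixed before Q and B, hence
    before the dimensions are known to be positive; a power of \<mu> > 0 is positive in any
    case.\<close>
  define M where "M = max (\<mu> powr (2 * s / D0)) (\<mu> powr (2 * s / Dinf))"
  have M: "0 < M" using \<mu> by (simp add: M_def less_max_iff_disj)
  define i where "i = 1 / (4 * (sg_const s * M))"
  have A: "0 < sg_const s" by (rule sg_const_pos[OF assms(4,5)])
  have i: "0 < i" using A M by (simp add: i_def)
  have "ennreal (i * min (measure lebesgue E powr ((D0 - 2 * s)/D0)) (measure lebesgue E powr ((Dinf - 2 * s)/Dinf)))
      \<le> perimA Q B s E"
    if adm: "admissible Q B" and tr: "0 \<le> trace B" and D: "Dinfty Q B = ereal Dinf"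
      and V: "\<And>t. 0 < t \<Longrightarrow> \<gamma> * min (t powr (D0/2)) (t powr (Dinf/2)) \<le> Vol Q B t"
      and E: "E \<in> sets lebesgue" "emeasure lebesgue E < \<infinity>"
    for Q B :: "real^'n^'n" and E
  \<comment> \<open>For a null set both powers are 0, since 0 powr a = 0, and the bound is
    trivial.\<close>
  proof (cases "measure lebesgue E = 0")
    case False
    define m where "m = measure lebesgue E"
    have m: "0 < m" using False by (simp add: m_def zero_less_measure_iff)
    \<comment> \<open>Positivity of \<open>Dinf\<close> comes from the volume growth, and D0 > Dinf
      passes it on to \<open>D0\<close>.\<close>
    have Dinf: "1 \<le> Dinf" using Dinfty_ge_1[OF adm tr assms(1)] unfolding D by simp
    then have D0: "0 < D0" "0 < Dinf" using assms(3) by auto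
    define t where "t = max ((\<mu> * m) powr (2 / D0)) ((\<mu> * m) powr (2 / Dinf))"
    have t: "0 < t" using \<mu> m by (simp add: t_def less_max_iff_disj)
    have pw: "\<mu> * m \<le> t powr (d / 2)" if d: "0 < d" "(\<mu> * m) powr (2 / d) \<le> t" for d
    proof -
      have "\<mu> * m = ((\<mu> * m) powr (2 / d)) powr (d / 2)" using d \<mu> m by (simp add: powr_powr)
      also have "\<dots> \<le> t powr (d / 2)" using d by (intro powr_mono2) auto
      finally show ?thesis .
    qed
    have "\<mu> * m \<le> min (t powr (D0/2)) (t powr (Dinf/2))"
      using pw[OF D0(1)] pw[OF D0(2)] by (simp add: t_def)
    then have "\<gamma> * (\<mu> * m) \<le> \<gamma> * min (t powr (D0/2)) (t powr (Dinf/2))"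
      using assms(2) by (intro mult_left_mono) auto
    also have "\<dots> \<le> Vol Q B t" by (rule V[OF t])
    finally have Vt: "2 * heat_const TYPE('n) * m \<le> Vol Q B t" using assms(2) by (simp add: \<mu>_def)
    have ge: "ennreal (m / (4 * (sg_const s * t powr s))) \<le> perimA Q B s E"
      unfolding m_def by (rule perimA_ge[OF adm tr assms(1) assms(4,5) t E]) (use m Vt in \<open>simp_all add: m_def\<close>)
    define X where "X = max (m powr (2 * s / D0)) (m powr (2 * s / Dinf))"
    have X: "0 < X" using m by (simp add: X_def less_max_iff_disj)
    have ts: "t powr s \<le> M * X"
    proof -
      have q: "((\<mu> * m) powr (2 / d)) powr s \<le> M * X" if "\<mu> powr (2 * s / d) \<le> M" "m powr (2 * s / d) \<le> X" for d
      proof -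
        have "((\<mu> * m) powr (2 / d)) powr s = \<mu> powr (2 * s / d) * m powr (2 * s / d)"
          using \<mu> m by (simp add: powr_powr powr_mult)
        also have "\<dots> \<le> M * X" using that M by (intro mult_mono) auto
        finally show ?thesis .
      qed
      have "((\<mu> * m) powr (2 / D0)) powr s \<le> M * X" "((\<mu> * m) powr (2 / Dinf)) powr s \<le> M * X"
        by (intro q; simp add: M_def X_def)+
      then show ?thesis unfolding t_def by (simp add: max_def)
    qed
    have e: "m powr ((d - 2 * s) / d) = m / m powr (2 * s / d)" if "0 < d" for d
      using that m by (simp add: diff_divide_distrib powr_diff)
    \<comment> \<open>Both powers are m divided by m powr (2s/d), so their minimum is m over the
      maximum of the denominators, which is X.\<close>
    have "min (m powr ((D0 - 2 * s)/D0)) (m powr ((Dinf - 2 * s)/Dinf)) \<le> m / X"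
      unfolding e[OF D0(1)] e[OF D0(2)] X_def by (simp add: max_def)
    then have "i * min (m powr ((D0 - 2 * s)/D0)) (m powr ((Dinf - 2 * s)/Dinf)) \<le> i * (m / X)"
      using i by (intro mult_left_mono) auto
    also have "\<dots> = m / (4 * (sg_const s * (M * X)))" by (simp add: i_def mult_ac)
    also have "\<dots> \<le> m / (4 * (sg_const s * t powr s))"
      using m A M X t ts by (intro divide_left_mono mult_left_mono mult_pos_pos) auto
    finally show ?thesis using ge unfolding m_def[symmetric] by (meson ennreal_leI order_trans)
  qed simp
  then show ?thesis using i by blast
qed

end
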